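(* Let $s,s'\in\mathbb C$ with $\chi(s),\chi(s')\notin\{\pm1\}$, and let $\phi,\phi'\colon\mathfrak X\to\mathbb C$ be $\Gamma$-invariant functions with $\Delta\phi=\chi(s)\phi$ and $\Delta\phi'=\chi(s')\phi'$. Then, as elements of $\mathcal D'(\mathfrak P_\Gamma)$, $$\mathrm{PS}^\Gamma_{\phi,\phi'}=\mathbf I_+(s)(\phi)\otimes\mathbf I_-(-\overline{s'})(\overline{\phi'}).$$
   Context: Let $q\ge2$ and let $\mathfrak G=(\mathfrak X,\mathfrak E)$ be the $(q+1)$-regular tree, with vertex set $\mathfrak X$, set $\mathfrak E\subseteq\mathfrak X^2$ of directed edges (both orientations of each edge) and graph distance $d$. For $\vec e=(a,b)$ put $\iota(\vec e)=a$, $\tau(\vec e)=b$. A (forward) chain is a sequence $(\vec e_1,\vec e_2,\dots)$ of directed edges with $\tau(\vec e_i)=\iota(\vec e_{i+1})$ and $\tau(\vec e_{i+1})\ne\iota(\vec e_i)$. The boundary $\Omega$ is the set of infinite chains modulo "eventually equal up to an index shift", with the topology generated by the sets $\partial_+\vec e$ of classes represented by chains starting with $\vec e$; it is compact and totally disconnected. For $x\in\mathfrak X,\omega\in\Omega$, $[x,\omega)$ is the geodesic ray from $x$ to $\omega$; for $\omega\neq\omega'$, $]\omega',\omega[$ is the vertex set of the bi-infinite geodesic joining them. Fix a base vertex $o$. The horocycle bracket is $\langle x,\omega\rangle=d(o,y)-d(x,y)$, where $[o,\omega)\cap[x,\omega)=[y,\omega)$. For $s\in\mathbb C$ let $p_s(x,\omega)=q^{(\frac12+is)\langle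 x,\omega\rangle}$, $\chi(s)=\frac{\sqrt q}{q+1}(q^{is}+q^{-is})$, and $\Delta f(x)=\frac1{q+1}\sum_{d(x,y)=1}f(y)$. $\mathcal D'(\Omega)$ is the algebraic dual of the space of locally constant functions on $\Omega$ (equivalently finitely additive complex measures on clopen sets); we write $\int f\,d\mu=\mu(f)$, similarly for tensor products $\mu\otimes\mu'$ on $\Omega\times\Omega$, and $\overline\mu(f):=\overline{\mu(\overline f)}$. The Poisson transform is $\mathcal P_s\mu(x)=\int_\Omega p_s(x,\omega)\,d\mu(\omega)$; if $\chi(s)\notin\{\pm1\}$ it is a linear bijection from $\mathcal D'(\Omega)$ onto $\{\phi:\Delta\phi=\chi(s)\phi\}$, and the boundary value $\mu_{s,\phi}$ of such $\phi$ is the unique $\mu$ with $\mathcal P_s\mu=\phi$. $\Gamma\le\mathrm{Aut}(\mathfrak G)$ is a discrete subgroup acting freely on $\mathfrak X$ with finite quotient $\Gamma\backslash\mathfrak X$. Let $\mathfrak P$ be the set of triples $(\omega',\omega,x)\in\Omega\times\Omega\times\mathfrak X$ with $\omega'\ne\omega$ and $x\in]\omega',\omega[$ (subspace topology, $\mathfrak X$ discrete), with diagonal $\Gamma$-action and compact quotient $\mathfrak P_\Gamma=\Gamma\backslash\mathfrak P$; $C^{\mathrm{lc}}(\mathfrak P_\Gamma)$ denotes the $\Gamma$-invariant locally constant functions on $\mathfrak P$ and $\mathcal D'(\mathfrak P_\Gamma)$ its algebraic dual. Choose $\Xi_{\mathfrak P}$ locally constant with compact support on $\mathfrak P$ and $\sum_{\gamma\in\Gamma}\Xi_{\mathfrak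 P}(\gamma p)=1$ for all $p$. The Patterson–Sullivan distribution is $$\mathrm{PS}^\Gamma_{\phi,\phi'}(F)=\int_{\Omega\times\Omega}\sum_{x\in]\omega',\omega[}\Xi_{\mathfrak P}(\omega',\omega,x)F(\omega',\omega,x)\,p_s(x,\omega)\,p_{-\overline{s'}}(x,\omega')\,d\mu_{s,\phi}(\omega)\,d\overline{\mu_{s',\phi'}}(\omega'),$$ the integrand being $0$ for $\omega=\omega'$ (it is independent of the choice of $\Xi_{\mathfrak P}$). Shift spaces: $\mathfrak P^+$ is the set of forward chains $(\vec e_1,\vec e_2,\dots)$, $\mathfrak P^-$ the set of backward chains $(\dots,\vec e_2,\vec e_1)$ (with $\tau(\vec e_{i+1})=\iota(\vec e_i)$, $\iota(\vec e_{i+1})\neq\tau(\vec e_i)$), each with the topology generated by cylinder sets fixing finitely many edges at the start $\vec e_1,\dots,\vec e_n$. $\pi_+(\vec e_1,\dots)=\iota(\vec e_1)$, $\pi_-(\dots,\vec e_1)=\tau(\vec e_1)$. $\mathcal D'(\mathfrak P^\pm)$ is the algebraic dual of the compactly supported locally constant functions. Transfer operators: $\mathcal L_+f(\vec e_1,\vec e_2,\dots)=\sum f(\vec e_0,\vec e_1,\dots)$ over $\vec e_0$ with $(\vec e_0,\vec e_1,\dots)\in\mathfrak P^+$, and $\mathcal L_-f(\dots,\vec e_2,\vec e_1)=\sum f(\dots,\vec e_1,\vec e_0)$ over $\vec e_0$ with $(\dots,\vec e_1,\vec e_0)\in\mathfrak P^-$; $\mathcal L'_\pm$ are their transposes and $\mathcal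 E_s(\mathcal L'_\pm)=\{u\in\mathcal D'(\mathfrak P^\pm):\mathcal L'_\pm u=q^{\frac12+is}u\}$. The pushforward is $\pi_{\pm,*}u(x)=u(\mathbb 1_{\pi_\pm^{-1}(x)})$; for $\chi(s)\notin\{\pm1\}$ it restricts to a $\Gamma$-equivariant linear isomorphism $\mathcal E_s(\mathcal L'_\pm)\to\{\phi:\Delta\phi=\chi(s)\phi\}$. For $\Gamma$-invariant such $\phi$, $\mathbf I_\pm(s)(\phi)\in\mathcal D'(\mathfrak P^\pm_\Gamma)$ ($\mathfrak P^\pm_\Gamma=\Gamma\backslash\mathfrak P^\pm$, distributions = algebraic dual of $\Gamma$-invariant locally constant functions) is $F\mapsto U((F\circ\mathrm{pr})\,\Xi_\pm)$ with $U=(\pi_{\pm,*})^{-1}(\phi)$ and $\Xi_\pm$ compactly supported locally constant on $\mathfrak P^\pm$ with $\sum_\gamma\Xi_\pm(\gamma\mathbf p)=1$. For $u_\pm\in\mathcal D'(\mathfrak P^\pm_\Gamma)$, $(u_+\otimes u_-)(\varphi)=u_+\big(\mathbf p_+\mapsto u_-(\varphi(\mathbf p_+,\cdot))\big)$. $\mathfrak P_\Gamma$ embeds in $\mathfrak P^+_\Gamma\times\mathfrak P^-_\Gamma$ via $\Gamma(\omega',\omega,x)\mapsto(\Gamma[x,\omega),\Gamma\mathbf p_-)$, where $[x,\omega)$ is viewed as a forward chain and $\mathbf p_-$ is the backward chain along $]\omega',\omega[$ coming from $\omega'$ and ending at $x$; functions on $\mathfrak P_\Gamma$ are extended by zero,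 so $u_+\otimes u_-$ defines an element of $\mathcal D'(\mathfrak P_\Gamma)$. *)

theory Defs
  imports "HOL-Analysis.Analysis"
begin

section \<open>The (q+1)-regular tree\<close>

text \<open>The tree is given by its set E of directed edges (both orientations of each edge).\<close>

definition regular_tree :: "('v \<times> 'v) set \<Rightarrow> nat \<Rightarrow> bool" where
  "regular_tree E q \<longleftrightarrow>
     (\<forall>x y. (x, y) \<in> E \<longrightarrow> (y, x) \<in> E) \<and>
     (\<forall>x. (x, x) \<notin> E) \<and>
     (\<forall>x. finite {y. (x, y) \<in> E} \<and> card {y. (x, y) \<in> E} = q + 1) \<and>
     (\<forall>x y. (x, y) \<in> E\<^sup>*) \<and>
     (\<forall>n (w :: nat \<Rightarrow> 'v). 1 \<le> n \<and> (\<forall>i<n. (w i, w (Suc i)) \<in> E) \<and>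
          (\<forall>i. Suc i < n \<longrightarrow> w (Suc (Suc i)) \<noteq> w i) \<longrightarrow> w n \<noteq> w 0)"

text \<open>graph distance\<close>
definition gdist :: "('v \<times> 'v) set \<Rightarrow> 'v \<Rightarrow> 'v \<Rightarrow> nat" where
  "gdist E x y = (LEAST n. (x, y) \<in> E ^^ n)"

section \<open>Chains, boundary\<close>

type_synonym 'v chn = "nat \<Rightarrow> 'v \<times> 'v"

text \<open>forward chains (e_1, e_2, ...) with e_{n+1} stored at index n\<close>
definition fchain :: "('v \<times> 'v) set \<Rightarrow> 'v chn \<Rightarrow> bool" where
  "fchain E c \<longleftrightarrow> (\<forall>n. c n \<in> E) \<and> (\<forall>n. snd (c n) = fst (c (Suc n)))
      \<and> (\<forall>n. snd (c (Suc n)) \<noteq> fst (c n))"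

text \<open>backward chains (..., e_2, e_1) with e_{n+1} stored at index n\<close>
definition bchain :: "('v \<times> 'v) set \<Rightarrow> 'v chn \<Rightarrow> bool" where
  "bchain E b \<longleftrightarrow> (\<forall>n. b n \<in> E) \<and> (\<forall>n. snd (b (Suc n)) = fst (b n))
      \<and> (\<forall>n. fst (b (Suc n)) \<noteq> snd (b n))"

definition Pplus :: "('v \<times> 'v) set \<Rightarrow> 'v chn set" where
  "Pplus E = {c. fchain E c}"

definition Pminus :: "('v \<times> 'v) set \<Rightarrow> 'v chn set" where
  "Pminus E = {b. bchain E b}"

definition pi_plus :: "'v chn \<Rightarrow> 'v" where "pi_plus c = fst (c 0)"
definition pi_minus :: "'v chn \<Rightarrow> 'v" where "pi_minus b = snd (b 0)"

text \<open>eventually equal up to an index shift\<close>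
definition chain_rel :: "('v \<times> 'v) set \<Rightarrow> ('v chn \<times> 'v chn) set" where
  "chain_rel E = {(c, c'). fchain E c \<and> fchain E c' \<and> (\<exists>k m. \<forall>n. c (n + k) = c' (n + m))}"

text \<open>boundary points are equivalence classes of forward chains\<close>
definition Omega :: "('v \<times> 'v) set \<Rightarrow> 'v chn set set" where
  "Omega E = Pplus E // chain_rel E"

definition bclass :: "('v \<times> 'v) set \<Rightarrow> 'v chn \<Rightarrow> 'v chn set" where
  "bclass E c = chain_rel E `` {c}"

text \<open>the open-compact sets \<partial>_+ e\<close>
definition bdry_set :: "('v \<times> 'v) set \<Rightarrow> 'v \<times> 'v \<Rightarrow> 'v chn set set" where
  "bdry_set E e = {\<omega> \<in> Omega E. \<exists>c\<in>\<omega>. c 0 = e}"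

text \<open>geodesic ray [x,\<omega>) as a forward chain\<close>
definition ray :: "'v \<Rightarrow> 'v chn set \<Rightarrow> 'v chn" where
  "ray x \<omega> = (THE c. c \<in> \<omega> \<and> fst (c 0) = x)"

definition ray_verts :: "'v \<Rightarrow> 'v chn set \<Rightarrow> 'v set" where
  "ray_verts x \<omega> = range (\<lambda>n. fst (ray x \<omega> n))"

text \<open>horocycle bracket with base vertex bo\<close>
definition horo :: "('v \<times> 'v) set \<Rightarrow> 'v \<Rightarrow> 'v \<Rightarrow> 'v chn set \<Rightarrow> int" where
  "horo E bo x \<omega> = (THE k. \<exists>y. ray_verts bo \<omega> \<inter> ray_verts x \<omega> = ray_verts y \<omega> \<and>
       k = int (gdist E bo y) - int (gdist E x y))"

text \<open>vertex set ]\<omega>',\<omega>[ of the bi-infinite geodesic joining \<omega>' and \<omega>\<close>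
definition geod_verts :: "('v \<times> 'v) set \<Rightarrow> 'v chn set \<Rightarrow> 'v chn set \<Rightarrow> 'v set" where
  "geod_verts E \<omega>' \<omega> = {x. \<exists>g :: int \<Rightarrow> 'v.
      (\<forall>n. (g n, g (n + 1)) \<in> E) \<and> (\<forall>n. g (n + 1) \<noteq> g (n - 1)) \<and>
      (\<lambda>n::nat. (g (int n), g (int n + 1))) \<in> \<omega> \<and>
      (\<lambda>n::nat. (g (- int n), g (- int n - 1))) \<in> \<omega>' \<and> x \<in> range g}"

section \<open>Poisson kernel, Laplacian\<close>

definition pker :: "('v \<times> 'v) set \<Rightarrow> nat \<Rightarrow> 'v \<Rightarrow> complex \<Rightarrow> 'v \<Rightarrow> 'v chn set \<Rightarrow> complex" where
  "pker E q bo s x \<omega> = (of_nat q :: complex) powr ((1/2 + \<i> * s) * of_int (horo E bo x \<omega>))"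

definition chi :: "nat \<Rightarrow> complex \<Rightarrow> complex" where
  "chi q s = of_real (sqrt (real q) / (real q + 1)) *
      ((of_nat q :: complex) powr (\<i> * s) + (of_nat q :: complex) powr (- \<i> * s))"

definition lap :: "('v \<times> 'v) set \<Rightarrow> nat \<Rightarrow> ('v \<Rightarrow> complex) \<Rightarrow> 'v \<Rightarrow> complex" where
  "lap E q f x = (1 / (of_nat q + 1)) * (\<Sum>y\<in>{y. (x, y) \<in> E}. f y)"

section \<open>Distributions on the boundary\<close>

definition lc_Omega :: "('v \<times> 'v) set \<Rightarrow> ('v chn set \<Rightarrow> complex) \<Rightarrow> bool" where
  "lc_Omega E f \<longleftrightarrow> (\<forall>\<omega>\<in>Omega E. \<exists>e\<in>E. \<omega> \<in> bdry_set E e \<and> (\<forall>\<eta>\<in>bdry_set E e. f \<eta> = f \<omega>))"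

text \<open>test functions: locally constant functions on \<Omega> (extended by 0 off \<Omega>)\<close>
definition test_Omega :: "('v \<times> 'v) set \<Rightarrow> ('v chn set \<Rightarrow> complex) set" where
  "test_Omega E = {f. lc_Omega E f \<and> (\<forall>\<omega>. \<omega> \<notin> Omega E \<longrightarrow> f \<omega> = 0)}"

text \<open>algebraic dual of a space T of test functions; functionals are normalised to vanish
  off T so that they are determined by their values on T\<close>
definition is_dual :: "('a \<Rightarrow> complex) set \<Rightarrow> (('a \<Rightarrow> complex) \<Rightarrow> complex) \<Rightarrow> bool" where
  "is_dual T u \<longleftrightarrow> (\<forall>f\<in>T. \<forall>g\<in>T. u (\<lambda>a. f a + g a) = u f + u g) \<and>
     (\<forall>c. \<forall>f\<in>T. u (\<lambda>a. c * f a) = c * u f) \<and> (\<forall>f. f \<notin> T \<longrightarrow> u f = 0)"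

definition integ_Omega :: "('v \<times> 'v) set \<Rightarrow> (('v chn set \<Rightarrow> complex) \<Rightarrow> complex)
     \<Rightarrow> ('v chn set \<Rightarrow> complex) \<Rightarrow> complex" where
  "integ_Omega E \<mu> f = \<mu> (\<lambda>\<omega>. if \<omega> \<in> Omega E then f \<omega> else 0)"

text \<open>complex conjugate distribution\<close>
definition conj_dist :: "(('a \<Rightarrow> complex) \<Rightarrow> complex) \<Rightarrow> ('a \<Rightarrow> complex) \<Rightarrow> complex" where
  "conj_dist \<mu> f = cnj (\<mu> (\<lambda>a. cnj (f a)))"

definition poisson :: "('v \<times> 'v) set \<Rightarrow> nat \<Rightarrow> 'v \<Rightarrow> complex
     \<Rightarrow> (('v chn set \<Rightarrow> complex) \<Rightarrow> complex) \<Rightarrow> 'v \<Rightarrow> complex" where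
  "poisson E q bo s \<mu> x = integ_Omega E \<mu> (\<lambda>\<omega>. pker E q bo s x \<omega>)"

text \<open>boundary value \<mu>_{s,\<phi>}\<close>
definition bval :: "('v \<times> 'v) set \<Rightarrow> nat \<Rightarrow> 'v \<Rightarrow> complex \<Rightarrow> ('v \<Rightarrow> complex)
     \<Rightarrow> ('v chn set \<Rightarrow> complex) \<Rightarrow> complex" where
  "bval E q bo s \<phi> = (THE \<mu>. is_dual (test_Omega E) \<mu> \<and> poisson E q bo s \<mu> = \<phi>)"

section \<open>Group action\<close>

definition act_chn :: "('v \<Rightarrow> 'v) \<Rightarrow> 'v chn \<Rightarrow> 'v chn" where
  "act_chn \<gamma> c = (\<lambda>n. (\<gamma> (fst (c n)), \<gamma> (snd (c n))))"

definition act_Omega :: "('v \<Rightarrow> 'v) \<Rightarrow> 'v chn set \<Rightarrow> 'v chn set" where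
  "act_Omega \<gamma> \<omega> = act_chn \<gamma> ` \<omega>"

definition act_P :: "('v \<Rightarrow> 'v) \<Rightarrow> 'v chn set \<times> 'v chn set \<times> 'v \<Rightarrow> 'v chn set \<times> 'v chn set \<times> 'v" where
  "act_P \<gamma> p = (case p of (\<omega>', \<omega>, x) \<Rightarrow> (act_Omega \<gamma> \<omega>', act_Omega \<gamma> \<omega>, \<gamma> x))"

text \<open>\<Gamma>: a group of automorphisms acting freely with finite quotient
  (discreteness is automatic for a free action)\<close>
definition good_group :: "('v \<times> 'v) set \<Rightarrow> ('v \<Rightarrow> 'v) set \<Rightarrow> bool" where
  "good_group E \<Gamma> \<longleftrightarrow>
     id \<in> \<Gamma> \<and> (\<forall>\<gamma>\<in>\<Gamma>. \<forall>\<delta>\<in>\<Gamma>. \<gamma> \<circ> \<delta> \<in> \<Gamma>) \<and> (\<forall>\<gamma>\<in>\<Gamma>. bij \<gamma> \<and> inv \<gamma> \<in> \<Gamma>) \<and>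
     (\<forall>\<gamma>\<in>\<Gamma>. \<forall>x y. (x, y) \<in> E \<longleftrightarrow> (\<gamma> x, \<gamma> y) \<in> E) \<and>
     (\<forall>\<gamma>\<in>\<Gamma>. \<forall>x. \<gamma> x = x \<longrightarrow> \<gamma> = id) \<and>
     finite ((\<lambda>x. (\<lambda>\<gamma>. \<gamma> x) ` \<Gamma>) ` UNIV)"

section \<open>The space \<PP> and its test functions\<close>

definition Pspace :: "('v \<times> 'v) set \<Rightarrow> ('v chn set \<times> 'v chn set \<times> 'v) set" where
  "Pspace E = {(\<omega>', \<omega>, x). \<omega>' \<in> Omega E \<and> \<omega> \<in> Omega E \<and> \<omega>' \<noteq> \<omega> \<and> x \<in> geod_verts E \<omega>' \<omega>}"

definition lc_P :: "('v \<times> 'v) set \<Rightarrow> ('v chn set \<times> 'v chn set \<times> 'v \<Rightarrow> complex) \<Rightarrow> bool" where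
  "lc_P E F \<longleftrightarrow> (\<forall>\<omega>' \<omega> x. (\<omega>', \<omega>, x) \<in> Pspace E \<longrightarrow>
      (\<exists>e'\<in>E. \<exists>e\<in>E. \<omega>' \<in> bdry_set E e' \<and> \<omega> \<in> bdry_set E e \<and>
        (\<forall>\<eta>' \<eta>. \<eta>' \<in> bdry_set E e' \<longrightarrow> \<eta> \<in> bdry_set E e \<longrightarrow> (\<eta>', \<eta>, x) \<in> Pspace E \<longrightarrow>
            F (\<eta>', \<eta>, x) = F (\<omega>', \<omega>, x))))"

text \<open>compact support in \<PP>: the fibres over vertices are compact open, so compactness of the
  support means it meets only finitely many fibres\<close>
definition cpt_P :: "('v \<times> 'v) set \<Rightarrow> ('v chn set \<times> 'v chn set \<times> 'v \<Rightarrow> complex) \<Rightarrow> bool" where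
  "cpt_P E F \<longleftrightarrow> finite {x. \<exists>\<omega>' \<omega>. (\<omega>', \<omega>, x) \<in> Pspace E \<and> F (\<omega>', \<omega>, x) \<noteq> 0}"

text \<open>\<Gamma>-invariant locally constant functions on \<PP>, i.e. C^lc(\<PP>_\<Gamma>)\<close>
definition Clc_PG :: "('v \<times> 'v) set \<Rightarrow> ('v \<Rightarrow> 'v) set \<Rightarrow> ('v chn set \<times> 'v chn set \<times> 'v \<Rightarrow> complex) \<Rightarrow> bool" where
  "Clc_PG E \<Gamma> F \<longleftrightarrow> lc_P E F \<and> (\<forall>\<gamma>\<in>\<Gamma>. \<forall>p\<in>Pspace E. F (act_P \<gamma> p) = F p)"

text \<open>cut-off functions \<Xi>: locally constant, compactly supported, \<Sum>_\<gamma> \<Xi>(\<gamma>p) = 1\<close>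
definition cutoff_P :: "('v \<times> 'v) set \<Rightarrow> ('v \<Rightarrow> 'v) set \<Rightarrow> ('v chn set \<times> 'v chn set \<times> 'v \<Rightarrow> complex) \<Rightarrow> bool" where
  "cutoff_P E \<Gamma> Xi \<longleftrightarrow> lc_P E Xi \<and> cpt_P E Xi \<and>
     (\<forall>p\<in>Pspace E. finite {\<gamma>\<in>\<Gamma>. Xi (act_P \<gamma> p) \<noteq> 0} \<and>
        (\<Sum>\<gamma>\<in>{\<gamma>\<in>\<Gamma>. Xi (act_P \<gamma> p) \<noteq> 0}. Xi (act_P \<gamma> p)) = 1)"

section \<open>Patterson--Sullivan distribution\<close>

definition PS :: "('v \<times> 'v) set \<Rightarrow> nat \<Rightarrow> 'v \<Rightarrow> ('v chn set \<times> 'v chn set \<times> 'v \<Rightarrow> complex)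
   \<Rightarrow> complex \<Rightarrow> complex \<Rightarrow> ('v \<Rightarrow> complex) \<Rightarrow> ('v \<Rightarrow> complex)
   \<Rightarrow> ('v chn set \<times> 'v chn set \<times> 'v \<Rightarrow> complex) \<Rightarrow> complex" where
  "PS E q bo Xi s s' \<phi> \<phi>' F =
     integ_Omega E (bval E q bo s \<phi>) (\<lambda>\<omega>.
       integ_Omega E (conj_dist (bval E q bo s' \<phi>')) (\<lambda>\<omega>'.
         if \<omega>' = \<omega> then 0 else
         (\<Sum>x\<in>{x \<in> geod_verts E \<omega>' \<omega>. Xi (\<omega>', \<omega>, x) \<noteq> 0}.
            Xi (\<omega>', \<omega>, x) * F (\<omega>', \<omega>, x) * pker E q bo s x \<omega> * pker E q bo (- cnj s') x \<omega>')))"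

section \<open>Shift spaces and transfer operators\<close>

text \<open>locally constant: determined near each point by finitely many initial edges\<close>
definition lc_shift :: "'v chn set \<Rightarrow> ('v chn \<Rightarrow> complex) \<Rightarrow> bool" where
  "lc_shift S f \<longleftrightarrow> (\<forall>c\<in>S. \<exists>n. \<forall>c'\<in>S. (\<forall>i<n. c' i = c i) \<longrightarrow> f c' = f c)"

text \<open>compact support: the fibres of the projection are compact open, so compact support
  means the support lies over finitely many vertices\<close>
definition test_shift :: "'v chn set \<Rightarrow> ('v chn \<Rightarrow> 'v) \<Rightarrow> ('v chn \<Rightarrow> complex) set" where
  "test_shift S \<pi> = {f. lc_shift S f \<and> finite (\<pi> ` {c\<in>S. f c \<noteq> 0}) \<and> (\<forall>c. c \<notin> S \<longrightarrow> f c = 0)}"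

definition consC :: "'v \<times> 'v \<Rightarrow> 'v chn \<Rightarrow> 'v chn" where
  "consC e c = (\<lambda>n. case n of 0 \<Rightarrow> e | Suc m \<Rightarrow> c m)"

text \<open>transfer operator (L_+ for S = \<PP>^+, L_- for S = \<PP>^-): sum over admissible prepended
  (resp. appended) edges e_0\<close>
definition transfer :: "('v \<times> 'v) set \<Rightarrow> 'v chn set \<Rightarrow> ('v chn \<Rightarrow> complex) \<Rightarrow> 'v chn \<Rightarrow> complex" where
  "transfer E S f c = (if c \<in> S then (\<Sum>e\<in>{e\<in>E. consC e c \<in> S}. f (consC e c)) else 0)"

definition pushfw :: "'v chn set \<Rightarrow> ('v chn \<Rightarrow> 'v) \<Rightarrow> (('v chn \<Rightarrow> complex) \<Rightarrow> complex) \<Rightarrow> 'v \<Rightarrow> complex" where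
  "pushfw S \<pi> u x = u (\<lambda>c. if c \<in> S \<and> \<pi> c = x then 1 else 0)"

text \<open>(\<pi>_{\<pm>,*})^{-1}(\<phi>) within \<E>_s(L'_\<pm>)\<close>
definition resonant :: "('v \<times> 'v) set \<Rightarrow> nat \<Rightarrow> 'v chn set \<Rightarrow> ('v chn \<Rightarrow> 'v) \<Rightarrow> complex
    \<Rightarrow> ('v \<Rightarrow> complex) \<Rightarrow> ('v chn \<Rightarrow> complex) \<Rightarrow> complex" where
  "resonant E q S \<pi> s \<phi> = (THE u. is_dual (test_shift S \<pi>) u \<and>
      (\<forall>f\<in>test_shift S \<pi>. u (transfer E S f) = (of_nat q :: complex) powr (1/2 + \<i> * s) * u f) \<and>
      pushfw S \<pi> u = \<phi>)"

definition cutoff_shift :: "'v chn set \<Rightarrow> ('v chn \<Rightarrow> 'v) \<Rightarrow> ('v \<Rightarrow> 'v) set \<Rightarrow> ('v chn \<Rightarrow> complex) \<Rightarrow> bool" where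
  "cutoff_shift S \<pi> \<Gamma> Xi \<longleftrightarrow> Xi \<in> test_shift S \<pi> \<and>
     (\<forall>c\<in>S. finite {\<gamma>\<in>\<Gamma>. Xi (act_chn \<gamma> c) \<noteq> 0} \<and>
        (\<Sum>\<gamma>\<in>{\<gamma>\<in>\<Gamma>. Xi (act_chn \<gamma> c) \<noteq> 0}. Xi (act_chn \<gamma> c)) = 1)"

text \<open>I(s)(\<phi>) applied to a \<Gamma>-invariant function F on the shift space\<close>
definition Iop :: "('v \<times> 'v) set \<Rightarrow> nat \<Rightarrow> 'v chn set \<Rightarrow> ('v chn \<Rightarrow> 'v) \<Rightarrow> ('v chn \<Rightarrow> complex)
    \<Rightarrow> complex \<Rightarrow> ('v \<Rightarrow> complex) \<Rightarrow> ('v chn \<Rightarrow> complex) \<Rightarrow> complex" where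
  "Iop E q S \<pi> Xi s \<phi> F = resonant E q S \<pi> s \<phi> (\<lambda>c. F c * Xi c)"

section \<open>Embedding of \<PP>_\<Gamma> into \<PP>^+_\<Gamma> \<times> \<PP>^-_\<Gamma> and the tensor product\<close>

definition compat :: "('v \<times> 'v) set \<Rightarrow> 'v chn \<Rightarrow> 'v chn \<Rightarrow> bool" where
  "compat E a b \<longleftrightarrow> a \<in> Pplus E \<and> b \<in> Pminus E \<and> pi_plus a = pi_minus b \<and> snd (a 0) \<noteq> fst (b 0)"

definition rev_chn :: "'v chn \<Rightarrow> 'v chn" where
  "rev_chn b = (\<lambda>n. (snd (b n), fst (b n)))"

text \<open>the point (\<omega>',\<omega>,x) of \<PP> corresponding to a compatible pair ([x,\<omega>), p_-)\<close>
definition triple_of :: "('v \<times> 'v) set \<Rightarrow> 'v chn \<Rightarrow> 'v chn \<Rightarrow> 'v chn set \<times> 'v chn set \<times> 'v" where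
  "triple_of E a b = (bclass E (rev_chn b), bclass E a, pi_plus a)"

text \<open>F on \<PP>_\<Gamma>, viewed as a function on \<PP>^+_\<Gamma> \<times> \<PP>^-_\<Gamma>, extended by zero\<close>
definition ext_zero :: "('v \<times> 'v) set \<Rightarrow> ('v \<Rightarrow> 'v) set \<Rightarrow> ('v chn set \<times> 'v chn set \<times> 'v \<Rightarrow> complex)
    \<Rightarrow> 'v chn \<Rightarrow> 'v chn \<Rightarrow> complex" where
  "ext_zero E \<Gamma> F a b =
     (if \<exists>\<gamma>1\<in>\<Gamma>. \<exists>\<gamma>2\<in>\<Gamma>. compat E (act_chn \<gamma>1 a) (act_chn \<gamma>2 b)
      then (let g = (SOME g. fst g \<in> \<Gamma> \<and> snd g \<in> \<Gamma> \<and> compat E (act_chn (fst g) a) (act_chn (snd g) b))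
            in F (triple_of E (act_chn (fst g) a) (act_chn (snd g) b)))
      else 0)"

text \<open>(u_+ \<otimes> u_-)(\<phi>) = u_+(p_+ \<mapsto> u_-(\<phi>(p_+, .)))\<close>
definition tensor_shift :: "(('v chn \<Rightarrow> complex) \<Rightarrow> complex) \<Rightarrow> (('v chn \<Rightarrow> complex) \<Rightarrow> complex)
    \<Rightarrow> ('v chn \<Rightarrow> 'v chn \<Rightarrow> complex) \<Rightarrow> complex" where
  "tensor_shift up um \<Phi> = up (\<lambda>a. um (\<lambda>b. \<Phi> a b))"

end

theory Submission
  imports Defs
begin

text \<open>
  Write \<open>z = q powr (1/2 + \<i> s)\<close>, let \<open>\<L>\<close> be the transfer operator on forward chains and \<open>\<mu>\<close> the
  boundary value of \<open>\<phi>\<close>. A chain in the class \<open>\<omega>\<close> is a ray \<open>[x, \<omega>)\<close>, and moving one step towards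
  \<open>\<omega>\<close> multiplies the Poisson kernel by \<open>z\<close>; hence \<open>f \<mapsto> \<mu> (\<omega> \<mapsto> \<Sum>x. p\<^sub>s(x, \<omega>) f [x, \<omega>))\<close> satisfies
  \<open>u (\<L> f) = z u f\<close> and pushes forward to \<open>\<phi>\<close>. Such a \<open>u\<close> is unique because \<open>\<L>\<close> shortens the
  dependence of \<open>f\<close> by one edge and, \<open>z\<^sup>2 \<noteq> 1\<close>, the values on one-edge cylinders are determined by
  \<open>\<phi>\<close>. The same formula on cylinders gives existence, also of \<open>\<mu>\<close>. Backward chains are treated by
  reversal.

  With these formulas the Patterson--Sullivan distribution becomes the product of the two resonant
  states, applied to \<open>\<Xi>\<^sub>P F\<close> on compatible pairs of chains. On the other side, unfolding the cut-off
  \<open>\<Xi>\<^sub>-\<close> against the sum over \<open>\<Gamma>\<close> hidden in the extension by zero leaves the same product applied to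
  \<open>\<Xi>\<^sub>+ F\<close>, and an invariant functional does not see the choice of the cut-off.
\<close>

section \<open>Walks, rays and the horocycle bracket\<close>

text \<open>\<open>bval\<close> and \<open>resonant\<close> are definite descriptions, so nothing
  can be computed before existence and uniqueness are settled. The exclusion of
  \<open>{1, -1}\<close> enters there: \<open>(q + 1) * chi q s\<close> equals
  \<open>z + q / z\<close>, which is \<plusminus>(q + 1) when z is \<plusminus>1, and z^2 - 1 is the
  determinant of the system on one-edge cylinders. Existence of the boundary value is the delicate
  half. Restricting the resonant state to chains from \<open>bo\<close> gives the only possible
  candidate, but its Poisson transform at another vertex becomes visible only after moving that
  vertex along a path to \<open>bo\<close>. Both sides of the theorem integrate in the same order,
  forward chains outside and backward chains inside, so functionals are never interchanged. What has
  to be known is that the inner integral is again a test function, which requires local constancy in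
  a uniform form; a compactness argument supplies it. Freeness of \<Gamma> reduces the sum behind
  \<open>ext_zero\<close> to a single term. The parameter \<open>- cnj s'\<close> arises because
  conjugating \<open>p_s\<close> gives \<open>p_{- cnj s}\<close>.\<close>

locale reg_tree =
  fixes E :: "('v \<times> 'v) set" and q :: nat
  assumes tree: "regular_tree E q" and q2: "q \<ge> 2"
begin

lemma edge_sym: "(x, y) \<in> E \<Longrightarrow> (y, x) \<in> E"
  using tree unfolding regular_tree_def by blast

lemma finite_nbrs: "finite {y. (x, y) \<in> E}"
  using tree unfolding regular_tree_def by blast

lemma card_nbrs: "card {y. (x, y) \<in> E} = q + 1"
  using tree unfolding regular_tree_def by blast

lemma connected: "(x, y) \<in> E\<^sup>*"
  using tree unfolding regular_tree_def by blast

lemma finite_edges_from: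
  assumes "finite X"
  shows "finite {e \<in> E. fst e \<in> X}"
proof -
  have "{e \<in> E. fst e \<in> X} = (SIGMA x:X. {y. (x, y) \<in> E})" by auto
  then show ?thesis using assms finite_nbrs by auto
qed

definition nbwalk :: "nat \<Rightarrow> (nat \<Rightarrow> 'v) \<Rightarrow> bool" where
  "nbwalk n w \<longleftrightarrow> (\<forall>i<n. (w i, w (Suc i)) \<in> E) \<and> (\<forall>i. Suc i < n \<longrightarrow> w (Suc (Suc i)) \<noteq> w i)"

lemma nbwalk_not_closed: "nbwalk n w \<Longrightarrow> 1 \<le> n \<Longrightarrow> w n \<noteq> w 0"
  using tree unfolding regular_tree_def nbwalk_def by blast

text \<open>Geodesics in a tree are unique. If the last steps agree, they can be cut off; otherwise
  \<open>w\<close> followed by \<open>w'\<close> backwards would be a closed walk without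
  backtracking, also at the turning point.\<close>

lemma nbwalk_unique:
  assumes "nbwalk n w" "nbwalk m w'" "w 0 = w' 0" "w n = w' m"
  shows "n = m \<and> (\<forall>i\<le>n. w i = w' i)"
  using assms
proof (induction n arbitrary: m)
  case 0
  then have "m = 0" using nbwalk_not_closed[of m w'] by (cases m) auto
  then show ?case using 0 by auto
next
  case (Suc n)
  obtain k where k: "m = Suc k"
    using Suc.prems nbwalk_not_closed[of "Suc n" w] by (cases m) auto
  show ?case
  proof (cases "w n = w' k")
    case True
    have "nbwalk n w" "nbwalk k w'" using Suc.prems k by (auto simp: nbwalk_def)
    from Suc.IH[OF this Suc.prems(3) True] show ?thesis
      using Suc.prems(4) k by (auto simp: le_Suc_eq)
  next
    case False
    \<comment> \<open>go along \<open>w\<close>, then back along \<open>w'\<close>\<close>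
    define W where "W i = (if i \<le> Suc n then w i else w' (Suc k - (i - Suc n)))" for i
    have W1: "W i = w i" if "i \<le> Suc n" for i using that by (simp add: W_def)
    have W2: "W i = w' (Suc k - (i - Suc n))" if "i \<ge> Suc n" for i
      using that Suc.prems(4) k by (cases "i = Suc n") (auto simp: W_def)
    have "nbwalk (Suc n + Suc k) W"
      unfolding nbwalk_def
    proof (intro conjI allI impI)
      fix i assume i: "i < Suc n + Suc k"
      show "(W i, W (Suc i)) \<in> E"
      proof (cases "i < Suc n")
        case True
        then show ?thesis using Suc.prems(1) by (auto simp: W1 nbwalk_def)
      next
        case False
        define j where "j = Suc k - (Suc i - Suc n)"
        have "(w' j, w' (Suc j)) \<in> E"
          using Suc.prems(2) k i False by (auto simp: nbwalk_def j_def)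
        moreover have "Suc k - (i - Suc n) = Suc j" using i False by (auto simp: j_def)
        ultimately show ?thesis using False edge_sym by (simp add: W2 j_def)
      qed
    next
      fix i assume i: "Suc i < Suc n + Suc k"
      consider "Suc i < Suc n" | "i = n" | "i > n" by linarith
      then show "W (Suc (Suc i)) \<noteq> W i"
      proof cases
        case 1
        then show ?thesis using Suc.prems(1) by (auto simp: W1 nbwalk_def)
      next
        case 2
        then show ?thesis using False by (simp add: W1 W2)
      next
        case 3
        define j where "j = Suc k - (Suc (Suc i) - Suc n)"
        have "w' (Suc (Suc j)) \<noteq> w' j"
          using Suc.prems(2) k i 3 by (auto simp: nbwalk_def j_def)
        moreover have "Suc k - (i - Suc n) = Suc (Suc j)" using i 3 by (auto simp: j_def)
        ultimately show ?thesis using 3 by (simp add: W2 j_def)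
      qed
    qed
    then have "W (Suc n + Suc k) \<noteq> W 0" by (rule nbwalk_not_closed) simp
    then show ?thesis using Suc.prems(3) by (simp add: W1 W2)
  qed
qed

text \<open>A shortest walk cannot backtrack, since cutting out a detour would save two steps. Hence
  it is itself a non-backtracking walk and coincides with \<open>w\<close>.\<close>

lemma gdist_nbwalk:
  assumes w: "nbwalk n w"
  shows "gdist E (w 0) (w n) = n"
proof -
  define m where "m = gdist E (w 0) (w n)"
  have "(w 0, w n) \<in> E ^^ n" using w by (auto simp: relpow_fun_conv nbwalk_def)
  then have "(w 0, w n) \<in> E ^^ m" unfolding m_def gdist_def by (rule LeastI)
  then obtain f where f: "f 0 = w 0" "f m = w n" "\<And>i. i < m \<Longrightarrow> (f i, f (Suc i)) \<in> E"
    by (auto simp: relpow_fun_conv)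
  have "f (Suc (Suc i)) \<noteq> f i" if i: "Suc i < m" for i
  proof
    assume eq: "f (Suc (Suc i)) = f i"
    have "(f 0, f i) \<in> E ^^ i"
      unfolding relpow_fun_conv using f i by (intro exI[of _ f]) auto
    moreover have "(f (Suc (Suc i)), f m) \<in> E ^^ (m - Suc (Suc i))"
      unfolding relpow_fun_conv using f i by (intro exI[of _ "\<lambda>j. f (Suc (Suc i) + j)"]) (auto simp del: add_Suc)
    ultimately have "(w 0, w n) \<in> E ^^ (i + (m - Suc (Suc i)))"
      unfolding relpow_add using eq f by auto
    then have "m \<le> i + (m - Suc (Suc i))" unfolding m_def gdist_def by (rule Least_le)
    then show False using i by simp
  qed
  then have "nbwalk m f" using f by (auto simp: nbwalk_def)
  from nbwalk_unique[OF this w f(1) f(2)] show ?thesis by (simp add: m_def)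
qed

lemma fchain_vertices: "fchain E c \<Longrightarrow> c n = (fst (c n), fst (c (Suc n)))"
  unfolding fchain_def by (metis prod.collapse)

lemma fchain_snd: "fchain E c \<Longrightarrow> snd (c n) = fst (c (Suc n))"
  unfolding fchain_def by blast

lemma fchain_edge: "fchain E c \<Longrightarrow> c n \<in> E"
  unfolding fchain_def by blast

lemma fchain_nbwalk: "fchain E c \<Longrightarrow> nbwalk n (\<lambda>i. fst (c i))"
  unfolding nbwalk_def fchain_def by (metis prod.collapse)

lemma fchain_shift: "fchain E c \<Longrightarrow> fchain E (\<lambda>n. c (n + k))"
  unfolding fchain_def add_Suc by blast

lemma fchain_inj:
  assumes c: "fchain E c" and eq: "fst (c i) = fst (c j)"
  shows "i = j"
proof -
  have False if "i < j" "fst (c i) = fst (c j)" for i j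
    using nbwalk_not_closed[OF fchain_nbwalk[OF fchain_shift[OF c, of i], of "j - i"]] that
    by (simp add: Suc_le_eq)
  from this[of i j] this[of j i] show ?thesis using eq by (metis nat_neq_iff)
qed

lemma consC_simps [simp]: "consC e c 0 = e" "consC e c (Suc n) = c n"
  by (simp_all add: consC_def)

lemma consC_tail: "consC (c 0) (\<lambda>n. c (Suc n)) = c"
  by (rule ext) (simp add: consC_def split: nat.split)

lemma all_nat_split: "(\<forall>n. P n) \<longleftrightarrow> P 0 \<and> (\<forall>n. P (Suc n))"
  by (metis not0_implies_Suc)

lemma fchain_consC_iff:
  "fchain E (consC e c) \<longleftrightarrow> fchain E c \<and> e \<in> E \<and> snd e = fst (c 0) \<and> snd (c 0) \<noteq> fst e"
  unfolding fchain_def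
    all_nat_split[where P = "\<lambda>n. consC e c n \<in> E"]
    all_nat_split[where P = "\<lambda>n. snd (consC e c n) = fst (consC e c (Suc n))"]
    all_nat_split[where P = "\<lambda>n. snd (consC e c (Suc n)) \<noteq> fst (consC e c n)"]
  by auto

text \<open>Up to the merging point both chains are non-backtracking walks with the same ends, so
  the index shift is trivial. This makes the description in \<open>ray\<close> unambiguous.\<close>

lemma fchain_eqI:
  assumes c: "fchain E c" and d: "fchain E d" and start: "fst (c 0) = fst (d 0)"
    and tail: "\<And>n. c (n + k) = d (n + m)"
  shows "c = d"
proof -
  have "k = m \<and> (\<forall>i\<le>k. fst (c i) = fst (d i))"
    using nbwalk_unique[OF fchain_nbwalk[OF c, of k] fchain_nbwalk[OF d, of m]] start tail[of 0]
    by simp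
  then have km: "k = m" and v: "\<And>i. i \<le> k \<Longrightarrow> fst (c i) = fst (d i)" by auto
  show ?thesis
  proof
    fix n show "c n = d n"
    proof (cases "n < k")
      case True
      then show ?thesis using fchain_vertices[OF c, of n] fchain_vertices[OF d, of n] v[of n] v[of "Suc n"]
        by simp
    next
      case False
      then show ?thesis using tail[of "n - k"] km by simp
    qed
  qed
qed

lemma equiv_chain_rel: "equiv (Pplus E) (chain_rel E)"
proof (rule equivI)
  show "chain_rel E \<subseteq> Pplus E \<times> Pplus E"
    unfolding chain_rel_def Pplus_def by auto
  show "refl_on (Pplus E) (chain_rel E)"
    unfolding refl_on_def chain_rel_def Pplus_def by auto
  show "sym (chain_rel E)"
    unfolding sym_def chain_rel_def by (auto, metis (full_types))
  show "trans (chain_rel E)"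
  proof (rule transI)
    fix a b c assume "(a, b) \<in> chain_rel E" "(b, c) \<in> chain_rel E"
    then obtain k m k' m' where h: "fchain E a" "fchain E c"
      "\<And>n. a (n + k) = b (n + m)" "\<And>n. b (n + k') = c (n + m')"
      unfolding chain_rel_def by blast
    have "a (n + (k' + k)) = c (n + (m + m'))" for n
      using h(3)[of "n + k'"] h(4)[of "n + m"] by (simp add: ac_simps)
    then show "(a, c) \<in> chain_rel E" unfolding chain_rel_def using h(1,2) by blast
  qed
qed

lemma Omega_fchain: "\<omega> \<in> Omega E \<Longrightarrow> c \<in> \<omega> \<Longrightarrow> fchain E c"
  using equiv_chain_rel unfolding Omega_def Pplus_def by (metis in_quotient_imp_subset mem_Collect_eq subsetD)

lemma Omega_related: "\<omega> \<in> Omega E \<Longrightarrow> c \<in> \<omega> \<Longrightarrow> d \<in> \<omega> \<Longrightarrow> \<exists>k m. \<forall>n. c (n + k) = d (n + m)"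
  using quotient_eq_iff[OF equiv_chain_rel, of \<omega> \<omega> c d] unfolding Omega_def chain_rel_def by auto

lemma Omega_closed:
  "\<omega> \<in> Omega E \<Longrightarrow> c \<in> \<omega> \<Longrightarrow> fchain E d \<Longrightarrow> (\<And>n. c (n + k) = d (n + m)) \<Longrightarrow> d \<in> \<omega>"
  unfolding Omega_def
  by (rule in_quotient_imp_closed[OF equiv_chain_rel])
     (auto simp: chain_rel_def intro: Omega_fchain[unfolded Omega_def])

lemma bclass_Omega: "fchain E c \<Longrightarrow> bclass E c \<in> Omega E"
  unfolding bclass_def Omega_def by (rule quotientI) (simp add: Pplus_def)

lemma bclass_self: "fchain E c \<Longrightarrow> c \<in> bclass E c"
  unfolding bclass_def using equiv_class_self[OF equiv_chain_rel] by (simp add: Pplus_def)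

lemma bclass_eq: "\<omega> \<in> Omega E \<Longrightarrow> c \<in> \<omega> \<Longrightarrow> bclass E c = \<omega>"
  using quotient_eqI[OF equiv_chain_rel, of "bclass E c" \<omega> c c] bclass_Omega bclass_self
    Omega_fchain[of \<omega> c]
  by (force simp: Omega_def chain_rel_def)

lemma Omega_consC:
  assumes "\<omega> \<in> Omega E" "fchain E (consC e c)"
  shows "consC e c \<in> \<omega> \<longleftrightarrow> c \<in> \<omega>"
proof -
  have c: "fchain E c" using assms fchain_consC_iff by blast
  show ?thesis
    using Omega_closed[OF assms(1) _ assms(2), of c 0 1] Omega_closed[OF assms(1) _ c, of "consC e c" 1 0]
    by auto
qed

text \<open>Follow a path from the origin of some representative to \<open>x\<close>. Each step
  either drops the first edge or prepends one, and neither changes the class.\<close>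

lemma ex_chain_from:
  assumes \<omega>: "\<omega> \<in> Omega E"
  shows "\<exists>c\<in>\<omega>. fst (c 0) = x"
proof -
  obtain c0 where c0: "c0 \<in> \<omega>"
    using \<omega> equiv_chain_rel unfolding Omega_def by (metis ex_in_conv in_quotient_imp_non_empty)
  have "(fst (c0 0), x) \<in> E\<^sup>*" by (rule connected)
  then show ?thesis
  proof (induction rule: rtrancl_induct)
    case base
    then show ?case using c0 by blast
  next
    case (step y z)
    then obtain c where c: "c \<in> \<omega>" "fst (c 0) = y" by blast
    have fc: "fchain E c" using Omega_fchain[OF \<omega> c(1)] .
    show ?case
    proof (cases "snd (c 0) = z")
      case True
      have "(\<lambda>n. c (n + 1)) \<in> \<omega>"
        by (rule Omega_closed[OF \<omega> c(1) fchain_shift[OF fc], of 1 0]) simp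
      then show ?thesis using True fchain_snd[OF fc, of 0] by (intro bexI[of _ "\<lambda>n. c (n + 1)"]) auto
    next
      case False
      then have "fchain E (consC (z, y) c)"
        unfolding fchain_consC_iff using fc c edge_sym[OF step(2)] by auto
      then have "consC (z, y) c \<in> \<omega>" using Omega_consC[OF \<omega>] c by blast
      then show ?thesis by (intro bexI[of _ "consC (z, y) c"]) auto
    qed
  qed
qed

lemma ray_eqI:
  assumes "\<omega> \<in> Omega E" "c \<in> \<omega>" "fst (c 0) = x"
  shows "ray x \<omega> = c"
  unfolding ray_def
proof (rule the_equality)
  show "c \<in> \<omega> \<and> fst (c 0) = x" using assms by blast
next
  fix d assume d: "d \<in> \<omega> \<and> fst (d 0) = x"
  then obtain k m where "\<And>n. d (n + k) = c (n + m)" using Omega_related[OF assms(1)] assms(2) by blast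
  then show "d = c" using fchain_eqI Omega_fchain[OF assms(1)] assms d by metis
qed

lemma ray_in: "\<omega> \<in> Omega E \<Longrightarrow> ray x \<omega> \<in> \<omega>"
  using ex_chain_from ray_eqI by metis

lemma ray_start: "\<omega> \<in> Omega E \<Longrightarrow> fst (ray x \<omega> 0) = x"
  using ex_chain_from ray_eqI by metis

lemma ray_fchain: "\<omega> \<in> Omega E \<Longrightarrow> fchain E (ray x \<omega>)"
  using ray_in Omega_fchain by blast

lemma ray_bclass: "fchain E c \<Longrightarrow> ray (fst (c 0)) (bclass E c) = c"
  using ray_eqI bclass_Omega bclass_self by blast

lemma bclass_ray: "\<omega> \<in> Omega E \<Longrightarrow> bclass E (ray x \<omega>) = \<omega>"
  using bclass_eq ray_in by blast

lemma ray_shift: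
  assumes "\<omega> \<in> Omega E"
  shows "ray (fst (ray x \<omega> k)) \<omega> = (\<lambda>n. ray x \<omega> (n + k))"
proof (rule ray_eqI[OF assms])
  show "(\<lambda>n. ray x \<omega> (n + k)) \<in> \<omega>"
    by (rule Omega_closed[OF assms ray_in[OF assms] fchain_shift[OF ray_fchain[OF assms]], where k1 = k and m = 0])
       simp
qed simp

text \<open>Together with \<open>ray_away\<close> this is the dichotomy behind all later arguments
  along edges: a step to a neighbour goes towards \<omega> or away from it.\<close>

lemma ray_towards:
  assumes "\<omega> \<in> Omega E" "snd (ray x \<omega> 0) = y"
  shows "ray x \<omega> = consC (x, y) (ray y \<omega>)"
proof -
  have "ray y \<omega> = (\<lambda>n. ray x \<omega> (Suc n))"
    using ray_shift[OF assms(1), of x 1] fchain_snd[OF ray_fchain[OF assms(1)], of x 0] assms(2) by simp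
  moreover have "(x, y) = ray x \<omega> 0" using ray_start[OF assms(1)] assms(2) by (metis prod.collapse)
  ultimately show ?thesis using consC_tail[of "ray x \<omega>"] by simp
qed

lemma ray_away:
  assumes "\<omega> \<in> Omega E" "(x, y) \<in> E" "snd (ray x \<omega> 0) \<noteq> y"
  shows "ray y \<omega> = consC (y, x) (ray x \<omega>)"
proof (rule ray_eqI[OF assms(1)])
  have "fchain E (consC (y, x) (ray x \<omega>))"
    unfolding fchain_consC_iff using assms ray_fchain ray_start edge_sym by auto
  then show "consC (y, x) (ray x \<omega>) \<in> \<omega>" using Omega_consC ray_in assms(1) by blast
qed simp

text \<open>The difference of the two indices is the same for every pair of merging indices, so it
  may be read off from any merging. The minimal pair yields the vertex \<open>y\<close> required by
  the definition.\<close>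

lemma horo_eqI:
  assumes \<omega>: "\<omega> \<in> Omega E" and merge: "\<And>n. ray bo \<omega> (n + k) = ray x \<omega> (n + m)"
  shows "horo E bo x \<omega> = int k - int m"
proof -
  define c d where "c = ray bo \<omega>" and "d = ray x \<omega>"
  have fc: "fchain E c" and fd: "fchain E d" using ray_fchain[OF \<omega>] by (auto simp: c_def d_def)
  \<comment> \<open>The first index at which the ray from \<open>bo\<close> joins the ray from
    \<open>x\<close>.\<close>
  define k0 where "k0 = (LEAST k. \<exists>m. \<forall>n. c (n + k) = d (n + m))"
  have "\<exists>m. \<forall>n. c (n + k) = d (n + m)" using merge by (auto simp: c_def d_def)
  then have "\<exists>m. \<forall>n. c (n + k0) = d (n + m)" unfolding k0_def by (rule LeastI)
  then obtain m0 where m0: "\<And>n. c (n + k0) = d (n + m0)" by blast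
  have least: "k0 \<le> i" if "\<And>n. c (n + i) = d (n + j)" for i j
    unfolding k0_def using that by (intro Least_le) blast
  have "k0 \<le> k" using least merge by (simp add: c_def d_def)
  then have "d (m0 + (k - k0)) = d m"
    using m0[of "k - k0"] merge[of 0] by (simp add: c_def d_def add.commute)
  then have "m0 + (k - k0) = m" using fchain_inj[OF fd] by simp
  then have diff: "int k - int m = int k0 - int m0" using \<open>k0 \<le> k\<close> by simp
  \<comment> \<open>From a common vertex onwards both rays are the ray of that vertex, so a common
    vertex is the same as a merging.\<close>
  have meet: "\<And>n. c (n + i) = d (n + j)" if "fst (c i) = fst (d j)" for i j
    using ray_shift[OF \<omega>, of bo i] ray_shift[OF \<omega>, of x j] that unfolding c_def d_def by metis
  define y where "y = fst (c k0)"
  have y': "y = fst (d m0)" using m0[of 0] by (simp add: y_def)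
  have rv: "ray_verts y \<omega> = range (\<lambda>n. fst (c (n + k0)))"
    unfolding ray_verts_def y_def c_def using ray_shift[OF \<omega>] by simp
  have inter: "ray_verts bo \<omega> \<inter> ray_verts x \<omega> = ray_verts y \<omega>"
  proof
    show "ray_verts bo \<omega> \<inter> ray_verts x \<omega> \<subseteq> ray_verts y \<omega>"
    proof
      fix v assume "v \<in> ray_verts bo \<omega> \<inter> ray_verts x \<omega>"
      then obtain i j where ij: "v = fst (c i)" "v = fst (d j)"
        unfolding ray_verts_def c_def d_def by blast
      then have "k0 \<le> i" using meet least by metis
      then show "v \<in> ray_verts y \<omega>" unfolding rv ij(1) by (intro image_eqI[of _ _ "i - k0"]) auto
    qed
    show "ray_verts y \<omega> \<subseteq> ray_verts bo \<omega> \<inter> ray_verts x \<omega>"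
    proof -
      have "fst (c (n + k0)) \<in> range (\<lambda>x. fst (d x))" for n using m0[of n] by auto
      then show ?thesis
        unfolding rv by (auto simp: ray_verts_def c_def[symmetric] d_def[symmetric])
    qed
  qed
  \<comment> \<open>Each of \<open>y\<close> and \<open>v\<close> lies on the ray from the other,
    and the vertices of a ray are distinct.\<close>
  have y_unique: "v = y" if eq: "ray_verts y \<omega> = ray_verts v \<omega>" for v
  proof -
    have self: "a \<in> ray_verts a \<omega>" for a
      unfolding ray_verts_def using ray_start[OF \<omega>, of a] by (metis rangeI)
    obtain i where i: "v = fst (ray y \<omega> i)"
      using self[of v] unfolding eq[symmetric] unfolding ray_verts_def by blast
    obtain j where j: "y = fst (ray v \<omega> j)"
      using self[of y] unfolding eq unfolding ray_verts_def by blast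
    have "ray v \<omega> = (\<lambda>n. ray y \<omega> (n + i))" using ray_shift[OF \<omega>] i by simp
    then have "fst (ray y \<omega> (j + i)) = fst (ray y \<omega> 0)" using j ray_start[OF \<omega>] by metis
    then have "i = 0" using fchain_inj[OF ray_fchain[OF \<omega>]] by fastforce
    then show ?thesis using i ray_start[OF \<omega>] by simp
  qed
  have dist: "gdist E bo y = k0" "gdist E x y = m0"
    using gdist_nbwalk[OF fchain_nbwalk[OF fc, of k0]] gdist_nbwalk[OF fchain_nbwalk[OF fd, of m0]]
      ray_start[OF \<omega>] y' by (simp_all add: y_def c_def d_def)
  show ?thesis unfolding horo_def diff
  proof (rule the_equality)
    show "\<exists>v. ray_verts bo \<omega> \<inter> ray_verts x \<omega> = ray_verts v \<omega> \<and>
        int k0 - int m0 = int (gdist E bo v) - int (gdist E x v)"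
      using inter dist by auto
  next
    fix l assume "\<exists>v. ray_verts bo \<omega> \<inter> ray_verts x \<omega> = ray_verts v \<omega> \<and>
        l = int (gdist E bo v) - int (gdist E x v)"
    then show "l = int k0 - int m0" using inter dist y_unique by metis
  qed
qed

lemma horo_base: "\<omega> \<in> Omega E \<Longrightarrow> horo E bo bo \<omega> = 0"
  using horo_eqI[of \<omega> bo 0 bo 0] by simp

lemma horo_towards:
  assumes \<omega>: "\<omega> \<in> Omega E" and y: "snd (ray x \<omega> 0) = y"
  shows "horo E bo y \<omega> = horo E bo x \<omega> + 1"
proof -
  obtain k m where km: "\<And>n. ray bo \<omega> (n + k) = ray y \<omega> (n + m)"
    using Omega_related[OF \<omega> ray_in[OF \<omega>] ray_in[OF \<omega>]] by metis
  have "ray bo \<omega> (n + k) = ray x \<omega> (n + Suc m)" for n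
    using km ray_towards[OF \<omega> y] by simp
  from horo_eqI[OF \<omega> this] horo_eqI[OF \<omega> km] show ?thesis by simp
qed

section \<open>Locally constant functions\<close>

lemma ray_agree_nbr:
  assumes \<omega>: "\<omega> \<in> Omega E" and \<eta>: "\<eta> \<in> Omega E" and xy: "(x, y) \<in> E"
    and agree: "\<And>i. i < Suc n \<Longrightarrow> ray x \<eta> i = ray x \<omega> i" and i: "i < n"
  shows "ray y \<eta> i = ray y \<omega> i"
proof (cases "snd (ray x \<omega> 0) = y")
  case True
  then have "ray x \<omega> = consC (x, y) (ray y \<omega>)" "ray x \<eta> = consC (x, y) (ray y \<eta>)"
    using ray_towards \<omega> \<eta> agree[of 0] by auto
  then show ?thesis using agree[of "Suc i"] i by simp
next
  case False
  then have "ray y \<omega> = consC (y, x) (ray x \<omega>)" "ray y \<eta> = consC (y, x) (ray x \<eta>)"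
    using ray_away[OF _ xy] \<omega> \<eta> agree[of 0] by auto
  then show ?thesis using agree i by (cases i) auto
qed

text \<open>Changing the base costs at most one edge of agreement per step of the path from
  \<open>x\<close> to \<open>y\<close>. The bound \<open>m\<close> therefore depends only on
  \<open>x\<close>, \<open>y\<close>, \<open>n\<close> and not on the boundary points.\<close>

lemma ray_agree_change_base:
  "\<exists>m. \<forall>\<omega>\<in>Omega E. \<forall>\<eta>\<in>Omega E. (\<forall>i<m. ray x \<eta> i = ray x \<omega> i) \<longrightarrow> (\<forall>i<n. ray y \<eta> i = ray y \<omega> i)"
  using connected[of x y]
proof (induction arbitrary: n rule: rtrancl_induct)
  case base
  then show ?case by blast
next
  case (step y z)
  from step.IH[of "Suc n"] obtain m where
    m: "\<And>\<omega> \<eta>. \<omega> \<in> Omega E \<Longrightarrow> \<eta> \<in> Omega E \<Longrightarrow> (\<forall>i<m. ray x \<eta> i = ray x \<omega> i)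
      \<Longrightarrow> (\<forall>i<Suc n. ray y \<eta> i = ray y \<omega> i)"
    by blast
  show ?case
  proof (intro exI[of _ m] ballI impI allI)
    fix \<omega> \<eta> i assume "\<omega> \<in> Omega E" "\<eta> \<in> Omega E" "\<forall>i<m. ray x \<eta> i = ray x \<omega> i" "i < n"
    then show "ray z \<eta> i = ray z \<omega> i" using ray_agree_nbr[OF _ _ step.hyps(2)] m by blast
  qed
qed

lemma bdry_set_iff:
  assumes "\<omega> \<in> Omega E"
  shows "\<omega> \<in> bdry_set E e \<longleftrightarrow> ray (fst e) \<omega> 0 = e"
proof
  assume "\<omega> \<in> bdry_set E e"
  then obtain c where "c \<in> \<omega>" "c 0 = e" unfolding bdry_set_def by blast
  then show "ray (fst e) \<omega> 0 = e" using ray_eqI[OF assms, of c "fst e"] by simp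
next
  assume "ray (fst e) \<omega> 0 = e"
  then show "\<omega> \<in> bdry_set E e" unfolding bdry_set_def using assms ray_in by blast
qed

text \<open>A chain that passes the n-th edge of the ray away from \<open>x\<close> must, when
  extended back to \<open>x\<close>, use the unique path there. In the induction, agreement on the
  ray from \<open>y\<close> shows that \<eta> does not lead back to \<open>x\<close>, so
  \<open>ray_away\<close> recovers the first edge.\<close>

lemma bdry_set_ray_agree:
  assumes \<omega>: "\<omega> \<in> Omega E" and \<eta>: "\<eta> \<in> bdry_set E (ray x \<omega> n)" and i: "i \<le> n"
  shows "ray x \<eta> i = ray x \<omega> i"
  using \<eta> i
proof (induction n arbitrary: x i)
  case 0
  then show ?case using bdry_set_iff[of \<eta>] ray_start[OF \<omega>] by (auto simp: bdry_set_def)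
next
  case (Suc n)
  have \<eta>O: "\<eta> \<in> Omega E" using Suc.prems by (simp add: bdry_set_def)
  define y where "y = snd (ray x \<omega> 0)"
  have rx: "ray x \<omega> = consC (x, y) (ray y \<omega>)" using ray_towards[OF \<omega>] y_def by blast
  then have IH: "ray y \<eta> i = ray y \<omega> i" if "i \<le> n" for i
    using Suc.IH[of y i] Suc.prems that by simp
  have "fchain E (consC (x, y) (ray y \<omega>))" using ray_fchain[OF \<omega>, of x] rx by simp
  then have "(x, y) \<in> E" "snd (ray y \<omega> 0) \<noteq> x" by (auto simp: fchain_consC_iff)
  then have "ray x \<eta> = consC (x, y) (ray y \<eta>)"
    using ray_away[OF \<eta>O, of y x] edge_sym IH[of 0] by simp
  then show ?case using rx IH Suc.prems(2) by (cases i) auto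
qed

text \<open>Local constancy measured by rays from one fixed vertex. These neighbourhoods are nested,
  so two conditions combine by taking a maximum, unlike for the sets
  \<open>bdry_set E e\<close>.\<close>

definition olc :: "'v \<Rightarrow> ('v chn set \<Rightarrow> 'b) \<Rightarrow> bool" where
  "olc x f \<longleftrightarrow> (\<forall>\<omega>\<in>Omega E. \<exists>n. \<forall>\<eta>\<in>Omega E. (\<forall>i<n. ray x \<eta> i = ray x \<omega> i) \<longrightarrow> f \<eta> = f \<omega>)"

lemma olcD:
  "olc x f \<Longrightarrow> \<omega> \<in> Omega E \<Longrightarrow>
    \<exists>n. \<forall>\<eta>\<in>Omega E. (\<forall>i<n. ray x \<eta> i = ray x \<omega> i) \<longrightarrow> f \<eta> = f \<omega>"
  unfolding olc_def by (rule bspec)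

lemma olc_change_base:
  assumes "olc x f" shows "olc y f"
  unfolding olc_def
proof
  fix \<omega> assume \<omega>: "\<omega> \<in> Omega E"
  from olcD[OF assms \<omega>] obtain n where
    n: "\<forall>\<eta>\<in>Omega E. (\<forall>i<n. ray x \<eta> i = ray x \<omega> i) \<longrightarrow> f \<eta> = f \<omega>" ..
  note n = n[THEN bspec, THEN mp]
  from ray_agree_change_base[of y n x] obtain m where
    m: "\<forall>\<omega>\<in>Omega E. \<forall>\<eta>\<in>Omega E. (\<forall>i<m. ray y \<eta> i = ray y \<omega> i) \<longrightarrow> (\<forall>i<n. ray x \<eta> i = ray x \<omega> i)" ..
  have "f \<eta> = f \<omega>" if "\<eta> \<in> Omega E" "\<forall>i<m. ray y \<eta> i = ray y \<omega> i" for \<eta>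
    by (rule n[OF that(1) m[THEN bspec[OF _ \<omega>], THEN bspec[OF _ that(1)], THEN mp[OF _ that(2)]]])
  then show "\<exists>m. \<forall>\<eta>\<in>Omega E. (\<forall>i<m. ray y \<eta> i = ray y \<omega> i) \<longrightarrow> f \<eta> = f \<omega>"
    by blast
qed

text \<open>The edge in \<open>lc_Omega\<close> may lie anywhere in the tree, so one direction has
  to change the base to its origin. For the other direction the n-th edge of the ray fixes all
  earlier edges.\<close>

lemma lc_Omega_iff: "lc_Omega E f \<longleftrightarrow> olc x f"
proof
  assume lc: "lc_Omega E f"
  show "olc x f"
    unfolding olc_def
  proof
    fix \<omega> assume \<omega>: "\<omega> \<in> Omega E"
    then obtain e where e: "\<omega> \<in> bdry_set E e" "\<And>\<eta>. \<eta> \<in> bdry_set E e \<Longrightarrow> f \<eta> = f \<omega>"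
      using lc unfolding lc_Omega_def by blast
    from ray_agree_change_base[of x 1 "fst e"] obtain m where
      m: "\<forall>\<omega>\<in>Omega E. \<forall>\<eta>\<in>Omega E. (\<forall>i<m. ray x \<eta> i = ray x \<omega> i)
        \<longrightarrow> (\<forall>i<1. ray (fst e) \<eta> i = ray (fst e) \<omega> i)" ..
    have "f \<eta> = f \<omega>" if "\<eta> \<in> Omega E" "\<forall>i<m. ray x \<eta> i = ray x \<omega> i" for \<eta>
    proof (rule e(2))
      have "\<forall>i<1. ray (fst e) \<eta> i = ray (fst e) \<omega> i"
        by (rule m[THEN bspec[OF _ \<omega>], THEN bspec[OF _ that(1)], THEN mp[OF _ that(2)]])
      then have "ray (fst e) \<eta> 0 = ray (fst e) \<omega> 0" by simp
      then show "\<eta> \<in> bdry_set E e" using e(1) bdry_set_iff that(1) \<omega> by simp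
    qed
    then show "\<exists>n. \<forall>\<eta>\<in>Omega E. (\<forall>i<n. ray x \<eta> i = ray x \<omega> i) \<longrightarrow> f \<eta> = f \<omega>" by blast
  qed
next
  assume olc: "olc x f"
  show "lc_Omega E f"
    unfolding lc_Omega_def
  proof
    fix \<omega> assume \<omega>: "\<omega> \<in> Omega E"
    from olcD[OF olc \<omega>] obtain n where
      n: "\<forall>\<eta>\<in>Omega E. (\<forall>i<n. ray x \<eta> i = ray x \<omega> i) \<longrightarrow> f \<eta> = f \<omega>" ..
    note n = n[THEN bspec, THEN mp]
    have "ray x \<omega> n \<in> E" using fchain_edge ray_fchain[OF \<omega>] by blast
    moreover have "\<omega> \<in> bdry_set E (ray x \<omega> n)"
      unfolding bdry_set_iff[OF \<omega>] using ray_shift[OF \<omega>] by simp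
    moreover have "f \<eta> = f \<omega>" if "\<eta> \<in> bdry_set E (ray x \<omega> n)" for \<eta>
      using n[of \<eta>] bdry_set_ray_agree[OF \<omega> that] that by (simp add: bdry_set_def)
    ultimately show "\<exists>e\<in>E. \<omega> \<in> bdry_set E e \<and> (\<forall>\<eta>\<in>bdry_set E e. f \<eta> = f \<omega>)" by blast
  qed
qed

lemma olc_combine:
  assumes "olc x f" "olc x g"
  shows "olc x (\<lambda>\<omega>. h (f \<omega>) (g \<omega>))"
  unfolding olc_def
proof
  fix \<omega> assume \<omega>: "\<omega> \<in> Omega E"
  from olcD[OF assms(1) \<omega>] obtain n where
    n: "\<forall>\<eta>\<in>Omega E. (\<forall>i<n. ray x \<eta> i = ray x \<omega> i) \<longrightarrow> f \<eta> = f \<omega>" ..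
  note n = n[THEN bspec, THEN mp]
  from olcD[OF assms(2) \<omega>] obtain m where
    m: "\<forall>\<eta>\<in>Omega E. (\<forall>i<m. ray x \<eta> i = ray x \<omega> i) \<longrightarrow> g \<eta> = g \<omega>" ..
  note m = m[THEN bspec, THEN mp]
  show "\<exists>n. \<forall>\<eta>\<in>Omega E. (\<forall>i<n. ray x \<eta> i = ray x \<omega> i) \<longrightarrow> h (f \<eta>) (g \<eta>) = h (f \<omega>) (g \<omega>)"
  proof (intro exI[of _ "max n m"] ballI impI)
    fix \<eta> assume "\<eta> \<in> Omega E" "\<forall>i<max n m. ray x \<eta> i = ray x \<omega> i"
    then have "f \<eta> = f \<omega>" "g \<eta> = g \<omega>" using n[of \<eta>] m[of \<eta>] by simp_all
    then show "h (f \<eta>) (g \<eta>) = h (f \<omega>) (g \<omega>)" by simp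
  qed
qed

lemma olc_const: "olc x (\<lambda>_. k)"
  by (auto simp: olc_def)

lemma olc_sum:
  assumes "finite X" "\<And>v. v \<in> X \<Longrightarrow> olc x (f v)"
  shows "olc x (\<lambda>\<omega>. \<Sum>v\<in>X. f v \<omega> :: complex)"
  using assms by (induction X rule: finite_induct) (auto intro: olc_const olc_combine[where h = "(+)"])

lemma olc_cong: "olc x f \<Longrightarrow> (\<And>\<omega>. \<omega> \<in> Omega E \<Longrightarrow> f \<omega> = g \<omega>) \<Longrightarrow> olc x g"
  unfolding olc_def by simp

lemma olc_first_edge: "olc x (\<lambda>\<omega>. ray x \<omega> 0)"
  unfolding olc_def by (intro ballI exI[of _ 1]) simp

text \<open>Along an edge the bracket changes by plus or minus one, and the sign is decided by the
  first edge of the ray.\<close>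

lemma olc_horo: "olc x (\<lambda>\<omega>. horo E bo y \<omega>)"
  using connected[of bo y]
proof (induction arbitrary: x rule: rtrancl_induct)
  case base
  show ?case by (rule olc_cong[OF olc_const[of _ 0]]) (simp add: horo_base)
next
  case (step y z)
  have "olc y (\<lambda>\<omega>. (\<lambda>h e. if snd e = z then h + 1 else h - 1) (horo E bo y \<omega>) (ray y \<omega> 0))"
    by (rule olc_combine) (rule step.IH, rule olc_first_edge)
  moreover have "(\<lambda>h e. if snd e = z then h + 1 else h - 1) (horo E bo y \<omega>) (ray y \<omega> 0) = horo E bo z \<omega>"
    if \<omega>: "\<omega> \<in> Omega E" for \<omega>
  proof (cases "snd (ray y \<omega> 0) = z")
    case True
    then show ?thesis using horo_towards[OF \<omega>] by simp
  next
    case False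
    \<comment> \<open>The ray from \<open>z\<close> now runs through \<open>y\<close>, so
      \<open>horo_towards\<close> is used in the opposite direction.\<close>
    then have "snd (ray z \<omega> 0) = y" using ray_away[OF \<omega> step.hyps(2)] by simp
    then show ?thesis using horo_towards[OF \<omega>, of z y] False by simp
  qed
  ultimately have "olc y (\<lambda>\<omega>. horo E bo z \<omega>)" by (rule olc_cong)
  then show ?case by (rule olc_change_base)
qed

lemma olc_pker: "olc x (\<lambda>\<omega>. pker E q bo s y \<omega>)"
  unfolding pker_def
  by (rule olc_combine[OF olc_horo olc_const, where h = "\<lambda>h _. of_nat q powr ((1/2 + \<i> * s) * of_int h)"])

lemma test_Omega_iff: "f \<in> test_Omega E \<longleftrightarrow> olc x f \<and> (\<forall>\<omega>. \<omega> \<notin> Omega E \<longrightarrow> f \<omega> = 0)"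
  unfolding test_Omega_def using lc_Omega_iff by auto

end

text \<open>Koenig's lemma as compactness of a closed, finitely branching set of sequences: if no
  uniform bound existed, bad cylinders could be refined forever, and local constancy at the limit
  sequence would be violated.\<close>

lemma finite_branching_uniform:
  fixes S :: "(nat \<Rightarrow> 'a) set" and f :: "(nat \<Rightarrow> 'a) \<Rightarrow> 'b"
  assumes fin: "\<And>n. finite ((\<lambda>c. c n) ` S)"
    and closed: "\<And>c. (\<And>n. \<exists>c'\<in>S. \<forall>i<n. c' i = c i) \<Longrightarrow> c \<in> S"
    and lc: "\<And>c. c \<in> S \<Longrightarrow> \<exists>n. \<forall>c'\<in>S. (\<forall>i<n. c' i = c i) \<longrightarrow> f c' = f c"
  shows "\<exists>n. \<forall>c\<in>S. \<forall>c'\<in>S. (\<forall>i<n. c' i = c i) \<longrightarrow> f c' = f c"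
proof (rule ccontr)
  assume neg: "\<not> ?thesis"
  \<comment> \<open>\<open>good c n\<close> says that \<open>f\<close> is uniformly locally constant
    on the cylinder given by the first \<open>n\<close> entries of \<open>c\<close>.\<close>
  define good where "good c n \<longleftrightarrow> (\<exists>m. \<forall>d\<in>S. \<forall>d'\<in>S. (\<forall>i<n. d i = c i) \<longrightarrow> (\<forall>i<n. d' i = c i) \<longrightarrow>
      (\<forall>i<m. d' i = d i) \<longrightarrow> f d' = f d)" for c n
  have bad0: "\<not> good c 0" for c using neg unfolding good_def by simp
  have step: "\<exists>a. \<not> good (c(n := a)) (Suc n)" if b: "\<not> good c n" for c n
  proof (rule ccontr)
    assume "\<not> ?thesis"
    then have "\<forall>a. good (c(n := a)) (Suc n)" by simp
    then have "\<forall>a. \<exists>m. \<forall>d\<in>S. \<forall>d'\<in>S. (\<forall>i<Suc n. d i = (c(n := a)) i) \<longrightarrow>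
        (\<forall>i<Suc n. d' i = (c(n := a)) i) \<longrightarrow> (\<forall>i<m. d' i = d i) \<longrightarrow> f d' = f d"
      unfolding good_def .
    from choice[OF this] obtain M where M: "\<forall>a. \<forall>d\<in>S. \<forall>d'\<in>S. (\<forall>i<Suc n. d i = (c(n := a)) i) \<longrightarrow>
        (\<forall>i<Suc n. d' i = (c(n := a)) i) \<longrightarrow> (\<forall>i<M a. d' i = d i) \<longrightarrow> f d' = f d" ..
    \<comment> \<open>The entry \<open>Suc n\<close> in the maximum forces agreement at position
      \<open>n\<close>, so that both sequences lie in the same refined cylinder.\<close>
    define N where "N = Max (insert (Suc n) (M ` ((\<lambda>c. c n) ` S)))"
    have finI: "finite (insert (Suc n) (M ` ((\<lambda>c. c n) ` S)))" using fin by blast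
    have N: "Suc n \<le> N" "\<And>d. d \<in> S \<Longrightarrow> M (d n) \<le> N"
      unfolding N_def using finI by (auto intro!: Max_ge)
    have "good c n"
      unfolding good_def
    proof (intro exI[of _ N] ballI impI)
      fix d d' assume d: "d \<in> S" "d' \<in> S" "\<forall>i<n. d i = c i" "\<forall>i<n. d' i = c i" "\<forall>i<N. d' i = d i"
      have "d' n = d n" using d(5) N(1) by simp
      then have "\<forall>i<Suc n. d i = (c(n := d n)) i" "\<forall>i<Suc n. d' i = (c(n := d n)) i"
        using d(3,4) by (auto simp: less_Suc_eq)
      moreover have "\<forall>i<M (d n). d' i = d i" using d(5) N(2)[OF d(1)] by simp
      ultimately show "f d' = f d" using M d(1,2) by blast
    qed
    with b show False ..
  qed
  have good_cong: "good c n = good c' n" if "\<forall>i<n. c i = c' i" for c c' n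
    using that unfolding good_def by simp
  define pick where "pick c n = (SOME a. \<not> good (c(n := a)) (Suc n))" for c n
  define P where "P = rec_nat (undefined :: nat \<Rightarrow> 'a) (\<lambda>n c. c(n := pick c n))"
  have P0: "P (Suc n) = (P n)(n := pick (P n) n)" for n by (simp add: P_def)
  have badP: "\<not> good (P n) n" for n
  proof (induction n)
    case (Suc n)
    then show ?case unfolding P0 pick_def by (rule someI_ex[OF step])
  qed (rule bad0)
  have P_stable: "P n i = P (Suc i) i" if "i < n" for n i
    using that by (induction n) (auto simp: P0 less_Suc_eq)
  define c where "c i = P (Suc i) i" for i
  have badc: "\<not> good c n" for n
  proof -
    have "\<forall>i<n. P n i = c i" unfolding c_def using P_stable by blast
    then show ?thesis using badP[of n] good_cong by blast
  qed
  have "c \<in> S"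
  proof (rule closed)
    fix n
    show "\<exists>c'\<in>S. \<forall>i<n. c' i = c i"
    proof (rule ccontr)
      assume "\<not> ?thesis"
      then have "good c n" unfolding good_def by blast
      then show False using badc by blast
    qed
  qed
  \<comment> \<open>On a small enough cylinder around the limit, \<open>f\<close> is constant, so
    that cylinder is good even with \<open>m = 0\<close>.\<close>
  from lc[OF this] obtain n where n: "\<forall>c'\<in>S. (\<forall>i<n. c' i = c i) \<longrightarrow> f c' = f c" ..
  have "good c n"
    unfolding good_def
  proof (intro exI[of _ 0] ballI impI)
    fix d d' assume "d \<in> S" "d' \<in> S" "\<forall>i<n. d i = c i" "\<forall>i<n. d' i = c i"
    then have "f d = f c" "f d' = f c" by (auto intro: n[THEN bspec, THEN mp])
    then show "f d' = f d" by simp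
  qed
  then show False using badc by blast
qed

context reg_tree
begin

section \<open>Test functions and the transfer operator on forward chains\<close>

abbreviation Tp :: "('v chn \<Rightarrow> complex) set" where
  "Tp \<equiv> test_shift (Pplus E) pi_plus"

abbreviation L :: "('v chn \<Rightarrow> complex) \<Rightarrow> 'v chn \<Rightarrow> complex" where
  "L \<equiv> transfer E (Pplus E)"

definition level :: "nat \<Rightarrow> ('v chn \<Rightarrow> 'b) \<Rightarrow> bool" where
  "level n f \<longleftrightarrow> (\<forall>c c'. fchain E c \<longrightarrow> fchain E c' \<longrightarrow> (\<forall>i<n. c' i = c i) \<longrightarrow> f c' = f c)"

lemma levelD: "level n f \<Longrightarrow> fchain E c \<Longrightarrow> fchain E c' \<Longrightarrow> (\<And>i. i < n \<Longrightarrow> c' i = c i) \<Longrightarrow> f c' = f c"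
  unfolding level_def by blast

lemma level_mono: "level n f \<Longrightarrow> n \<le> m \<Longrightarrow> level m f"
  unfolding level_def by (meson less_le_trans)

lemma level_lc_shift: "level n f \<Longrightarrow> lc_shift (Pplus E) f"
  unfolding lc_shift_def Pplus_def level_def by blast

lemma Tp_I:
  assumes "lc_shift (Pplus E) f" "finite X" "\<And>c. f c \<noteq> 0 \<Longrightarrow> fchain E c \<and> fst (c 0) \<in> X"
  shows "f \<in> Tp"
proof -
  have "pi_plus ` {c \<in> Pplus E. f c \<noteq> 0} \<subseteq> X" using assms(3) by (auto simp: pi_plus_def)
  then have "finite (pi_plus ` {c \<in> Pplus E. f c \<noteq> 0})" using assms(2) finite_subset by blast
  then show ?thesis unfolding test_shift_def using assms(1,3) by (auto simp: Pplus_def)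
qed

lemma Tp_lc: "f \<in> Tp \<Longrightarrow> lc_shift (Pplus E) f"
  unfolding test_shift_def by blast

lemma Tp_support:
  assumes "f \<in> Tp"
  shows "\<exists>X. finite X \<and> (\<forall>c. f c \<noteq> 0 \<longrightarrow> fchain E c \<and> fst (c 0) \<in> X)"
  using assms unfolding test_shift_def
  by (intro exI[of _ "pi_plus ` {c \<in> Pplus E. f c \<noteq> 0}"]) (auto simp: pi_plus_def Pplus_def)

lemma lc_shift_combine:
  assumes "lc_shift S f" "lc_shift S g"
  shows "lc_shift S (\<lambda>c. h (f c) (g c))"
  unfolding lc_shift_def
proof
  fix c assume c: "c \<in> S"
  from bspec[OF assms(1)[unfolded lc_shift_def] c] obtain n where
    n: "\<forall>c'\<in>S. (\<forall>i<n. c' i = c i) \<longrightarrow> f c' = f c" ..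
  from bspec[OF assms(2)[unfolded lc_shift_def] c] obtain m where
    m: "\<forall>c'\<in>S. (\<forall>i<m. c' i = c i) \<longrightarrow> g c' = g c" ..
  show "\<exists>n. \<forall>c'\<in>S. (\<forall>i<n. c' i = c i) \<longrightarrow> h (f c') (g c') = h (f c) (g c)"
  proof (intro exI[of _ "max n m"] ballI impI)
    fix c' assume c': "c' \<in> S" "\<forall>i<max n m. c' i = c i"
    have "f c' = f c" by (rule n[THEN bspec, THEN mp]) (use c' in auto)
    moreover have "g c' = g c" by (rule m[THEN bspec, THEN mp]) (use c' in auto)
    ultimately show "h (f c') (g c') = h (f c) (g c)" by simp
  qed
qed

lemma Tp_combine:
  assumes f: "f \<in> Tp" and g: "g \<in> Tp" and h: "h 0 0 = 0"
  shows "(\<lambda>c. h (f c) (g c)) \<in> Tp"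
proof -
  obtain X where X: "finite X" "\<And>c. f c \<noteq> 0 \<Longrightarrow> fchain E c \<and> fst (c 0) \<in> X"
    using Tp_support[OF f] by metis
  obtain Y where Y: "finite Y" "\<And>c. g c \<noteq> 0 \<Longrightarrow> fchain E c \<and> fst (c 0) \<in> Y"
    using Tp_support[OF g] by metis
  show ?thesis
  proof (rule Tp_I[of _ "X \<union> Y"])
    show "lc_shift (Pplus E) (\<lambda>c. h (f c) (g c))"      by (rule lc_shift_combine[OF Tp_lc[OF f] Tp_lc[OF g]])
    show "finite (X \<union> Y)" using X Y by blast
    fix c assume "h (f c) (g c) \<noteq> 0"
    then have "f c \<noteq> 0 \<or> g c \<noteq> 0" using h by auto
    then show "fchain E c \<and> fst (c 0) \<in> X \<union> Y" using X Y by blast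
  qed
qed

lemma Tp_zero: "(\<lambda>_. 0) \<in> Tp"
  by (rule Tp_I[of _ "{}"]) (auto simp: lc_shift_def)

lemma Tp_add: "f \<in> Tp \<Longrightarrow> g \<in> Tp \<Longrightarrow> (\<lambda>c. f c + g c) \<in> Tp"
  using Tp_combine[of f g "(+)"] by simp

lemma Tp_diff: "f \<in> Tp \<Longrightarrow> g \<in> Tp \<Longrightarrow> (\<lambda>c. f c - g c) \<in> Tp"
  using Tp_combine[of f g "(-)"] by simp

lemma Tp_scale: "f \<in> Tp \<Longrightarrow> (\<lambda>c. k * f c) \<in> Tp"
  using Tp_combine[of f f "\<lambda>a _. k * a"] by simp

lemma Tp_mult: "f \<in> Tp \<Longrightarrow> g \<in> Tp \<Longrightarrow> (\<lambda>c. f c * g c) \<in> Tp"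
  using Tp_combine[of f g "(*)"] by simp

lemma chains_from_finite:
  assumes "finite X"
  shows "finite ((\<lambda>c. c n) ` {c. fchain E c \<and> fst (c 0) \<in> X})"
proof (induction n)
  case 0
  show ?case
    by (rule finite_subset[OF _ finite_edges_from[OF assms]]) (auto simp: fchain_edge)
next
  case (Suc n)
  have "(\<lambda>c. c (Suc n)) ` {c. fchain E c \<and> fst (c 0) \<in> X}
      \<subseteq> {e \<in> E. fst e \<in> snd ` (\<lambda>c. c n) ` {c. fchain E c \<and> fst (c 0) \<in> X}}"
    by (force simp: fchain_edge fchain_snd[symmetric])
  then show ?case using finite_edges_from Suc finite_subset by blast
qed

lemma fchain_closed:
  assumes "\<And>n. \<exists>c'. fchain E c' \<and> (\<forall>i<n. c' i = c i)"
  shows "fchain E c"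
proof -
  have "c n \<in> E \<and> snd (c n) = fst (c (Suc n)) \<and> snd (c (Suc n)) \<noteq> fst (c n)" for n
  proof -
    obtain c' where "fchain E c'" "\<forall>i<Suc (Suc n). c' i = c i" using assms by blast
    then have "fchain E c'" "c' n = c n" "c' (Suc n) = c (Suc n)" by auto
    then show ?thesis unfolding fchain_def by metis
  qed
  then show ?thesis unfolding fchain_def by blast
qed

text \<open>Compactness applies only over the finite set of origins of the support. The additional
  edge in \<open>Suc n\<close> makes two agreeing chains share their origin, so both lie over that
  set or \<open>f\<close> vanishes at both.\<close>

lemma Tp_level:
  assumes f: "f \<in> Tp"
  shows "\<exists>n. level (Suc n) f"
proof -
  obtain X where X: "finite X" "\<And>c. f c \<noteq> 0 \<Longrightarrow> fchain E c \<and> fst (c 0) \<in> X"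
    using Tp_support[OF f] by metis
  define S where "S = {c. fchain E c \<and> fst (c 0) \<in> X}"
  have "\<exists>n. \<forall>c\<in>S. \<forall>c'\<in>S. (\<forall>i<n. c' i = c i) \<longrightarrow> f c' = f c"
  proof (rule finite_branching_uniform)
    show "finite ((\<lambda>c. c n) ` S)" for n unfolding S_def by (rule chains_from_finite[OF X(1)])
  next
    fix c assume h: "\<And>n. \<exists>c'\<in>S. \<forall>i<n. c' i = c i"
    have "fchain E c" by (rule fchain_closed) (use h in \<open>auto simp: S_def\<close>)
    moreover have "fst (c 0) \<in> X" using h[of 1] by (auto simp: S_def)
    ultimately show "c \<in> S" by (simp add: S_def)
  next
    fix c assume "c \<in> S"
    then have "c \<in> Pplus E" by (simp add: S_def Pplus_def)
    from bspec[OF Tp_lc[OF f, unfolded lc_shift_def] this] obtain n where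
      "\<forall>c'\<in>Pplus E. (\<forall>i<n. c' i = c i) \<longrightarrow> f c' = f c" ..
    then show "\<exists>n. \<forall>c'\<in>S. (\<forall>i<n. c' i = c i) \<longrightarrow> f c' = f c"
      by (intro exI[of _ n]) (simp add: S_def Pplus_def)
  qed
  then obtain n where n: "\<forall>c\<in>S. \<forall>c'\<in>S. (\<forall>i<n. c' i = c i) \<longrightarrow> f c' = f c" ..
  have "level (Suc n) f"
    unfolding level_def
  proof (intro allI impI)
    fix c c' assume h: "fchain E c" "fchain E c'" "\<forall>i<Suc n. c' i = c i"
    show "f c' = f c"
    proof (cases "c \<in> S")
      case True
      then have "c' \<in> S" using h by (simp add: S_def)
      show ?thesis by (rule n[THEN bspec[OF _ True], THEN bspec[OF _ \<open>c' \<in> S\<close>], THEN mp]) (use h in simp)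
    next
      case False
      then have "c' \<notin> S" using h by (simp add: S_def)
      then have "f c = 0" "f c' = 0" using False X(2) by (auto simp: S_def)
      then show ?thesis by simp
    qed
  qed
  then show ?thesis ..
qed

lemma preds_eq:
  "fchain E c \<Longrightarrow> {e \<in> E. consC e c \<in> Pplus E} = {e \<in> E. snd e = fst (c 0) \<and> fst e \<noteq> snd (c 0)}"
  by (auto simp: Pplus_def fchain_consC_iff)

lemma L_eq:
  "fchain E c \<Longrightarrow> L f c = (\<Sum>e\<in>{e \<in> E. snd e = fst (c 0) \<and> fst e \<noteq> snd (c 0)}. f (consC e c))"
  unfolding transfer_def using preds_eq[of c] by (simp add: Pplus_def)

lemma L_off: "\<not> fchain E c \<Longrightarrow> L f c = 0"
  by (simp add: transfer_def Pplus_def)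

lemma finite_edges_to: "finite {e \<in> E. snd e = x \<and> P e}"
proof -
  have "{e \<in> E. snd e = x \<and> P e} \<subseteq> (\<lambda>y. (y, x)) ` {y. (x, y) \<in> E}" using edge_sym by force
  then show ?thesis using finite_nbrs finite_subset by blast
qed

lemma L_add: "L (\<lambda>c. f c + g c) = (\<lambda>c. L f c + L g c)"
  by (rule ext) (simp add: transfer_def sum.distrib)

lemma L_scale: "L (\<lambda>c. k * f c) = (\<lambda>c. k * L f c)"
  by (rule ext) (simp add: transfer_def sum_distrib_left)

text \<open>A prepended edge uses up one edge of the dependence. The set of admissible predecessors
  is decided by \<open>c 0\<close>, which is why the level cannot be lowered below one.\<close>

lemma L_level:
  assumes f: "level (Suc n) f" and n: "n \<ge> 1"
  shows "level n (L f)"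
  unfolding level_def
proof (intro allI impI)
  fix c c' assume h: "fchain E c" "fchain E c'" "\<forall>i<n. c' i = c i"
  then have 0: "c' 0 = c 0" using n by simp
  have "f (consC e c') = f (consC e c)" if "e \<in> E" "snd e = fst (c 0)" "fst e \<noteq> snd (c 0)" for e
  proof (rule levelD[OF f])
    show "fchain E (consC e c)" "fchain E (consC e c')" using that h 0 by (auto simp: fchain_consC_iff)
    show "consC e c' i = consC e c i" if "i < Suc n" for i using that h by (cases i) auto
  qed
  then show "L f c' = L f c" unfolding L_eq[OF h(1)] L_eq[OF h(2)] 0 by (intro sum.cong) auto
qed

lemma L_Tp:
  assumes f: "f \<in> Tp"
  shows "L f \<in> Tp"
proof -
  obtain X where X: "finite X" "\<And>c. f c \<noteq> 0 \<Longrightarrow> fchain E c \<and> fst (c 0) \<in> X"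
    using Tp_support[OF f] by metis
  obtain n where "level (Suc n) f" using Tp_level[OF f] by blast
  \<comment> \<open>A spare edge, so that \<open>L_level\<close> applies also when \<open>f\<close>
    has level one.\<close>
  then have "level (Suc (Suc n)) f" by (rule level_mono) simp
  then have "level (Suc n) (L f)" by (rule L_level) simp
  then show ?thesis
  proof (rule Tp_I[OF level_lc_shift])
    show "finite (snd ` {e \<in> E. fst e \<in> X})" using finite_edges_from[OF X(1)] by blast
    fix c assume "L f c \<noteq> 0"
    moreover then have c: "fchain E c" using L_off by blast
    ultimately obtain e where e: "e \<in> E" "snd e = fst (c 0)" "f (consC e c) \<noteq> 0"
      unfolding L_eq[OF c] by (auto elim: sum.not_neutral_contains_not_neutral)
    then have "fst e \<in> X" using X(2)[of "consC e c"] by simp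
    then show "fchain E c \<and> fst (c 0) \<in> snd ` {e \<in> E. fst e \<in> X}" using c e by force
  qed
qed

lemma funpow_L_Tp: "f \<in> Tp \<Longrightarrow> (L ^^ m) f \<in> Tp"
  by (induction m) (auto intro: L_Tp)

lemma funpow_L_level:
  assumes "level (Suc n) f" "m \<le> n"
  shows "level (Suc (n - m)) ((L ^^ m) f)"
  using assms(2)
proof (induction m)
  case (Suc m)
  then have "level (Suc (Suc (n - Suc m))) ((L ^^ m) f)" by (simp add: Suc_diff_Suc)
  then show ?case using L_level by simp
qed (use assms in simp)

lemma ex_next_edge:
  assumes "e \<in> E"
  shows "\<exists>e'\<in>E. fst e' = snd e \<and> snd e' \<noteq> fst e"
proof -
  have "{y. (snd e, y) \<in> E} \<noteq> {fst e}" using card_nbrs[of "snd e"] q2 by auto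
  moreover have "fst e \<in> {y. (snd e, y) \<in> E}" using assms edge_sym by simp
  ultimately obtain y where "(snd e, y) \<in> E" "y \<noteq> fst e" by blast
  then show ?thesis by (intro bexI[of _ "(snd e, y)"]) auto
qed

definition next_edge :: "'v \<times> 'v \<Rightarrow> 'v \<times> 'v" where
  "next_edge e = (SOME e'. e' \<in> E \<and> fst e' = snd e \<and> snd e' \<noteq> fst e)"

text \<open>An arbitrary chain beginning with \<open>e\<close>. It turns a function of level one
  into a function on edges.\<close>

definition rep :: "'v \<times> 'v \<Rightarrow> 'v chn" where
  "rep e n = (next_edge ^^ n) e"

lemma rep_0 [simp]: "rep e 0 = e"
  by (simp add: rep_def)

lemma rep_fchain:
  assumes "e \<in> E"
  shows "fchain E (rep e)"
proof -
  have next_edge: "next_edge e \<in> E \<and> fst (next_edge e) = snd e \<and> snd (next_edge e) \<noteq> fst e" if "e \<in> E" for e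
    unfolding next_edge_def using ex_next_edge[OF that] by (intro someI_ex[of "\<lambda>e'. e' \<in> E \<and> _ e'"]) blast
  have "rep e n \<in> E" for n unfolding rep_def using assms next_edge by (induction n) auto
  then show ?thesis unfolding fchain_def using next_edge by (simp add: rep_def)
qed

lemma level1_rep:
  assumes "level 1 f" "fchain E c"
  shows "f c = f (rep (c 0))"
  by (rule levelD[OF assms(1)]) (use assms rep_fchain fchain_edge in auto)

definition fib :: "'v \<Rightarrow> 'v chn \<Rightarrow> complex" where
  "fib x c = (if c \<in> Pplus E \<and> pi_plus c = x then 1 else 0)"

lemma fib_eq: "fib x c = (if fchain E c \<and> fst (c 0) = x then 1 else 0)"
  by (simp add: fib_def Pplus_def pi_plus_def)

lemma level_fib: "level 1 (fib x)"
  unfolding level_def by (simp add: fib_eq)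

lemma fib_Tp: "fib x \<in> Tp"
  by (rule Tp_I[OF level_lc_shift[OF level_fib], of "{x}"]) (auto simp: fib_eq split: if_splits)

definition cyl :: "'v \<times> 'v \<Rightarrow> 'v chn \<Rightarrow> complex" where
  "cyl e c = (if fchain E c \<and> c 0 = e then 1 else 0)"

lemma cyl_Tp: "cyl e \<in> Tp"
proof (rule Tp_I[of _ "{fst e}"])
  have "level 1 (cyl e)" unfolding level_def by (simp add: cyl_def)
  then show "lc_shift (Pplus E) (cyl e)" by (rule level_lc_shift)
qed (auto simp: cyl_def split: if_splits)

text \<open>The edge \<open>e\<close> can be prepended to exactly those chains that start at
  \<open>snd e\<close> and do not go straight back along \<open>e\<close>. This relation ties
  cylinders to the fibres seen by the pushforward.\<close>

lemma L_cyl: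
  assumes e: "e \<in> E"
  shows "L (cyl e) = (\<lambda>c. fib (snd e) c - cyl (snd e, fst e) c)"
proof
  fix c
  show "L (cyl e) c = fib (snd e) c - cyl (snd e, fst e) c"
  proof (cases "fchain E c")
    case True
    define A where "A = {e \<in> E. snd e = fst (c 0) \<and> fst e \<noteq> snd (c 0)}"
    have "L (cyl e) c = (\<Sum>e'\<in>A. if e' = e then 1 else 0)"
      unfolding L_eq[OF True] A_def by (rule sum.cong) (auto simp: cyl_def fchain_consC_iff True)
    also have "\<dots> = (if e \<in> A then 1 else 0)" using finite_edges_to by (simp add: A_def)
    also have "\<dots> = fib (snd e) c - cyl (snd e, fst e) c"
      using e True by (cases "c 0") (auto simp: A_def fib_eq cyl_def)
    finally show ?thesis .
  next
    case False
    then show ?thesis by (simp add: L_off fib_eq cyl_def)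
  qed
qed

end

lemma dual_add: "is_dual T u \<Longrightarrow> f \<in> T \<Longrightarrow> g \<in> T \<Longrightarrow> u (\<lambda>a. f a + g a) = u f + u g"
  unfolding is_dual_def by blast

lemma dual_scale: "is_dual T u \<Longrightarrow> f \<in> T \<Longrightarrow> u (\<lambda>a. k * f a) = k * u f"
  unfolding is_dual_def by blast

lemma dual_off: "is_dual T u \<Longrightarrow> f \<notin> T \<Longrightarrow> u f = 0"
  unfolding is_dual_def by blast

lemma dual_sum:
  assumes u: "is_dual T u" and zero: "(\<lambda>_. 0) \<in> T"
    and add: "\<And>f g. f \<in> T \<Longrightarrow> g \<in> T \<Longrightarrow> (\<lambda>a. f a + g a) \<in> T"
    and f: "\<And>i. i \<in> I \<Longrightarrow> f i \<in> T"
  shows "(\<lambda>a. \<Sum>i\<in>I. f i a) \<in> T \<and> u (\<lambda>a. \<Sum>i\<in>I. f i a) = (\<Sum>i\<in>I. u (f i))"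
proof -
  have u0: "u (\<lambda>_. 0) = 0" using dual_scale[OF u zero, of 0] by simp
  show ?thesis
    using f
  proof (induction I rule: infinite_finite_induct)
    case (insert i I)
    then show ?case using add[of "f i" "\<lambda>a. \<Sum>i\<in>I. f i a"] dual_add[OF u, of "f i" "\<lambda>a. \<Sum>i\<in>I. f i a"] by simp
  qed (use u0 zero in auto)
qed

section \<open>The resonant state of an eigenfunction: uniqueness and construction\<close>

locale eigenfunction = reg_tree E q for E :: "('v \<times> 'v) set" and q :: nat +
  fixes s :: complex and \<phi> :: "'v \<Rightarrow> complex"
  assumes chi_ne: "chi q s \<notin> {1, -1}" and eigen: "lap E q \<phi> = (\<lambda>x. chi q s * \<phi> x)"
begin

definition z :: complex where "z = of_nat q powr (1/2 + \<i> * s)"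

lemma q_plus_one_nonzero: "(of_nat q + 1 :: complex) \<noteq> 0"
  by (metis of_nat_Suc of_nat_eq_0_iff nat.distinct(1) add.commute)

lemma z_nonzero: "z \<noteq> 0"
  using q2 by (simp add: z_def)

text \<open>With \<open>r\<close> the root of \<open>q\<close> and
  \<open>p = q powr (\<i> * s)\<close> one has \<open>z = r * p\<close> and
  \<open>q / z = r / p\<close>, the two summands of \<open>chi\<close> up to normalisation.\<close>

lemma chi_z: "(of_nat q + 1) * chi q s = z + of_nat q / z"
proof -
  have q: "(of_nat q :: complex) \<noteq> 0" using q2 by simp
  have sq: "of_nat q powr (1/2) = complex_of_real (sqrt (real q))"
  proof -
    have "complex_of_real (real q) powr complex_of_real (1/2) = complex_of_real (real q powr (1/2))"
      by (rule powr_of_real[of "real q" "1/2"]) simp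
    then show ?thesis by (simp add: powr_half_sqrt)
  qed
  have sq2: "complex_of_real (sqrt (real q)) * complex_of_real (sqrt (real q)) = of_nat q"
    by (metis of_real_mult of_real_of_nat_eq of_nat_0_le_iff real_sqrt_mult_self abs_of_nonneg)
  define r p where "r = complex_of_real (sqrt (real q))" and "p = of_nat q powr (\<i> * s)"
  have rr: "r * r = of_nat q" and r0: "r \<noteq> 0" using sq2 q2 by (auto simp: r_def)
  have p0: "p \<noteq> 0" using q by (simp add: p_def)
  have z: "z = r * p" unfolding z_def r_def p_def powr_add sq ..
  have pm: "of_nat q powr (- \<i> * s) = 1 / p" unfolding p_def by (simp add: powr_minus_divide)
  have "chi q s = r / (of_nat q + 1) * (p + 1 / p)"
    unfolding chi_def pm by (simp add: r_def p_def)
  then have "(of_nat q + 1) * chi q s = r * (p + 1 / p)" using q_plus_one_nonzero by simp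
  also have "\<dots> = z + of_nat q / z" unfolding z rr[symmetric] using r0 p0 by (simp add: field_simps)
  finally show ?thesis .
qed

lemma z_square: "z * z - 1 \<noteq> 0"
proof
  assume "z * z - 1 = 0"
  then have "(z - 1) * (z + 1) = 0" by (simp add: algebra_simps)
  then have "z = 1 \<or> z = -1" by (simp add: eq_neg_iff_add_eq_0)
  then show False
  proof (elim disjE)
    assume "z = 1"
    then have "(of_nat q + 1) * chi q s = (of_nat q + 1) * 1" using chi_z by simp
    then show False using q_plus_one_nonzero chi_ne unfolding mult_cancel_left by blast
  next
    assume "z = -1"
    then have "(of_nat q + 1) * chi q s = (of_nat q + 1) * (-1)" using chi_z by simp
    then show False using q_plus_one_nonzero chi_ne unfolding mult_cancel_left by blast
  qed
qed

lemma sum_nbrs: "(\<Sum>y\<in>{y. (x, y) \<in> E}. \<phi> y) = (z + of_nat q / z) * \<phi> x"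
proof -
  have "1 / (of_nat q + 1) * (\<Sum>y\<in>{y. (x, y) \<in> E}. \<phi> y) = chi q s * \<phi> x"
    using fun_cong[OF eigen, of x] by (simp add: lap_def)
  then have "(\<Sum>y\<in>{y. (x, y) \<in> E}. \<phi> y) = (of_nat q + 1) * chi q s * \<phi> x"
    using q_plus_one_nonzero by (simp add: field_simps)
  then show ?thesis by (simp add: chi_z)
qed

text \<open>The solution of \<open>z u(x,y) + u(y,x) = \<phi> y\<close> and \<open>z u(y,x) + u(x,y) = \<phi> x\<close>, which is the eigenvalue
  equation on one-edge cylinders.\<close>

definition u0 :: "'v \<times> 'v \<Rightarrow> complex" where
  "u0 e = (z * \<phi> (snd e) - \<phi> (fst e)) / (z * z - 1)"

lemma edges_from_eq: "{e \<in> E. fst e = x} = (\<lambda>y. (x, y)) ` {y. (x, y) \<in> E}"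
  by force

text \<open>A fibre is the disjoint union of its one-edge cylinders. The sum over neighbours comes
  from the eigenvalue equation, and \<open>z * (z + q / z) - (q + 1)\<close> is exactly the
  denominator.\<close>

lemma sum_u0: "(\<Sum>e\<in>{e \<in> E. fst e = x}. u0 e) = \<phi> x"
proof -
  have "(\<Sum>e\<in>{e \<in> E. fst e = x}. u0 e) = (\<Sum>y\<in>{y. (x, y) \<in> E}. (z * \<phi> y - \<phi> x) / (z * z - 1))"
    unfolding edges_from_eq by (subst sum.reindex) (auto simp: inj_on_def u0_def)
  also have "\<dots> = (z * (\<Sum>y\<in>{y. (x, y) \<in> E}. \<phi> y) - (of_nat q + 1) * \<phi> x) / (z * z - 1)"
    by (simp add: sum_divide_distrib[symmetric] sum_subtractf sum_distrib_left card_nbrs)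
  also have "\<dots> = ((z * z - 1) * \<phi> x) / (z * z - 1)"
  proof -
    have "z * ((z + of_nat q / z) * \<phi> x) - (of_nat q + 1) * \<phi> x = (z * z - 1) * \<phi> x"
      using z_nonzero by (simp add: field_simps)
    then show ?thesis unfolding sum_nbrs by simp
  qed
  finally show ?thesis using z_square by simp
qed

text \<open>All edges leaving \<open>snd e\<close> contribute \<phi> there, and removing the
  reversed edge leaves \<open>z * u0 e\<close>. This is the consistency that lets \<open>u0\<close>
  extend to an eigenfunctional.\<close>

lemma sum_u0_next:
  assumes e: "e \<in> E"
  shows "(\<Sum>c\<in>{c \<in> E. fst c = snd e \<and> snd c \<noteq> fst e}. u0 c) = z * u0 e"
proof -
  have fin: "finite {c \<in> E. fst c = snd e}" unfolding edges_from_eq using finite_nbrs by blast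
  have "{c \<in> E. fst c = snd e \<and> snd c \<noteq> fst e} = {c \<in> E. fst c = snd e} - {(snd e, fst e)}" by auto
  then have "(\<Sum>c\<in>{c \<in> E. fst c = snd e \<and> snd c \<noteq> fst e}. u0 c) = \<phi> (snd e) - u0 (snd e, fst e)"
    using sum_diff1[OF fin, of u0 "(snd e, fst e)"] edge_sym[of "fst e" "snd e"] e by (simp add: sum_u0)
  also have "\<dots> = z * u0 e" unfolding u0_def using z_square by (simp add: field_simps)
  finally show ?thesis .
qed

definition is_resonant :: "(('v chn \<Rightarrow> complex) \<Rightarrow> complex) \<Rightarrow> bool" where
  "is_resonant u \<longleftrightarrow> is_dual Tp u \<and> (\<forall>f\<in>Tp. u (L f) = z * u f) \<and> pushfw (Pplus E) pi_plus u = \<phi>"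

lemma resonant_dual: "is_resonant u \<Longrightarrow> is_dual Tp u"
  unfolding is_resonant_def by blast

lemma resonant_L: "is_resonant u \<Longrightarrow> f \<in> Tp \<Longrightarrow> u (L f) = z * u f"
  unfolding is_resonant_def by blast

lemma resonant_fib: "is_resonant u \<Longrightarrow> u (fib x) = \<phi> x"
  unfolding is_resonant_def pushfw_def fib_def by (metis (no_types, lifting))

text \<open>The value that a resonant state is forced to take on functions of level one. For test
  functions the index set is finite, and \<open>u1_eq\<close> enlarges it when convenient.\<close>

definition u1 :: "('v chn \<Rightarrow> complex) \<Rightarrow> complex" where
  "u1 f = (\<Sum>e\<in>{e \<in> E. f (rep e) \<noteq> 0}. u0 e * f (rep e))"

lemma u1_eq:
  assumes "finite A" "A \<subseteq> E" "\<And>e. e \<in> E \<Longrightarrow> f (rep e) \<noteq> 0 \<Longrightarrow> e \<in> A"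
  shows "u1 f = (\<Sum>e\<in>A. u0 e * f (rep e))"
  unfolding u1_def by (rule sum.mono_neutral_left) (use assms in auto)

lemma Tp_edge_support:
  assumes "f \<in> Tp"
  shows "\<exists>A. finite A \<and> A \<subseteq> E \<and> (\<forall>c. f c \<noteq> 0 \<longrightarrow> fchain E c \<and> c 0 \<in> A)"
proof -
  obtain X where X: "finite X" "\<And>c. f c \<noteq> 0 \<Longrightarrow> fchain E c \<and> fst (c 0) \<in> X"
    using Tp_support[OF assms] by metis
  then show ?thesis
    by (intro exI[of _ "{e \<in> E. fst e \<in> X}"]) (auto simp: finite_edges_from fchain_edge)
qed

lemma Tp_edge_support2:
  assumes "f \<in> Tp" "g \<in> Tp"
  shows "\<exists>A. finite A \<and> A \<subseteq> E \<and> (\<forall>c. f c \<noteq> 0 \<longrightarrow> c 0 \<in> A) \<and> (\<forall>c. g c \<noteq> 0 \<longrightarrow> c 0 \<in> A)"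
proof -
  obtain A B where "finite A \<and> A \<subseteq> E \<and> (\<forall>c. f c \<noteq> 0 \<longrightarrow> fchain E c \<and> c 0 \<in> A)"
    "finite B \<and> B \<subseteq> E \<and> (\<forall>c. g c \<noteq> 0 \<longrightarrow> fchain E c \<and> c 0 \<in> B)"
    using Tp_edge_support assms by meson
  then show ?thesis by (intro exI[of _ "A \<union> B"]) auto
qed

lemma u1_add:
  assumes "f \<in> Tp" "g \<in> Tp"
  shows "u1 (\<lambda>c. f c + g c) = u1 f + u1 g"
proof -
  obtain A where A: "finite A" "A \<subseteq> E" "\<And>c. f c \<noteq> 0 \<Longrightarrow> c 0 \<in> A" "\<And>c. g c \<noteq> 0 \<Longrightarrow> c 0 \<in> A"
    using Tp_edge_support2[OF assms] by metis
  have f: "e \<in> A" if "f (rep e) \<noteq> 0" for e using A(3)[OF that] by simp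
  have g: "e \<in> A" if "g (rep e) \<noteq> 0" for e using A(4)[OF that] by simp
  have fg: "e \<in> A" if "f (rep e) + g (rep e) \<noteq> 0" for e
    using f[of e] g[of e] that by (cases "f (rep e) = 0") simp_all
  show ?thesis
    using u1_eq[OF A(1,2), of f] u1_eq[OF A(1,2), of g] u1_eq[OF A(1,2), of "\<lambda>c. f c + g c"] f g fg
    by (simp add: sum.distrib distrib_left)
qed

lemma u1_scale: "u1 (\<lambda>c. k * f c) = k * u1 f"
  by (cases "k = 0") (simp_all add: u1_def sum_distrib_left ac_simps)

text \<open>After exchanging the sums, the coefficient of \<open>f (rep e)\<close> is the sum of
  \<open>u0\<close> over all continuations of \<open>e\<close>, to which \<open>sum_u0_next\<close>
  applies.\<close>

lemma u1_L:
  assumes f: "f \<in> Tp" "level 1 f"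
  shows "u1 (L f) = z * u1 f"
proof -
  obtain A where A: "finite A" "A \<subseteq> E" "\<And>c. f c \<noteq> 0 \<Longrightarrow> fchain E c \<and> c 0 \<in> A"
    using Tp_edge_support[OF f(1)] by metis
  obtain B where B: "finite B" "B \<subseteq> E" "\<And>c. L f c \<noteq> 0 \<Longrightarrow> fchain E c \<and> c 0 \<in> B"
    using Tp_edge_support[OF L_Tp[OF f(1)]] by metis
  \<comment> \<open>Large enough for the support of \<open>L f\<close> and for every continuation of
    an edge in \<open>A\<close>; the latter makes the inner sums complete.\<close>
  define C where "C = B \<union> {c \<in> E. fst c \<in> snd ` A}"
  have C: "finite C" "C \<subseteq> E" using A B by (auto simp: C_def intro: finite_edges_from)
  have Lf: "L f (rep c) = (\<Sum>e\<in>A. if snd e = fst c \<and> fst e \<noteq> snd c then f (rep e) else 0)"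
    if c: "c \<in> E" for c
  proof -
    have fc: "fchain E (rep c)" using rep_fchain c by blast
    have "L f (rep c) = (\<Sum>e\<in>{e \<in> E. snd e = fst c \<and> fst e \<noteq> snd c}. f (rep e))"
      unfolding L_eq[OF fc]
    proof (rule sum.cong)
      fix e assume "e \<in> {e \<in> E. snd e = fst c \<and> fst e \<noteq> snd c}"
      then have "fchain E (consC e (rep c))" using fc by (auto simp: fchain_consC_iff)
      then show "f (consC e (rep c)) = f (rep e)" using level1_rep[OF f(2)] by fastforce
    qed simp
    also have "\<dots> = (\<Sum>e\<in>{e \<in> A. snd e = fst c \<and> fst e \<noteq> snd c}. f (rep e))"
      by (rule sum.mono_neutral_right) (use A(2) A(3)[of "rep _"] finite_edges_to in auto)
    also have "\<dots> = (\<Sum>e\<in>A. if snd e = fst c \<and> fst e \<noteq> snd c then f (rep e) else 0)"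
      using A(1) by (simp add: sum.inter_filter)
    finally show ?thesis .
  qed
  have "u1 (L f) = (\<Sum>c\<in>C. u0 c * L f (rep c))"
    by (rule u1_eq[OF C]) (use B(3)[of "rep _"] in \<open>auto simp: C_def\<close>)
  also have "\<dots> = (\<Sum>c\<in>C. \<Sum>e\<in>A. if snd e = fst c \<and> fst e \<noteq> snd c then u0 c * f (rep e) else 0)"
  proof (rule sum.cong)
    fix c assume "c \<in> C"
    then have "c \<in> E" using C(2) by blast
    then show "u0 c * L f (rep c) = (\<Sum>e\<in>A. if snd e = fst c \<and> fst e \<noteq> snd c then u0 c * f (rep e) else 0)"
      unfolding Lf[OF \<open>c \<in> E\<close>] sum_distrib_left by (intro sum.cong) auto
  qed simp
  also have "\<dots> = (\<Sum>e\<in>A. \<Sum>c\<in>C. if snd e = fst c \<and> fst e \<noteq> snd c then u0 c * f (rep e) else 0)"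
    by (rule sum.swap)
  also have "\<dots> = (\<Sum>e\<in>A. z * (u0 e * f (rep e)))"
  proof (rule sum.cong)
    fix e assume e: "e \<in> A"
    have "(\<Sum>c\<in>C. if snd e = fst c \<and> fst e \<noteq> snd c then u0 c * f (rep e) else 0)
        = (\<Sum>c\<in>{c \<in> C. snd e = fst c \<and> fst e \<noteq> snd c}. u0 c * f (rep e))"
      using C(1) by (simp add: sum.inter_filter)
    also have "{c \<in> C. snd e = fst c \<and> fst e \<noteq> snd c} = {c \<in> E. fst c = snd e \<and> snd c \<noteq> fst e}"
      using e C(2) by (auto simp: C_def)
    finally show "(\<Sum>c\<in>C. if snd e = fst c \<and> fst e \<noteq> snd c then u0 c * f (rep e) else 0) = z * (u0 e * f (rep e))"
      using sum_u0_next[of e] e A(2) by (auto simp: sum_distrib_right[symmetric])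
  qed simp
  also have "\<dots> = z * u1 f"
    using u1_eq[OF A(1,2), of f] A(3)[of "rep _"] by (simp add: sum_distrib_left)
  finally show ?thesis .
qed

text \<open>Evaluating \<open>u\<close> in \<open>L_cyl\<close> for \<open>e\<close> and for its
  reversal gives two linear equations for the two oriented cylinders, with determinant
  \<open>z * z - 1\<close>.\<close>

lemma resonant_cyl:
  assumes u: "is_resonant u" and e: "e \<in> E"
  shows "u (cyl e) = u0 e"
proof -
  have eq: "z * u (cyl e) + u (cyl (snd e, fst e)) = \<phi> (snd e)" if "e \<in> E" for e
  proof -
    have "fib (snd e) = (\<lambda>c. L (cyl e) c + cyl (snd e, fst e) c)" unfolding L_cyl[OF that] by simp
    then have "u (fib (snd e)) = u (L (cyl e)) + u (cyl (snd e, fst e))"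
      using dual_add[OF resonant_dual[OF u] L_Tp[OF cyl_Tp] cyl_Tp] by simp
    then show ?thesis using resonant_fib[OF u] resonant_L[OF u cyl_Tp] by simp
  qed
  have "(snd e, fst e) \<in> E" using e edge_sym by simp
  from eq[OF this] have "z * u (cyl (snd e, fst e)) + u (cyl e) = \<phi> (fst e)" by simp
  then have "(z * z - 1) * u (cyl e) = z * \<phi> (snd e) - \<phi> (fst e)"
    unfolding eq[OF e, symmetric] by (simp add: algebra_simps flip: \<open>_ = \<phi> (fst e)\<close>)
  then show ?thesis unfolding u0_def using z_square by (simp add: field_simps)
qed

lemma resonant_level1:
  assumes u: "is_resonant u" and f: "f \<in> Tp" "level 1 f"
  shows "u f = u1 f"
proof -
  obtain A where A: "finite A" "A \<subseteq> E" "\<And>c. f c \<noteq> 0 \<Longrightarrow> fchain E c \<and> c 0 \<in> A"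
    using Tp_edge_support[OF f(1)] by metis
  have "f = (\<lambda>c. \<Sum>e\<in>A. f (rep e) * cyl e c)"
  proof
    fix c
    show "f c = (\<Sum>e\<in>A. f (rep e) * cyl e c)"
    proof (cases "fchain E c")
      case True
      then have "(\<Sum>e\<in>A. f (rep e) * cyl e c) = (\<Sum>e\<in>A. if e = c 0 then f c else 0)"
        using level1_rep[OF f(2) True] by (intro sum.cong) (auto simp: cyl_def)
      also have "\<dots> = f c" using A by auto
      finally show ?thesis ..
    next
      case False
      then show ?thesis using A(3) by (auto simp: cyl_def)
    qed
  qed
  then have "u f = u (\<lambda>c. \<Sum>e\<in>A. f (rep e) * cyl e c)" by simp
  also have "\<dots> = (\<Sum>e\<in>A. u (\<lambda>c. f (rep e) * cyl e c))"
    using dual_sum[OF resonant_dual[OF u] Tp_zero Tp_add, of A "\<lambda>e c. f (rep e) * cyl e c"] Tp_scale[OF cyl_Tp]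
    by blast
  also have "\<dots> = (\<Sum>e\<in>A. u0 e * f (rep e))"
    using A(2) by (intro sum.cong) (auto simp: dual_scale[OF resonant_dual[OF u] cyl_Tp] resonant_cyl[OF u])
  also have "\<dots> = u1 f" using u1_eq[OF A(1,2), of f] A(3)[of "rep _"] by simp
  finally show ?thesis .
qed

text \<open>If \<open>u\<close> is resonant then \<open>u ((L ^^ m) f)\<close> is
  \<open>z ^ m * u f\<close>; once \<open>(L ^^ m) f\<close> has level one, its value is given by
  \<open>u1\<close>.\<close>

definition approx :: "('v chn \<Rightarrow> complex) \<Rightarrow> nat \<Rightarrow> complex" where
  "approx f m = u1 ((L ^^ m) f) / z ^ m"

lemma resonant_approx:
  assumes u: "is_resonant u" and f: "f \<in> Tp" "level (Suc n) f"
  shows "u f = approx f n"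
proof -
  have "u ((L ^^ m) f) = z ^ m * u f" for m
    by (induction m) (simp_all add: resonant_L[OF u funpow_L_Tp[OF f(1)]])
  moreover have "u ((L ^^ n) f) = u1 ((L ^^ n) f)"
    by (rule resonant_level1[OF u funpow_L_Tp[OF f(1)]]) (use funpow_L_level[OF f(2), of n] in simp)
  ultimately show ?thesis using z_nonzero by (simp add: approx_def eq_divide_eq mult.commute)
qed

lemma resonant_unique: "is_resonant u \<Longrightarrow> is_resonant v \<Longrightarrow> u = v"
proof
  fix f assume u: "is_resonant u" and v: "is_resonant v"
  show "u f = v f"
  proof (cases "f \<in> Tp")
    case True
    then obtain n where "level (Suc n) f" using Tp_level by blast
    from resonant_approx[OF u True this] resonant_approx[OF v True this] show ?thesis by simp
  next
    case False
    then show ?thesis using dual_off resonant_dual u v by metis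
  qed
qed

text \<open>The sequence is eventually constant. Writing its value as a limit avoids choosing a
  level for each \<open>f\<close>, so linearity and the eigenvalue equation follow from limit
  rules.\<close>

definition ures :: "('v chn \<Rightarrow> complex) \<Rightarrow> complex" where
  "ures f = (if f \<in> Tp then lim (approx f) else 0)"

text \<open>Beyond the level of \<open>f\<close> every further transfer step contributes a factor
  \<open>z\<close> by \<open>u1_L\<close>, which the denominator cancels.\<close>

lemma approx_stable:
  assumes f: "f \<in> Tp" "level (Suc n) f"
  shows "approx f (n + k) = approx f n"
proof (induction k)
  case (Suc k)
  have "level (Suc (n + k)) f" using level_mono[OF f(2)] by simp
  from funpow_L_level[OF this, of "n + k"] have "level 1 ((L ^^ (n + k)) f)" by simp
  from u1_L[OF funpow_L_Tp[OF f(1)] this] have "approx f (Suc (n + k)) = approx f (n + k)"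
    using z_nonzero by (simp add: approx_def)
  then show ?case using Suc by simp
qed simp

lemma approx_limit:
  assumes f: "f \<in> Tp" "level (Suc n) f"
  shows "approx f \<longlonglongrightarrow> approx f n"
proof -
  have "\<forall>\<^sub>F m in sequentially. approx f n = approx f m"
    unfolding eventually_sequentially
    using approx_stable[OF f] by (metis le_add_diff_inverse)
  then show ?thesis by (rule Lim_transform_eventually[OF tendsto_const])
qed

lemma approx_ures:
  assumes f: "f \<in> Tp"
  shows "approx f \<longlonglongrightarrow> ures f"
proof -
  obtain n where "level (Suc n) f" using Tp_level[OF f] by blast
  from approx_limit[OF f this] show ?thesis using f by (simp add: ures_def limI)
qed

lemma funpow_L_add: "(L ^^ m) (\<lambda>c. f c + g c) = (\<lambda>c. (L ^^ m) f c + (L ^^ m) g c)"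
  by (induction m) (auto simp: L_add)

lemma funpow_L_scale: "(L ^^ m) (\<lambda>c. k * f c) = (\<lambda>c. k * (L ^^ m) f c)"
  by (induction m) (auto simp: L_scale)

lemma ures_resonant: "is_resonant ures"
  unfolding is_resonant_def
proof (intro conjI ballI)
  show "is_dual Tp ures"
    unfolding is_dual_def
  proof (intro conjI ballI allI impI)
    fix f g assume f: "f \<in> Tp" and g: "g \<in> Tp"
    have "approx (\<lambda>a. f a + g a) m = approx f m + approx g m" for m
      unfolding approx_def funpow_L_add
      using u1_add[OF funpow_L_Tp[OF f] funpow_L_Tp[OF g]] by (simp add: add_divide_distrib)
    then have "approx (\<lambda>a. f a + g a) \<longlonglongrightarrow> ures f + ures g"
      using tendsto_add[OF approx_ures[OF f] approx_ures[OF g]] by presburger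
    then show "ures (\<lambda>a. f a + g a) = ures f + ures g"
      using approx_ures[OF Tp_add[OF f g]] LIMSEQ_unique by blast
  next
    fix k f assume f: "f \<in> Tp"
    have "approx (\<lambda>a. k * f a) m = k * approx f m" for m
      unfolding approx_def funpow_L_scale u1_scale by simp
    then have "approx (\<lambda>a. k * f a) \<longlonglongrightarrow> k * ures f"
      using tendsto_mult_left[OF approx_ures[OF f]] by presburger
    then show "ures (\<lambda>a. k * f a) = k * ures f"
      using approx_ures[OF Tp_scale[OF f]] LIMSEQ_unique by blast
  qed (simp add: ures_def)
  fix f assume f: "f \<in> Tp"
  \<comment> \<open>Applying \<open>L\<close> merely shifts the sequence by one place; the missing
    power of \<open>z\<close> becomes the eigenvalue.\<close>
  have "approx (L f) m = z * approx f (Suc m)" for m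
    unfolding approx_def using z_nonzero by (simp add: funpow_swap1)
  then have "approx (L f) \<longlonglongrightarrow> z * ures f"
    using tendsto_mult_left[OF LIMSEQ_Suc[OF approx_ures[OF f]]] by presburger
  then show "ures (L f) = z * ures f" using approx_ures[OF L_Tp[OF f]] LIMSEQ_unique by blast
next
  show "pushfw (Pplus E) pi_plus ures = \<phi>"
  proof
    fix x
    \<comment> \<open>Fibre indicators have level one, so the sequence is already constant from
      index 0.\<close>
    have "approx (fib x) \<longlonglongrightarrow> approx (fib x) 0" by (rule approx_limit) (use fib_Tp level_fib in auto)
    then have "ures (fib x) = approx (fib x) 0" using approx_ures[OF fib_Tp] LIMSEQ_unique by blast
    also have "\<dots> = u1 (fib x)" by (simp add: approx_def)
    also have "\<dots> = (\<Sum>e\<in>{e \<in> E. fst e = x}. u0 e * fib x (rep e))"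
      by (rule u1_eq) (auto simp: fib_eq edges_from_eq finite_nbrs split: if_splits)
    also have "\<dots> = (\<Sum>e\<in>{e \<in> E. fst e = x}. u0 e)"
      by (rule sum.cong) (auto simp: fib_eq rep_fchain)
    finally show "pushfw (Pplus E) pi_plus ures x = \<phi> x"
      unfolding pushfw_def sum_u0 fib_def[abs_def] .
  qed
qed

lemma resonant_eqI: "is_resonant u \<Longrightarrow> resonant E q (Pplus E) pi_plus s \<phi> = u"
  unfolding resonant_def using resonant_unique
  by (intro the_equality) (auto simp: is_resonant_def z_def)

end

context reg_tree
begin

section \<open>Boundary values and resonant states\<close>

lemma pker_base: "\<omega> \<in> Omega E \<Longrightarrow> pker E q bo s bo \<omega> = 1"
  using q2 by (simp add: pker_def horo_base)

lemma pker_towards: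
  assumes "\<omega> \<in> Omega E" "snd (ray x \<omega> 0) = y"
  shows "pker E q bo s y \<omega> = of_nat q powr (1/2 + \<i> * s) * pker E q bo s x \<omega>"
proof -
  have "(1/2 + \<i> * s) * of_int (horo E bo y \<omega>)
      = (1/2 + \<i> * s) + (1/2 + \<i> * s) * of_int (horo E bo x \<omega>)"
    unfolding horo_towards[OF assms] by (simp add: algebra_simps)
  then show ?thesis unfolding pker_def by (simp add: powr_add)
qed

text \<open>The boundary function whose integral is the resonant state. Summing over the chains of
  \<omega> where \<open>f\<close> is nonzero needs no choice of vertices;
  \<open>sum_chains_eq\<close> passes to vertices, since a class has one chain per origin.\<close>

definition pull :: "'v \<Rightarrow> complex \<Rightarrow> ('v chn \<Rightarrow> complex) \<Rightarrow> 'v chn set \<Rightarrow> complex" where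
  "pull bo s f \<omega> = (if \<omega> \<in> Omega E
     then \<Sum>c\<in>{c \<in> \<omega>. f c \<noteq> 0}. pker E q bo s (fst (c 0)) \<omega> * f c else 0)"

lemma pull_off: "\<omega> \<notin> Omega E \<Longrightarrow> pull bo s f \<omega> = 0"
  by (simp add: pull_def)

lemma sum_chains_eq:
  assumes X: "finite X" "\<forall>c. f c \<noteq> 0 \<longrightarrow> fst (c 0) \<in> X" and \<omega>: "\<omega> \<in> Omega E"
  shows "(\<Sum>c\<in>{c \<in> \<omega>. f c \<noteq> 0}. k c * f c) = (\<Sum>x\<in>X. k (ray x \<omega>) * (f (ray x \<omega>) :: complex))"
proof -
  have set_eq: "{c \<in> \<omega>. f c \<noteq> 0} = (\<lambda>x. ray x \<omega>) ` {x \<in> X. f (ray x \<omega>) \<noteq> 0}"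
  proof
    show "{c \<in> \<omega>. f c \<noteq> 0} \<subseteq> (\<lambda>x. ray x \<omega>) ` {x \<in> X. f (ray x \<omega>) \<noteq> 0}"
    proof
      fix c assume "c \<in> {c \<in> \<omega>. f c \<noteq> 0}"
      then show "c \<in> (\<lambda>x. ray x \<omega>) ` {x \<in> X. f (ray x \<omega>) \<noteq> 0}"
        using ray_eqI[OF \<omega>, of c "fst (c 0)"] X(2) by (intro image_eqI[of _ _ "fst (c 0)"]) auto
    qed
    show "(\<lambda>x. ray x \<omega>) ` {x \<in> X. f (ray x \<omega>) \<noteq> 0} \<subseteq> {c \<in> \<omega>. f c \<noteq> 0}"
      using ray_in[OF \<omega>] by auto
  qed
  have inj: "inj_on (\<lambda>x. ray x \<omega>) A" for A
    by (rule inj_on_inverseI[of _ "\<lambda>c. fst (c 0)"]) (simp add: ray_start[OF \<omega>])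
  have "(\<Sum>c\<in>{c \<in> \<omega>. f c \<noteq> 0}. k c * f c)
      = (\<Sum>x\<in>{x \<in> X. f (ray x \<omega>) \<noteq> 0}. k (ray x \<omega>) * f (ray x \<omega>))"
    unfolding set_eq sum.reindex[OF inj] by simp
  also have "\<dots> = (\<Sum>x\<in>X. k (ray x \<omega>) * f (ray x \<omega>))"
    by (rule sum.mono_neutral_left) (use X in auto)
  finally show ?thesis .
qed

lemma pull_eq:
  assumes "finite X" "\<forall>c. f c \<noteq> 0 \<longrightarrow> fst (c 0) \<in> X" and \<omega>: "\<omega> \<in> Omega E"
  shows "pull bo s f \<omega> = (\<Sum>x\<in>X. pker E q bo s x \<omega> * f (ray x \<omega>))"
  using sum_chains_eq[OF assms, of "\<lambda>c. pker E q bo s (fst (c 0)) \<omega>"] \<omega>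
  by (simp add: pull_def ray_start)

lemma olc_ray:
  assumes "lc_shift (Pplus E) f"
  shows "olc y (\<lambda>\<omega>. f (ray x \<omega>))"
proof -
  have "olc x (\<lambda>\<omega>. f (ray x \<omega>))"
    unfolding olc_def
  proof
    fix \<omega> assume \<omega>: "\<omega> \<in> Omega E"
    then have "ray x \<omega> \<in> Pplus E" using ray_fchain by (simp add: Pplus_def)
    from bspec[OF assms[unfolded lc_shift_def] this] obtain n where
      "\<forall>c'\<in>Pplus E. (\<forall>i<n. c' i = ray x \<omega> i) \<longrightarrow> f c' = f (ray x \<omega>)" ..
    then show "\<exists>n. \<forall>\<eta>\<in>Omega E. (\<forall>i<n. ray x \<eta> i = ray x \<omega> i) \<longrightarrow> f (ray x \<eta>) = f (ray x \<omega>)"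
      by (intro exI[of _ n]) (simp add: Pplus_def ray_fchain)
  qed
  then show ?thesis by (rule olc_change_base)
qed

lemma pull_test:
  assumes f: "f \<in> Tp"
  shows "pull bo s f \<in> test_Omega E"
proof -
  obtain X where X: "finite X" "\<And>c. f c \<noteq> 0 \<Longrightarrow> fchain E c \<and> fst (c 0) \<in> X"
    using Tp_support[OF f] by metis
  have "olc bo (\<lambda>\<omega>. \<Sum>x\<in>X. pker E q bo s x \<omega> * f (ray x \<omega>))"
    by (intro olc_sum[OF X(1)] olc_combine[where h = "(*)"] olc_pker olc_ray Tp_lc f)
  then have "olc bo (pull bo s f)"
    by (rule olc_cong) (rule pull_eq[symmetric], use X in auto)
  then show ?thesis unfolding test_Omega_iff[of _ bo] using pull_off by blast
qed

lemma pull_add: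
  assumes "f \<in> Tp" "g \<in> Tp"
  shows "pull bo s (\<lambda>c. f c + g c) = (\<lambda>\<omega>. pull bo s f \<omega> + pull bo s g \<omega>)"
proof
  fix \<omega>
  obtain X where X: "finite X" "\<And>c. f c \<noteq> 0 \<Longrightarrow> fchain E c \<and> fst (c 0) \<in> X"
    using Tp_support[OF assms(1)] by metis
  obtain Y where Y: "finite Y" "\<And>c. g c \<noteq> 0 \<Longrightarrow> fchain E c \<and> fst (c 0) \<in> Y"
    using Tp_support[OF assms(2)] by metis
  have fin: "finite (X \<union> Y)" using X Y by blast
  have f: "\<forall>c. f c \<noteq> 0 \<longrightarrow> fst (c 0) \<in> X \<union> Y" using X(2) by blast
  have g: "\<forall>c. g c \<noteq> 0 \<longrightarrow> fst (c 0) \<in> X \<union> Y" using Y(2) by blast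
  have fg: "\<forall>c. f c + g c \<noteq> 0 \<longrightarrow> fst (c 0) \<in> X \<union> Y"
    using f g by (metis add.right_neutral add.left_neutral)
  show "pull bo s (\<lambda>c. f c + g c) \<omega> = pull bo s f \<omega> + pull bo s g \<omega>"
  proof (cases "\<omega> \<in> Omega E")
    case True
    show ?thesis
      unfolding pull_eq[OF fin f True] pull_eq[OF fin g True]
        pull_eq[OF fin fg True]
      by (simp add: sum.distrib distrib_left)
  qed (simp add: pull_off)
qed

lemma pull_scale: "pull bo s (\<lambda>c. k * f c) = (\<lambda>\<omega>. k * pull bo s f \<omega>)"
  by (rule ext, cases "k = 0") (simp_all add: pull_def sum_distrib_left ac_simps)

text \<open>The chains obtained by prepending an edge to \<open>ray x \<omega>\<close> are the rays
  \<open>ray y \<omega>\<close> whose first step leads to \<open>x\<close>.\<close>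

lemma L_ray:
  assumes X: "finite X" "\<forall>c. f c \<noteq> 0 \<longrightarrow> fst (c 0) \<in> X" and \<omega>: "\<omega> \<in> Omega E"
  shows "L f (ray x \<omega>) = (\<Sum>y\<in>X. if snd (ray y \<omega> 0) = x then f (ray y \<omega>) else 0)"
proof -
  define Y where "Y = {y. snd (ray y \<omega> 0) = x}"
  have ray_Y: "ray y \<omega> = consC (y, x) (ray x \<omega>)" if "y \<in> Y" for y
    using ray_towards[OF \<omega>, of y x] that by (simp add: Y_def)
  have set_eq: "{e \<in> E. snd e = fst (ray x \<omega> 0) \<and> fst e \<noteq> snd (ray x \<omega> 0)} = (\<lambda>y. (y, x)) ` Y"
  proof
    show "(\<lambda>y. (y, x)) ` Y \<subseteq> {e \<in> E. snd e = fst (ray x \<omega> 0) \<and> fst e \<noteq> snd (ray x \<omega> 0)}"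
    proof
      fix e assume "e \<in> (\<lambda>y. (y, x)) ` Y"
      then obtain y where y: "e = (y, x)" "y \<in> Y" by blast
      then have "fchain E (consC (y, x) (ray x \<omega>))" using ray_Y ray_fchain[OF \<omega>, of y] by simp
      then show "e \<in> {e \<in> E. snd e = fst (ray x \<omega> 0) \<and> fst e \<noteq> snd (ray x \<omega> 0)}"
        unfolding fchain_consC_iff y(1) by auto
    qed
    show "{e \<in> E. snd e = fst (ray x \<omega> 0) \<and> fst e \<noteq> snd (ray x \<omega> 0)} \<subseteq> (\<lambda>y. (y, x)) ` Y"
    proof
      fix e assume "e \<in> {e \<in> E. snd e = fst (ray x \<omega> 0) \<and> fst e \<noteq> snd (ray x \<omega> 0)}"
      then have e: "(fst e, x) \<in> E" "e = (fst e, x)" "snd (ray x \<omega> 0) \<noteq> fst e"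
        using ray_start[OF \<omega>, of x] by (auto simp: prod_eq_iff)
      have "fst e \<in> Y" unfolding Y_def using ray_away[OF \<omega> edge_sym[OF e(1)] e(3)] by simp
      then show "e \<in> (\<lambda>y. (y, x)) ` Y" using e(2) by blast
    qed
  qed
  have "finite ((\<lambda>y. (y, x)) ` Y)" unfolding set_eq[symmetric] by (rule finite_edges_to)
  then have finY: "finite Y" by (rule finite_imageD) (simp add: inj_on_def)
  have "L f (ray x \<omega>) = (\<Sum>y\<in>Y. f (consC (y, x) (ray x \<omega>)))"
    unfolding L_eq[OF ray_fchain[OF \<omega>]] set_eq by (subst sum.reindex) (auto simp: inj_on_def)
  also have "\<dots> = (\<Sum>y\<in>Y. f (ray y \<omega>))"
    by (rule sum.cong) (simp_all add: ray_Y)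
  also have "\<dots> = (\<Sum>y\<in>{y \<in> X. snd (ray y \<omega> 0) = x}. f (ray y \<omega>))"
    by (rule sum.mono_neutral_right)
       (use finY X(2)[rule_format, of "ray _ \<omega>"] ray_start[OF \<omega>] in \<open>auto simp: Y_def\<close>)
  also have "\<dots> = (\<Sum>y\<in>X. if snd (ray y \<omega> 0) = x then f (ray y \<omega>) else 0)"
    using X(1) by (simp add: sum.inter_filter)
  finally show ?thesis .
qed

lemma pull_L:
  assumes f: "f \<in> Tp"
  shows "pull bo s (L f) = (\<lambda>\<omega>. of_nat q powr (1/2 + \<i> * s) * pull bo s f \<omega>)"
proof
  fix \<omega>
  obtain X where X: "finite X" "\<And>c. f c \<noteq> 0 \<Longrightarrow> fchain E c \<and> fst (c 0) \<in> X"
    using Tp_support[OF f] by metis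
  obtain Y0 where Y0: "finite Y0" "\<And>c. L f c \<noteq> 0 \<Longrightarrow> fchain E c \<and> fst (c 0) \<in> Y0"
    using Tp_support[OF L_Tp[OF f]] by metis
  show "pull bo s (L f) \<omega> = of_nat q powr (1/2 + \<i> * s) * pull bo s f \<omega>"
  proof (cases "\<omega> \<in> Omega E")
    case \<omega>: True
    \<comment> \<open>Every \<open>y\<close> in \<open>X\<close> contributes at the next vertex on
      its ray, so these vertices must be included; the set may depend on \<omega>.\<close>
    define Y where "Y = Y0 \<union> (\<lambda>y. snd (ray y \<omega> 0)) ` X"
    have Y: "finite Y" "\<forall>c. L f c \<noteq> 0 \<longrightarrow> fst (c 0) \<in> Y" using X Y0 by (auto simp: Y_def)
    have Xf: "\<forall>c. f c \<noteq> 0 \<longrightarrow> fst (c 0) \<in> X" using X(2) by blast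
    have "pull bo s (L f) \<omega> = (\<Sum>x\<in>Y. pker E q bo s x \<omega> * (\<Sum>y\<in>X. if snd (ray y \<omega> 0) = x then f (ray y \<omega>) else 0))"
      unfolding pull_eq[OF Y \<omega>] L_ray[OF X(1) Xf \<omega>] ..
    also have "\<dots> = (\<Sum>x\<in>Y. \<Sum>y\<in>X. if x = snd (ray y \<omega> 0) then pker E q bo s x \<omega> * f (ray y \<omega>) else 0)"
      unfolding sum_distrib_left by (intro sum.cong) auto
    also have "\<dots> = (\<Sum>y\<in>X. \<Sum>x\<in>Y. if x = snd (ray y \<omega> 0) then pker E q bo s x \<omega> * f (ray y \<omega>) else 0)"
      by (rule sum.swap)
    also have "\<dots> = (\<Sum>y\<in>X. pker E q bo s (snd (ray y \<omega> 0)) \<omega> * f (ray y \<omega>))"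
      using Y(1) by (intro sum.cong) (auto simp: Y_def)
    also have "\<dots> = of_nat q powr (1/2 + \<i> * s) * pull bo s f \<omega>"
      unfolding pull_eq[OF X(1) Xf \<omega>] sum_distrib_left
      by (intro sum.cong) (simp_all add: pker_towards[OF \<omega> refl])
    finally show ?thesis .
  qed (simp add: pull_off)
qed

text \<open>Through this identity the pushforward of a state of the form \<mu> after
  \<open>pull\<close> is the Poisson transform of \<mu>.\<close>

lemma pull_fib: "pull bo s (fib x) = (\<lambda>\<omega>. if \<omega> \<in> Omega E then pker E q bo s x \<omega> else 0)"
proof
  fix \<omega>
  show "pull bo s (fib x) \<omega> = (if \<omega> \<in> Omega E then pker E q bo s x \<omega> else 0)"
  proof (cases "\<omega> \<in> Omega E")
    case True
    have "pull bo s (fib x) \<omega> = (\<Sum>y\<in>{x}. pker E q bo s y \<omega> * fib x (ray y \<omega>))"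
      by (rule pull_eq[OF _ _ True]) (auto simp: fib_eq split: if_splits)
    then show ?thesis using True ray_start ray_fchain by (simp add: fib_eq)
  qed (simp add: pull_off)
qed

text \<open>A right inverse of \<open>pull\<close>: the function is placed on chains from the base
  vertex, where the Poisson kernel is 1.\<close>

definition lift :: "'v \<Rightarrow> ('v chn set \<Rightarrow> complex) \<Rightarrow> 'v chn \<Rightarrow> complex" where
  "lift bo f c = (if fchain E c \<and> fst (c 0) = bo then f (bclass E c) else 0)"

lemma lift_Tp:
  assumes f: "f \<in> test_Omega E"
  shows "lift bo f \<in> Tp"
proof (rule Tp_I[of _ "{bo}"])
  show "lc_shift (Pplus E) (lift bo f)"
    unfolding lc_shift_def
  proof
    fix c assume "c \<in> Pplus E"
    then have c: "fchain E c" by (simp add: Pplus_def)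
    have rc: "ray (fst (c 0)) (bclass E c) = c" using ray_bclass c by blast
    have "olc (fst (c 0)) f" using f test_Omega_iff by blast
    from olcD[OF this bclass_Omega[OF c]] obtain n where
      n: "\<forall>\<eta>\<in>Omega E. (\<forall>i<n. ray (fst (c 0)) \<eta> i = ray (fst (c 0)) (bclass E c) i) \<longrightarrow> f \<eta> = f (bclass E c)" ..
    show "\<exists>n. \<forall>c'\<in>Pplus E. (\<forall>i<n. c' i = c i) \<longrightarrow> lift bo f c' = lift bo f c"
    proof (intro exI[of _ "Suc n"] ballI impI)
      fix c' assume c': "c' \<in> Pplus E" "\<forall>i<Suc n. c' i = c i"
      \<comment> \<open>Agreement at index 0, the reason for \<open>Suc n\<close>, gives both chains
        the same origin and hence the same branch of \<open>lift\<close>.\<close>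
      then have fc': "fchain E c'" and 0: "c' 0 = c 0" by (auto simp: Pplus_def)
      have "f (bclass E c') = f (bclass E c)"
        using n bclass_Omega[OF fc'] ray_bclass[OF fc'] rc c' 0 by simp
      then show "lift bo f c' = lift bo f c" using 0 c fc' by (simp add: lift_def)
    qed
  qed
qed (auto simp: lift_def split: if_splits)

lemma pull_lift:
  assumes f: "f \<in> test_Omega E"
  shows "pull bo s (lift bo f) = f"
proof
  fix \<omega>
  show "pull bo s (lift bo f) \<omega> = f \<omega>"
  proof (cases "\<omega> \<in> Omega E")
    case True
    have "pull bo s (lift bo f) \<omega> = (\<Sum>y\<in>{bo}. pker E q bo s y \<omega> * lift bo f (ray y \<omega>))"
      by (rule pull_eq[OF _ _ True]) (auto simp: lift_def split: if_splits)
    then show ?thesis using True ray_start ray_fchain bclass_ray by (simp add: lift_def pker_base)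
  next
    case False
    then show ?thesis using f by (simp add: pull_off test_Omega_def)
  qed
qed

lemma lift_pull_base:
  assumes "\<And>c. f c \<noteq> 0 \<Longrightarrow> fchain E c \<and> fst (c 0) = bo"
  shows "lift bo (pull bo s f) = f"
proof
  fix c
  show "lift bo (pull bo s f) c = f c"
  proof (cases "fchain E c \<and> fst (c 0) = bo")
    case True
    then have \<omega>: "bclass E c \<in> Omega E" using bclass_Omega by blast
    have "pull bo s f (bclass E c) = (\<Sum>y\<in>{bo}. pker E q bo s y (bclass E c) * f (ray y (bclass E c)))"
      by (rule pull_eq[OF _ _ \<omega>]) (use assms in auto)
    then show ?thesis using True ray_bclass[of c] pker_base[OF \<omega>] by (simp add: lift_def)
  next
    case False
    then show ?thesis using assms by (auto simp: lift_def)
  qed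
qed

lemma test_Omega_add: "f \<in> test_Omega E \<Longrightarrow> g \<in> test_Omega E \<Longrightarrow> (\<lambda>\<omega>. f \<omega> + g \<omega>) \<in> test_Omega E"
  unfolding test_Omega_iff[of _ undefined] using olc_combine[where h = "(+)"] by auto

lemma test_Omega_scale: "f \<in> test_Omega E \<Longrightarrow> (\<lambda>\<omega>. k * f \<omega>) \<in> test_Omega E"
  unfolding test_Omega_iff[of _ undefined] using olc_combine[where h = "\<lambda>a _. k * a"] by auto

lemma lift_add: "lift bo (\<lambda>\<omega>. f \<omega> + g \<omega>) = (\<lambda>c. lift bo f c + lift bo g c)"
  by (auto simp: lift_def)

lemma lift_scale: "lift bo (\<lambda>\<omega>. k * f \<omega>) = (\<lambda>c. k * lift bo f c)"
  by (auto simp: lift_def)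

end

section \<open>Existence and uniqueness of boundary values\<close>

context eigenfunction
begin

definition is_bval :: "'v \<Rightarrow> (('v chn set \<Rightarrow> complex) \<Rightarrow> complex) \<Rightarrow> bool" where
  "is_bval bo \<mu> \<longleftrightarrow> is_dual (test_Omega E) \<mu> \<and> poisson E q bo s \<mu> = \<phi>"

text \<open>\<open>pull_L\<close> gives the eigenvalue and \<open>pull_fib\<close> the pushforward.
  The conditional makes the functional vanish off \<open>Tp\<close>, as \<open>is_dual\<close>
  demands.\<close>

lemma bval_resonant:
  assumes "is_bval bo \<mu>"
  shows "is_resonant (\<lambda>f. if f \<in> Tp then \<mu> (pull bo s f) else 0)"
proof -
  have dual: "is_dual (test_Omega E) \<mu>" and pois: "\<And>x. poisson E q bo s \<mu> x = \<phi> x"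
    using assms by (auto simp: is_bval_def)
  show ?thesis
    unfolding is_resonant_def
  proof (intro conjI ballI)
    show "is_dual Tp (\<lambda>f. if f \<in> Tp then \<mu> (pull bo s f) else 0)"
      unfolding is_dual_def
      by (auto simp: Tp_add Tp_scale pull_add pull_scale dual_add[OF dual pull_test pull_test]
          dual_scale[OF dual pull_test])
    fix f assume f: "f \<in> Tp"
    then show "(if L f \<in> Tp then \<mu> (pull bo s (L f)) else 0) = z * (if f \<in> Tp then \<mu> (pull bo s f) else 0)"
      using L_Tp pull_L[OF f] dual_scale[OF dual pull_test] by (simp add: z_def)
  next
    show "pushfw (Pplus E) pi_plus (\<lambda>f. if f \<in> Tp then \<mu> (pull bo s f) else 0) = \<phi>"
    proof
      fix x
      have "pushfw (Pplus E) pi_plus (\<lambda>f. if f \<in> Tp then \<mu> (pull bo s f) else 0) x = \<mu> (pull bo s (fib x))"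
        using fib_Tp[of x] unfolding pushfw_def fib_def[abs_def] by simp
      also have "\<dots> = \<phi> x" unfolding pull_fib pois[symmetric] poisson_def integ_Omega_def ..
      finally show "pushfw (Pplus E) pi_plus (\<lambda>f. if f \<in> Tp then \<mu> (pull bo s f) else 0) x = \<phi> x" .
    qed
  qed
qed

lemma ures_pull:
  assumes "is_bval bo \<mu>" "f \<in> Tp"
  shows "ures f = \<mu> (pull bo s f)"
  using fun_cong[OF resonant_unique[OF bval_resonant[OF assms(1)] ures_resonant], of f] assms(2) by simp

lemma bval_lift:
  assumes "is_bval bo \<mu>" "f \<in> test_Omega E"
  shows "\<mu> f = ures (lift bo f)"
  using ures_pull[OF assms(1) lift_Tp[OF assms(2)]] pull_lift[OF assms(2)] by simp

lemma bval_unique: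
  assumes "is_bval bo \<mu>" "is_bval bo \<nu>"
  shows "\<mu> = \<nu>"
proof
  fix f
  show "\<mu> f = \<nu> f"
  proof (cases "f \<in> test_Omega E")
    case True
    then show ?thesis using bval_lift assms by metis
  next
    case False
    then show ?thesis using assms dual_off unfolding is_bval_def by metis
  qed
qed

text \<open>What existence of the boundary value needs: the values of \<open>ures\<close> on chains
  from \<open>bo\<close> determine it over every vertex. Both functionals are eigenfunctionals of
  \<open>L\<close> for the same nonzero \<open>z\<close>, so equality can be carried across an edge
  by applying \<open>L\<close> or by undoing it.\<close>

lemma ures_lift_pull:
  assumes "f \<in> Tp" "\<And>c. f c \<noteq> 0 \<Longrightarrow> fst (c 0) = x"
  shows "ures (lift bo (pull bo s f)) = ures f"
  using connected[of bo x] assms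
proof (induction arbitrary: f rule: rtrancl_induct)
  case base
  obtain X where X: "finite X" "\<And>c. f c \<noteq> 0 \<Longrightarrow> fchain E c \<and> fst (c 0) \<in> X"
    using Tp_support[OF base(1)] by metis
  have "lift bo (pull bo s f) = f" by (rule lift_pull_base) (use base(2) X(2) in blast)
  then show ?case by simp
next
  case (step y w)
  define N where "N g = ures (lift bo (pull bo s g))" for g
  note dual = resonant_dual[OF ures_resonant]
  have N_add: "N (\<lambda>c. g c + h c) = N g + N h" if "g \<in> Tp" "h \<in> Tp" for g h
    unfolding N_def pull_add[OF that] lift_add
    by (rule dual_add[OF dual]) (intro lift_Tp pull_test that)+
  have N_L: "N (L g) = z * N g" if "g \<in> Tp" for g
    unfolding N_def pull_L[OF that] lift_scale z_def[symmetric]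
    by (rule dual_scale[OF dual]) (intro lift_Tp pull_test that)
  obtain X where X: "finite X" "\<And>c. f c \<noteq> 0 \<Longrightarrow> fchain E c \<and> fst (c 0) \<in> X"
    using Tp_support[OF step.prems(1)] by metis
  \<comment> \<open>\<open>f = f1 + f2\<close>, where \<open>L f1\<close> is supported over \<open>y\<close> and \<open>f2 = L g\<close> with \<open>g\<close> supported over \<open>y\<close>.\<close>
  define f1 where "f1 = (\<lambda>c. cyl (w, y) c * f c)"
  define f2 where "f2 = (\<lambda>c. f c - f1 c)"
  have f1: "f1 \<in> Tp" unfolding f1_def by (rule Tp_mult[OF cyl_Tp step.prems(1)])
  have f2: "f2 \<in> Tp" unfolding f2_def by (rule Tp_diff[OF step.prems(1) f1])
  have N1: "N f1 = ures f1"
  proof -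
    \<comment> \<open>Since \<open>f1\<close> lives on chains beginning with \<open>(w, y)\<close>,
      this is the edge that \<open>L\<close> removes, and \<open>c\<close> starts at
      \<open>y\<close>.\<close>
    have "fst (c 0) = y" if nz: "L f1 c \<noteq> 0" for c
    proof -
      have c: "fchain E c" using L_off nz by blast
      then obtain e where "e \<in> E" "snd e = fst (c 0)" "f1 (consC e c) \<noteq> 0"
        using nz unfolding L_eq[OF c] by (auto elim: sum.not_neutral_contains_not_neutral)
      then show ?thesis by (auto simp: f1_def cyl_def split: if_splits)
    qed
    then have "N (L f1) = ures (L f1)" unfolding N_def using step.IH[OF L_Tp[OF f1]] by blast
    then show ?thesis using N_L[OF f1] resonant_L[OF ures_resonant f1] z_nonzero by simp
  qed
  \<comment> \<open>Chains in the support of \<open>f2\<close> leave \<open>w\<close> without going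
    to \<open>y\<close>, so \<open>(y, w)\<close> can be prepended; \<open>g\<close> does this, and
    \<open>L\<close> takes the edge off again.\<close>
  define g where "g c = (if fchain E c \<and> c 0 = (y, w) then f2 (\<lambda>n. c (Suc n)) else 0)" for c
  have "g \<in> Tp"
  proof (rule Tp_I[of _ "{y}"])
    obtain n where n: "level (Suc n) f2" using Tp_level[OF f2] by blast
    have "level (Suc (Suc n)) g"
      unfolding level_def
    proof (intro allI impI)
      fix c c' assume h: "fchain E c" "fchain E c'" "\<forall>i<Suc (Suc n). c' i = c i"
      have "f2 (\<lambda>n. c' (Suc n)) = f2 (\<lambda>n. c (Suc n))"
        by (rule levelD[OF n]) (use h fchain_shift[of _ 1] in auto)
      then show "g c' = g c" using h by (simp add: g_def)
    qed
    then show "lc_shift (Pplus E) g" by (rule level_lc_shift)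
  qed (auto simp: g_def split: if_splits)
  moreover have "L g = f2"
  proof
    fix c
    show "L g c = f2 c"
    proof (cases "fchain E c")
      case True
      define A where "A = {e \<in> E. snd e = fst (c 0) \<and> fst e \<noteq> snd (c 0)}"
      have "L g c = (\<Sum>e\<in>A. if e = (y, w) then f2 c else 0)"
        unfolding L_eq[OF True] A_def by (rule sum.cong) (auto simp: g_def fchain_consC_iff True)
      also have "\<dots> = (if (y, w) \<in> A then f2 c else 0)" using finite_edges_to by (simp add: A_def)
      also have "\<dots> = f2 c"
      proof -
        have "(y, w) \<in> A" if "f2 c \<noteq> 0"
        proof -
          have "f c \<noteq> 0" using that by (auto simp: f2_def f1_def)
          then have w: "fst (c 0) = w" using step.prems(2) by blast
          have "c 0 \<noteq> (w, y)" using that True by (auto simp: f2_def f1_def cyl_def)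
          then show ?thesis using w step.hyps(2) by (auto simp: A_def prod_eq_iff)
        qed
        then show ?thesis by auto
      qed
      finally show ?thesis .
    next
      case False
      then have "f c = 0" using X by blast
      then show ?thesis using False by (simp add: L_off f2_def f1_def)
    qed
  qed
  moreover have "N g = ures g"
    unfolding N_def by (rule step.IH[OF \<open>g \<in> Tp\<close>]) (auto simp: g_def split: if_splits)
  ultimately have N2: "N f2 = ures f2" using N_L[of g] resonant_L[OF ures_resonant, of g] by simp
  have "f = (\<lambda>c. f1 c + f2 c)" by (simp add: f2_def)
  then show ?case
    using N_add[OF f1 f2] N1 N2 dual_add[OF dual f1 f2] unfolding N_def by metis
qed

text \<open>The candidate is dictated by \<open>bval_lift\<close>. Its Poisson transform at
  \<open>x\<close> is the value at \<open>pull bo s (fib x)\<close>, which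
  \<open>ures_lift_pull\<close> evaluates.\<close>

lemma bval_exists: "\<exists>\<mu>. is_bval bo \<mu>"
proof -
  define \<mu> where "\<mu> f = (if f \<in> test_Omega E then ures (lift bo f) else 0)" for f
  note dual = resonant_dual[OF ures_resonant]
  have "is_dual (test_Omega E) \<mu>"
    unfolding is_dual_def \<mu>_def
    by (auto simp: test_Omega_add test_Omega_scale lift_add lift_scale
        dual_add[OF dual lift_Tp lift_Tp] dual_scale[OF dual lift_Tp])
  moreover have "poisson E q bo s \<mu> = \<phi>"
  proof
    fix x
    have "poisson E q bo s \<mu> x = \<mu> (pull bo s (fib x))"
      unfolding poisson_def integ_Omega_def pull_fib ..
    also have "\<dots> = ures (lift bo (pull bo s (fib x)))" using pull_test[OF fib_Tp] by (simp add: \<mu>_def)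
    also have "\<dots> = ures (fib x)" by (rule ures_lift_pull[OF fib_Tp, of _ x]) (auto simp: fib_eq split: if_splits)
    also have "\<dots> = \<phi> x" using resonant_fib[OF ures_resonant] .
    finally show "poisson E q bo s \<mu> x = \<phi> x" .
  qed
  ultimately show ?thesis unfolding is_bval_def by blast
qed

lemma is_bval_bval: "is_bval bo (bval E q bo s \<phi>)"
proof -
  have "bval E q bo s \<phi> = (THE \<mu>. is_bval bo \<mu>)" unfolding bval_def is_bval_def ..
  then show ?thesis using bval_exists bval_unique by (metis theI)
qed

end

context reg_tree
begin

section \<open>Backward chains\<close>

lemma rev_chn_rev_chn [simp]: "rev_chn (rev_chn b) = b"
  by (simp add: rev_chn_def)

text \<open>Flipping each edge while keeping the indices preserves the edge nearest to the vertex at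
  index 0. Cylinders and the appended edge of the transfer operator therefore carry over
  directly.\<close>

lemma Pminus_iff: "b \<in> Pminus E \<longleftrightarrow> fchain E (rev_chn b)"
proof -
  have "b n \<in> E \<longleftrightarrow> (snd (b n), fst (b n)) \<in> E" for n using edge_sym by (metis prod.collapse)
  then show ?thesis
    unfolding Pminus_def bchain_def fchain_def rev_chn_def by (simp add: eq_commute)
qed

lemma rev_chn_Pminus: "rev_chn c \<in> Pminus E \<longleftrightarrow> c \<in> Pplus E"
  by (simp add: Pminus_iff Pplus_def)

abbreviation Tm :: "('v chn \<Rightarrow> complex) set" where
  "Tm \<equiv> test_shift (Pminus E) pi_minus"

lemma rev_chn_agree: "rev_chn c i = rev_chn d i \<longleftrightarrow> c i = d i"
  by (auto simp: rev_chn_def prod_eq_iff)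

lemma lc_shift_rev:
  assumes f: "lc_shift S f" and S: "\<And>c. c \<in> S' \<Longrightarrow> rev_chn c \<in> S"
  shows "lc_shift S' (\<lambda>c. f (rev_chn c))"
  unfolding lc_shift_def
proof
  fix c assume "c \<in> S'"
  then have "rev_chn c \<in> S" by (rule S)
  from bspec[OF f[unfolded lc_shift_def] this] obtain n where
    n: "\<forall>c'\<in>S. (\<forall>i<n. c' i = rev_chn c i) \<longrightarrow> f c' = f (rev_chn c)" ..
  have "f (rev_chn c') = f (rev_chn c)" if "c' \<in> S'" "\<forall>i<n. c' i = c i" for c'
    by (rule n[THEN bspec[OF _ S[OF that(1)]], THEN mp]) (use that(2) in \<open>simp add: rev_chn_agree\<close>)
  then show "\<exists>n. \<forall>c'\<in>S'. (\<forall>i<n. c' i = c i) \<longrightarrow> f (rev_chn c') = f (rev_chn c)" by blast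
qed

lemma Tm_iff: "g \<in> Tm \<longleftrightarrow> (\<lambda>c. g (rev_chn c)) \<in> Tp"
proof -
  have "lc_shift (Pminus E) g \<longleftrightarrow> lc_shift (Pplus E) (\<lambda>c. g (rev_chn c))"
    using lc_shift_rev[of "Pminus E" g "Pplus E"] lc_shift_rev[of "Pplus E" "\<lambda>c. g (rev_chn c)" "Pminus E"]
    by (auto simp: rev_chn_Pminus Pminus_iff Pplus_def)
  moreover have "pi_minus ` {c \<in> Pminus E. g c \<noteq> 0} = pi_plus ` {c \<in> Pplus E. g (rev_chn c) \<noteq> 0}"
  proof -
    have "{c \<in> Pminus E. g c \<noteq> 0} = rev_chn ` {c \<in> Pplus E. g (rev_chn c) \<noteq> 0}"
    proof (intro set_eqI iffI)
      fix c assume "c \<in> {c \<in> Pminus E. g c \<noteq> 0}"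
      then show "c \<in> rev_chn ` {c \<in> Pplus E. g (rev_chn c) \<noteq> 0}"
        by (intro image_eqI[of _ _ "rev_chn c"]) (auto simp: Pminus_iff Pplus_def)
    qed (auto simp: rev_chn_Pminus)
    moreover have "pi_minus (rev_chn c) = pi_plus c" for c :: "'v chn"
      by (simp add: pi_minus_def pi_plus_def rev_chn_def)
    ultimately show ?thesis by (simp add: image_image)
  qed
  moreover have "(\<forall>c. c \<notin> Pminus E \<longrightarrow> g c = 0) \<longleftrightarrow> (\<forall>c. c \<notin> Pplus E \<longrightarrow> g (rev_chn c) = 0)"
    by (metis rev_chn_rev_chn rev_chn_Pminus)
  ultimately show ?thesis unfolding test_shift_def by simp
qed

lemma transfer_Pminus: "transfer E (Pminus E) g (rev_chn c) = L (\<lambda>c. g (rev_chn c)) c"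
proof (cases "c \<in> Pplus E")
  case True
  have cons: "consC e (rev_chn c) = rev_chn (consC (prod.swap e) c)" for e
    by (rule ext) (simp add: consC_def rev_chn_def split: nat.split)
  have "(\<Sum>e\<in>{e \<in> E. consC e (rev_chn c) \<in> Pminus E}. g (consC e (rev_chn c)))
      = (\<Sum>e\<in>{e \<in> E. consC e c \<in> Pplus E}. g (rev_chn (consC e c)))"
    unfolding cons rev_chn_Pminus
    by (rule sum.reindex_bij_witness[of _ prod.swap prod.swap]) (auto intro: edge_sym)
  then show ?thesis using True by (simp add: transfer_def rev_chn_Pminus)
next
  case False
  then show ?thesis by (simp add: transfer_def rev_chn_Pminus)
qed

section \<open>Automorphisms\<close>

definition aut :: "('v \<Rightarrow> 'v) \<Rightarrow> bool" where
  "aut \<gamma> \<longleftrightarrow> bij \<gamma> \<and> (\<forall>x y. (x, y) \<in> E \<longleftrightarrow> (\<gamma> x, \<gamma> y) \<in> E)"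

lemma aut_inj: "aut \<gamma> \<Longrightarrow> \<gamma> x = \<gamma> y \<longleftrightarrow> x = y"
  unfolding aut_def by (metis bij_is_inj inj_eq)

lemma act_chn_apply: "act_chn \<gamma> c n = (\<gamma> (fst (c n)), \<gamma> (snd (c n)))"
  by (simp add: act_chn_def)

lemma aut_edge: "aut \<gamma> \<Longrightarrow> (\<gamma> x, \<gamma> y) \<in> E \<longleftrightarrow> (x, y) \<in> E"
  unfolding aut_def by blast

lemma fchain_act: "aut \<gamma> \<Longrightarrow> fchain E (act_chn \<gamma> c) \<longleftrightarrow> fchain E c"
  unfolding fchain_def by (simp add: act_chn_apply aut_edge aut_inj)

lemma act_agree: "aut \<gamma> \<Longrightarrow> act_chn \<gamma> c i = act_chn \<gamma> d j \<longleftrightarrow> c i = d j"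
  by (simp add: act_chn_apply aut_inj prod_eq_iff)

lemma act_chn_comp: "act_chn \<gamma> (act_chn \<delta> c) = act_chn (\<gamma> \<circ> \<delta>) c"
  by (simp add: act_chn_def)

lemma act_chn_id [simp]: "act_chn id c = c"
  by (simp add: act_chn_def)

lemma act_rev_chn: "act_chn \<gamma> (rev_chn c) = rev_chn (act_chn \<gamma> c)"
  by (simp add: act_chn_def rev_chn_def)

lemma aut_inv:
  assumes "aut \<gamma>"
  shows "aut (inv \<gamma>)" "\<gamma> \<circ> inv \<gamma> = id" "inv \<gamma> \<circ> \<gamma> = id"
proof -
  have b: "bij \<gamma>" using assms by (simp add: aut_def)
  then show 1: "\<gamma> \<circ> inv \<gamma> = id" and "inv \<gamma> \<circ> \<gamma> = id"
    by (auto simp: bij_def surj_iff inj_iff)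
  have "\<gamma> (inv \<gamma> x) = x" for x using fun_cong[OF 1, of x] by simp
  then show "aut (inv \<gamma>)"
    unfolding aut_def using bij_imp_bij_inv[OF b] aut_edge[OF assms] by metis
qed

lemma Tp_act:
  assumes \<gamma>: "aut \<gamma>" and f: "f \<in> Tp"
  shows "(\<lambda>c. f (act_chn \<gamma> c)) \<in> Tp"
proof -
  obtain X where X: "finite X" "\<And>c. f c \<noteq> 0 \<Longrightarrow> fchain E c \<and> fst (c 0) \<in> X"
    using Tp_support[OF f] by metis
  obtain n where n: "level (Suc n) f" using Tp_level[OF f] by blast
  have "level (Suc n) (\<lambda>c. f (act_chn \<gamma> c))"
    unfolding level_def
    by (intro allI impI levelD[OF n]) (auto simp: fchain_act[OF \<gamma>] act_agree[OF \<gamma>])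
  then show ?thesis
  proof (rule Tp_I[OF level_lc_shift])
    show "finite (\<gamma> -` X)" using X(1) \<gamma> by (intro finite_vimageI) (auto simp: aut_def bij_def)
    fix c assume "f (act_chn \<gamma> c) \<noteq> 0"
    from X(2)[OF this] show "fchain E c \<and> fst (c 0) \<in> \<gamma> -` X"
      using fchain_act[OF \<gamma>] by (simp add: act_chn_apply)
  qed
qed

lemma L_act:
  assumes \<gamma>: "aut \<gamma>"
  shows "L (\<lambda>c. f (act_chn \<gamma> c)) c = L f (act_chn \<gamma> c)"
proof (cases "fchain E c")
  case True
  have fc: "fchain E (act_chn \<gamma> c)" using fchain_act[OF \<gamma>] True by blast
  have cons: "act_chn \<gamma> (consC e c) = consC (map_prod \<gamma> \<gamma> e) (act_chn \<gamma> c)" for e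
    by (rule ext) (cases e, simp add: consC_def act_chn_apply split: nat.split)
  have i1: "inv \<gamma> (\<gamma> x) = x" and i2: "\<gamma> (inv \<gamma> x) = x" for x
    using fun_cong[OF aut_inv(3)[OF \<gamma>], of x] fun_cong[OF aut_inv(2)[OF \<gamma>], of x] by auto
  have edge_inv: "(inv \<gamma> x, y) \<in> E \<longleftrightarrow> (x, \<gamma> y) \<in> E" for x y
    using aut_edge[OF \<gamma>, of "inv \<gamma> x" y] by (simp add: i2)
  show ?thesis
    unfolding L_eq[OF True] L_eq[OF fc] cons
    by (rule sum.reindex_bij_witness[of _ "map_prod (inv \<gamma>) (inv \<gamma>)" "map_prod \<gamma> \<gamma>"])
       (auto simp: i1 i2 act_chn_apply aut_edge[OF \<gamma>] aut_inj[OF \<gamma>] edge_inv dest: arg_cong[of _ _ \<gamma>])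
next
  case False
  then show ?thesis using fchain_act[OF \<gamma>] by (simp add: L_off)
qed

lemma act_Omega_bclass:
  assumes \<gamma>: "aut \<gamma>" and c: "fchain E c"
  shows "act_Omega \<gamma> (bclass E c) = bclass E (act_chn \<gamma> c)"
proof
  show "act_Omega \<gamma> (bclass E c) \<subseteq> bclass E (act_chn \<gamma> c)"
    unfolding act_Omega_def bclass_def chain_rel_def
    by (auto simp: fchain_act[OF \<gamma>] act_agree[OF \<gamma>]) blast
  show "bclass E (act_chn \<gamma> c) \<subseteq> act_Omega \<gamma> (bclass E c)"
  proof
    fix d assume d: "d \<in> bclass E (act_chn \<gamma> c)"
    define d' where "d' = act_chn (inv \<gamma>) d"
    have dd': "d = act_chn \<gamma> d'" unfolding d'_def by (simp add: act_chn_comp aut_inv(2)[OF \<gamma>])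
    have "d' \<in> bclass E c"
      using d unfolding dd' bclass_def chain_rel_def
      by (auto simp: fchain_act[OF \<gamma>] act_agree[OF \<gamma>])
    then show "d \<in> act_Omega \<gamma> (bclass E c)" unfolding act_Omega_def dd' by blast
  qed
qed

end

section \<open>Resonant states under reversal and automorphisms\<close>

context eigenfunction
begin

text \<open>Reversal matches test spaces, transfer operators and projections. Hence existence and
  uniqueness for backward chains are both inherited from the forward case.\<close>

lemma resonant_minus: "resonant E q (Pminus E) pi_minus s \<phi> = (\<lambda>g. ures (\<lambda>c. g (rev_chn c)))"
  unfolding resonant_def
proof (rule the_equality)
  note res = ures_resonant
  have pi: "(if rev_chn c \<in> Pminus E \<and> pi_minus (rev_chn c) = x then 1 else 0) = fib x c" for c x
    by (simp add: fib_eq Pminus_iff pi_minus_def rev_chn_def)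
  show "is_dual Tm (\<lambda>g. ures (\<lambda>c. g (rev_chn c))) \<and>
    (\<forall>f\<in>Tm. ures (\<lambda>c. transfer E (Pminus E) f (rev_chn c)) =
        of_nat q powr (1/2 + \<i> * s) * ures (\<lambda>c. f (rev_chn c))) \<and>
    pushfw (Pminus E) pi_minus (\<lambda>g. ures (\<lambda>c. g (rev_chn c))) = \<phi>"
  proof (intro conjI ballI)
    show "is_dual Tm (\<lambda>g. ures (\<lambda>c. g (rev_chn c)))"
      unfolding is_dual_def
      by (auto simp: Tm_iff dual_add[OF resonant_dual[OF res]] dual_scale[OF resonant_dual[OF res]]
          dual_off[OF resonant_dual[OF res]])
    fix f assume "f \<in> Tm"
    then show "ures (\<lambda>c. transfer E (Pminus E) f (rev_chn c)) =
        of_nat q powr (1/2 + \<i> * s) * ures (\<lambda>c. f (rev_chn c))"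
      unfolding transfer_Pminus Tm_iff by (simp add: resonant_L[OF res] z_def)
  next
    show "pushfw (Pminus E) pi_minus (\<lambda>g. ures (\<lambda>c. g (rev_chn c))) = \<phi>"
      unfolding pushfw_def pi by (rule ext) (rule resonant_fib[OF res])
  qed
next
  fix u assume u: "is_dual Tm u \<and>
    (\<forall>f\<in>Tm. u (transfer E (Pminus E) f) = of_nat q powr (1/2 + \<i> * s) * u f) \<and>
    pushfw (Pminus E) pi_minus u = \<phi>"
  have Tp_iff: "f \<in> Tp \<longleftrightarrow> (\<lambda>c. f (rev_chn c)) \<in> Tm" for f
    unfolding Tm_iff by simp
  have "is_resonant (\<lambda>f. u (\<lambda>c. f (rev_chn c)))"
    unfolding is_resonant_def
  proof (intro conjI ballI)
    have dual: "is_dual Tm u" using u by blast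
    show "is_dual Tp (\<lambda>f. u (\<lambda>c. f (rev_chn c)))"
      unfolding is_dual_def
      by (auto simp: Tp_iff dual_add[OF dual] dual_scale[OF dual] dual_off[OF dual])
    fix f assume f: "f \<in> Tp"
    have "(\<lambda>c. L f (rev_chn c)) = transfer E (Pminus E) (\<lambda>c. f (rev_chn c))"
    proof
      fix c
      show "L f (rev_chn c) = transfer E (Pminus E) (\<lambda>c. f (rev_chn c)) c"
        using transfer_Pminus[of "\<lambda>c. f (rev_chn c)" "rev_chn c"] by simp
    qed
    then show "u (\<lambda>c. L f (rev_chn c)) = z * u (\<lambda>c. f (rev_chn c))"
      using u f unfolding Tp_iff z_def by simp
  next
    have pi: "(if rev_chn c \<in> Pplus E \<and> pi_plus (rev_chn c) = x then 1 else 0)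
        = (if c \<in> Pminus E \<and> pi_minus c = x then 1 else 0 :: complex)" for c x
      by (simp add: Pminus_iff Pplus_def pi_minus_def pi_plus_def rev_chn_def)
    show "pushfw (Pplus E) pi_plus (\<lambda>f. u (\<lambda>c. f (rev_chn c))) = \<phi>"
      using u unfolding pushfw_def pi by blast
  qed
  then have "(\<lambda>f. u (\<lambda>c. f (rev_chn c))) = ures" using resonant_unique ures_resonant by blast
  from fun_cong[OF this, symmetric] show "u = (\<lambda>g. ures (\<lambda>c. g (rev_chn c)))" by auto
qed

text \<open>The translated functional is resonant for the translate of \<phi>, which is \<phi>
  itself, and resonant states are unique.\<close>

lemma ures_invariant:
  assumes \<gamma>: "aut \<gamma>" and \<phi>: "\<And>x. \<phi> (\<gamma> x) = \<phi> x" and f: "f \<in> Tp"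
  shows "ures (\<lambda>c. f (act_chn \<gamma> c)) = ures f"
proof -
  note res = ures_resonant
  note dual = resonant_dual[OF res]
  have "is_resonant (\<lambda>f. if f \<in> Tp then ures (\<lambda>c. f (act_chn \<gamma> c)) else 0)"
    unfolding is_resonant_def
  proof (intro conjI ballI)
    show "is_dual Tp (\<lambda>f. if f \<in> Tp then ures (\<lambda>c. f (act_chn \<gamma> c)) else 0)"
      unfolding is_dual_def
      by (auto simp: Tp_add Tp_scale dual_add[OF dual Tp_act[OF \<gamma>] Tp_act[OF \<gamma>]]
          dual_scale[OF dual Tp_act[OF \<gamma>]])
    fix f assume f: "f \<in> Tp"
    then show "(if L f \<in> Tp then ures (\<lambda>c. L f (act_chn \<gamma> c)) else 0)
        = z * (if f \<in> Tp then ures (\<lambda>c. f (act_chn \<gamma> c)) else 0)"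
      using resonant_L[OF res Tp_act[OF \<gamma> f]] L_Tp[OF f] by (simp add: L_act[OF \<gamma>, symmetric])
  next
    show "pushfw (Pplus E) pi_plus (\<lambda>f. if f \<in> Tp then ures (\<lambda>c. f (act_chn \<gamma> c)) else 0) = \<phi>"
    proof
      fix x
      have x: "\<gamma> (inv \<gamma> x) = x" using fun_cong[OF aut_inv(2)[OF \<gamma>], of x] by simp
      have "fib x (act_chn \<gamma> c) = fib (inv \<gamma> x) c" for c
        using aut_inj[OF \<gamma>, of "fst (c 0)" "inv \<gamma> x"] x
        by (simp add: fib_eq fchain_act[OF \<gamma>] act_chn_apply)
      then have "ures (\<lambda>c. fib x (act_chn \<gamma> c)) = \<phi> (inv \<gamma> x)"
        using resonant_fib[OF res, of "inv \<gamma> x"] by simp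
      also have "\<dots> = \<phi> x" using \<phi>[of "inv \<gamma> x"] x by simp
      finally show "pushfw (Pplus E) pi_plus (\<lambda>f. if f \<in> Tp then ures (\<lambda>c. f (act_chn \<gamma> c)) else 0) x = \<phi> x"
        using fib_Tp[of x] unfolding pushfw_def fib_def[abs_def] by simp
    qed
  qed
  from fun_cong[OF resonant_unique[OF this res], of f] show ?thesis using f by simp
qed

end

context reg_tree
begin

section \<open>Pairs of chains\<close>

text \<open>Two rays from \<open>x\<close> join to a geodesic exactly when they do not begin along
  the same edge. For equal boundary points the rays coincide, so the criterion also covers the
  diagonal.\<close>

lemma geod_verts_iff:
  assumes \<omega>: "\<omega> \<in> Omega E" and \<omega>': "\<omega>' \<in> Omega E"
  shows "x \<in> geod_verts E \<omega>' \<omega> \<longleftrightarrow> ray x \<omega> 0 \<noteq> ray x \<omega>' 0"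
proof
  assume "x \<in> geod_verts E \<omega>' \<omega>"
  then obtain g :: "int \<Rightarrow> 'v" and j where
    g: "\<And>n. (g n, g (n + 1)) \<in> E" "\<And>n. g (n + 1) \<noteq> g (n - 1)"
      "(\<lambda>n::nat. (g (int n), g (int n + 1))) \<in> \<omega>"
      "(\<lambda>n::nat. (g (- int n), g (- int n - 1))) \<in> \<omega>'" and x: "x = g j"
    unfolding geod_verts_def by blast

  \<comment> \<open>The geodesic is recentred at \<open>x = g j\<close>: \<open>a\<close> and
    \<open>b\<close> are its two halves.\<close>
  define a where "a n = (g (j + int n), g (j + int n + 1))" for n :: nat
  define b where "b n = (g (j - int n), g (j - int n - 1))" for n :: nat
  have "fchain E a"
    unfolding fchain_def
  proof (intro conjI allI)
    fix n
    have S: "j + int (Suc n) = j + int n + 1" by simp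
    show "a n \<in> E" unfolding a_def by (rule g(1))
    show "snd (a n) = fst (a (Suc n))" unfolding a_def S by simp
    show "snd (a (Suc n)) \<noteq> fst (a n)" unfolding a_def S using g(2)[of "j + int n + 1"] by simp
  qed
  \<comment> \<open>At least one of \<open>nat j\<close> and \<open>nat (- j)\<close> is zero, so a
    single formula handles both signs of the shift.\<close>
  moreover have "(\<lambda>n. (g (int n), g (int n + 1))) (n + nat j) = a (n + nat (- j))" for n
    by (cases "j \<ge> 0") (simp_all add: a_def algebra_simps)
  ultimately have "a \<in> \<omega>" using Omega_closed[OF \<omega> g(3)] by blast
  then have ra: "ray x \<omega> = a" by (rule ray_eqI[OF \<omega>]) (simp add: a_def x)
  have "(g n, g (n - 1)) \<in> E" for n using edge_sym[OF g(1)[of "n - 1"]] by simp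
  then have bE: "b n \<in> E" for n unfolding b_def by blast
  have "fchain E b"
    unfolding fchain_def
  proof (intro conjI allI)
    fix n
    have S: "j - int (Suc n) = j - int n - 1" by simp
    show "b n \<in> E" by (rule bE)
    show "snd (b n) = fst (b (Suc n))" unfolding b_def S by simp
    show "snd (b (Suc n)) \<noteq> fst (b n)" unfolding b_def S using g(2)[of "j - int n - 1"] by simp
  qed
  moreover have "(\<lambda>n. (g (- int n), g (- int n - 1))) (n + nat (- j)) = b (n + nat j)" for n
    by (cases "j \<ge> 0") (simp_all add: b_def algebra_simps)
  ultimately have "b \<in> \<omega>'" using Omega_closed[OF \<omega>' g(4)] by blast
  then have rb: "ray x \<omega>' = b" by (rule ray_eqI[OF \<omega>']) (simp add: b_def x)
  show "ray x \<omega> 0 \<noteq> ray x \<omega>' 0" unfolding ra rb using g(2)[of j] by (simp add: a_def b_def)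
next
  assume ne: "ray x \<omega> 0 \<noteq> ray x \<omega>' 0"
  define a b where "a = ray x \<omega>" and "b = ray x \<omega>'"
  have fa: "fchain E a" and fb: "fchain E b" using ray_fchain \<omega> \<omega>' by (auto simp: a_def b_def)
  have a0: "fst (a 0) = x" and b0: "fst (b 0) = x" using ray_start \<omega> \<omega>' by (auto simp: a_def b_def)
  \<comment> \<open>The ray to \<omega> runs over the nonnegative indices and the ray to \<omega>'
    over the negative ones.\<close>
  define g where "g n = (if n \<ge> 0 then fst (a (nat n)) else fst (b (nat (- n))))" for n :: int
  have gp: "g (int n) = fst (a n)" for n by (simp add: g_def)
  have gm: "g (- int n) = fst (b n)" for n using a0 b0 by (cases "n = 0") (simp_all add: g_def)
  have gp1: "g (int n + 1) = fst (a (Suc n))" for n using gp[of "Suc n"] by (simp add: add.commute)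
  have gm1: "g (- int n - 1) = fst (b (Suc n))" for n
  proof -
    have "- int n - 1 = - int (Suc n)" by simp
    then show ?thesis by (simp only: gm)
  qed
  have va: "(fst (a n), fst (a (Suc n))) = a n" for n using fchain_vertices[OF fa] by simp
  have vb: "(fst (b n), fst (b (Suc n))) = b n" for n using fchain_vertices[OF fb] by simp
  have "(g n, g (n + 1)) \<in> E" for n
  proof (cases "n \<ge> 0")
    case True
    then obtain m where "n = int m" using nonneg_int_cases by blast
    then show ?thesis using gp gp1 va fchain_edge[OF fa] by simp
  next
    case False
    define m where "m = nat (- n - 1)"
    have m: "n = - int m - 1" "n + 1 = - int m" using False by (auto simp: m_def)
    have "(g (n + 1), g n) = b m" unfolding m(2) gm by (simp add: m(1) gm1 vb)
    then show ?thesis using fchain_edge[OF fb, of m] edge_sym by metis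
  qed
  moreover have "g (n + 1) \<noteq> g (n - 1)" for n
  proof -
    consider "n > 0" | "n = 0" | "n < 0" by linarith
    then show ?thesis
    proof cases
      case 1
      define m where "m = nat (n - 1)"
      have m: "n - 1 = int m" "n + 1 = int (Suc m) + 1" using 1 by (auto simp: m_def)
      show ?thesis unfolding m gp gp1 using fchain_inj[OF fa, of "Suc (Suc m)" m] by auto
    next
      case 2
      \<comment> \<open>Within each half backtracking is impossible; at the joint it is excluded by
        the different first edges.\<close>
      have "fst (a 1) \<noteq> fst (b 1)" using ne va[of 0] vb[of 0] a0 b0 unfolding a_def b_def by auto
      then show ?thesis using gp1[of 0] gm1[of 0] 2 by simp
    next
      case 3
      define m where "m = nat (- n - 1)"
      have m: "n - 1 = - int (Suc m) - 1" "n + 1 = - int m" using 3 by (auto simp: m_def)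
      show ?thesis unfolding m gm gm1 using fchain_inj[OF fb, of "Suc (Suc m)" m] by auto
    qed
  qed
  moreover have "(\<lambda>n::nat. (g (int n), g (int n + 1))) \<in> \<omega>"
    unfolding gp gp1 va unfolding a_def by (rule ray_in[OF \<omega>])
  moreover have "(\<lambda>n::nat. (g (- int n), g (- int n - 1))) \<in> \<omega>'"
    unfolding gm gm1 vb unfolding b_def by (rule ray_in[OF \<omega>'])
  moreover have "x \<in> range g" using gp[of 0] a0 by (metis rangeI)
  ultimately show "x \<in> geod_verts E \<omega>' \<omega>" unfolding geod_verts_def by blast
qed

text \<open>A point \<open>(\<omega>', \<omega>, x)\<close> of \<open>Pspace E\<close> is encoded by the pair of forward chains \<open>[x, \<omega>)\<close> and
  \<open>[x, \<omega>')\<close>; the second one is the reversal of the backward chain in \<open>compat\<close>.\<close>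

definition cpt :: "'v chn \<Rightarrow> 'v chn \<Rightarrow> bool" where
  "cpt a b \<longleftrightarrow> fchain E a \<and> fchain E b \<and> fst (a 0) = fst (b 0) \<and> a 0 \<noteq> b 0"

definition point :: "'v chn \<times> 'v chn \<Rightarrow> 'v chn set \<times> 'v chn set \<times> 'v" where
  "point p = (bclass E (snd p), bclass E (fst p), fst (fst p 0))"

lemma compat_iff: "compat E a (rev_chn b) \<longleftrightarrow> cpt a b"
  unfolding compat_def cpt_def rev_chn_Pminus
  by (auto simp: Pplus_def pi_plus_def pi_minus_def rev_chn_def prod_eq_iff)

lemma triple_of_eq: "triple_of E a (rev_chn b) = point (a, b)"
  by (simp add: triple_of_def point_def pi_plus_def)

lemma ray_point:
  assumes "cpt a b"
  shows "ray (fst (a 0)) (bclass E a) = a" "ray (fst (a 0)) (bclass E b) = b"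
  using assms ray_bclass unfolding cpt_def by metis+

lemma point_Pspace:
  assumes "cpt a b"
  shows "point (a, b) \<in> Pspace E"
proof -
  have \<omega>: "bclass E a \<in> Omega E" "bclass E b \<in> Omega E" using assms bclass_Omega by (auto simp: cpt_def)
  have "a 0 \<noteq> b 0" using assms by (simp add: cpt_def)
  then have "fst (a 0) \<in> geod_verts E (bclass E b) (bclass E a)"
    unfolding geod_verts_iff[OF \<omega>] ray_point[OF assms] .
  moreover have "bclass E b \<noteq> bclass E a" using ray_point[OF assms] \<open>a 0 \<noteq> b 0\<close> by metis
  ultimately show ?thesis using \<omega> by (simp add: Pspace_def point_def)
qed

lemma cpt_ray:
  assumes "\<omega> \<in> Omega E" "\<omega>' \<in> Omega E"
  shows "cpt (ray x \<omega>) (ray x \<omega>') \<longleftrightarrow> ray x \<omega> 0 \<noteq> ray x \<omega>' 0"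
    and "point (ray x \<omega>, ray x \<omega>') = (\<omega>', \<omega>, x)"
  using assms by (auto simp: cpt_def point_def ray_fchain ray_start bclass_ray)

definition plc :: "('v chn \<times> 'v chn \<Rightarrow> complex) \<Rightarrow> bool" where
  "plc \<Phi> \<longleftrightarrow> (\<forall>a b. cpt a b \<longrightarrow> (\<exists>n. \<forall>a' b'. cpt a' b' \<longrightarrow> (\<forall>i<n. a' i = a i \<and> b' i = b i)
      \<longrightarrow> \<Phi> (a', b') = \<Phi> (a, b)))"

lemma plcD:
  "plc \<Phi> \<Longrightarrow> cpt a b \<Longrightarrow> \<exists>n. \<forall>a' b'. cpt a' b' \<longrightarrow> (\<forall>i<n. a' i = a i \<and> b' i = b i) \<longrightarrow> \<Phi> (a', b') = \<Phi> (a, b)"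
  unfolding plc_def by simp

lemma plc_mult:
  assumes "plc \<Phi>" "plc \<Psi>"
  shows "plc (\<lambda>p. \<Phi> p * \<Psi> p)"
  unfolding plc_def
proof (intro allI impI)
  fix a b assume ab: "cpt a b"
  from plcD[OF assms(1) ab] obtain n where
    n: "\<forall>a' b'. cpt a' b' \<longrightarrow> (\<forall>i<n. a' i = a i \<and> b' i = b i) \<longrightarrow> \<Phi> (a', b') = \<Phi> (a, b)" ..
  from plcD[OF assms(2) ab] obtain m where
    m: "\<forall>a' b'. cpt a' b' \<longrightarrow> (\<forall>i<m. a' i = a i \<and> b' i = b i) \<longrightarrow> \<Psi> (a', b') = \<Psi> (a, b)" ..
  show "\<exists>n. \<forall>a' b'. cpt a' b' \<longrightarrow> (\<forall>i<n. a' i = a i \<and> b' i = b i) \<longrightarrow>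
      \<Phi> (a', b') * \<Psi> (a', b') = \<Phi> (a, b) * \<Psi> (a, b)"
  proof (intro exI[of _ "max n m"] allI impI)
    fix a' b' assume h: "cpt a' b'" "\<forall>i<max n m. a' i = a i \<and> b' i = b i"
    have "\<Phi> (a', b') = \<Phi> (a, b)" by (rule n[THEN spec, THEN spec, THEN mp[OF _ h(1)], THEN mp]) (use h(2) in simp)
    moreover have "\<Psi> (a', b') = \<Psi> (a, b)" by (rule m[THEN spec, THEN spec, THEN mp[OF _ h(1)], THEN mp]) (use h(2) in simp)
    ultimately show "\<Phi> (a', b') * \<Psi> (a', b') = \<Phi> (a, b) * \<Psi> (a, b)" by simp
  qed
qed

lemma plc_fst:
  assumes "lc_shift (Pplus E) f"
  shows "plc (\<lambda>p. f (fst p))"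
  unfolding plc_def
proof (intro allI impI)
  fix a b assume "cpt a b"
  then have "a \<in> Pplus E" by (simp add: cpt_def Pplus_def)
  from bspec[OF assms[unfolded lc_shift_def] this] obtain n where
    "\<forall>c'\<in>Pplus E. (\<forall>i<n. c' i = a i) \<longrightarrow> f c' = f a" ..
  then show "\<exists>n. \<forall>a' b'. cpt a' b' \<longrightarrow> (\<forall>i<n. a' i = a i \<and> b' i = b i) \<longrightarrow> f (fst (a', b')) = f (fst (a, b))"
    by (intro exI[of _ n]) (simp add: cpt_def Pplus_def)
qed

lemma bdry_set_agree:
  assumes c: "fchain E c" and e: "bclass E c \<in> bdry_set E e"
  shows "\<exists>n. \<forall>c'. fchain E c' \<longrightarrow> (\<forall>i<n. c' i = c i) \<longrightarrow> bclass E c' \<in> bdry_set E e"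
proof -
  from ray_agree_change_base[of "fst (c 0)" 1 "fst e"] obtain m where
    m: "\<forall>\<omega>\<in>Omega E. \<forall>\<eta>\<in>Omega E. (\<forall>i<m. ray (fst (c 0)) \<eta> i = ray (fst (c 0)) \<omega> i)
      \<longrightarrow> (\<forall>i<1. ray (fst e) \<eta> i = ray (fst e) \<omega> i)" ..
  show ?thesis
  proof (intro exI[of _ "Suc m"] allI impI)
    fix c' assume c': "fchain E c'" "\<forall>i<Suc m. c' i = c i"
    have "c' 0 = c 0" using c' by simp
    then have "ray (fst (c 0)) (bclass E c') = c'" using ray_bclass[OF c'(1)] by simp
    then have "\<forall>i<m. ray (fst (c 0)) (bclass E c') i = ray (fst (c 0)) (bclass E c) i"
      using c'(2) ray_bclass[OF c] by simp
    then have "\<forall>i<1. ray (fst e) (bclass E c') i = ray (fst e) (bclass E c) i"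
      by (rule m[THEN bspec[OF _ bclass_Omega[OF c]], THEN bspec[OF _ bclass_Omega[OF c'(1)]], THEN mp])
    then show "bclass E c' \<in> bdry_set E e"
      using e bdry_set_iff bclass_Omega c c'(1) by simp
  qed
qed

lemma plc_point:
  assumes F: "lc_P E F"
  shows "plc (\<lambda>p. F (point p))"
  unfolding plc_def
proof (intro allI impI)
  fix a b assume ab: "cpt a b"
  then have fa: "fchain E a" and fb: "fchain E b" by (auto simp: cpt_def)
  have "(bclass E b, bclass E a, fst (a 0)) \<in> Pspace E" using point_Pspace[OF ab] by (simp add: point_def)
  from F[unfolded lc_P_def, THEN spec, THEN spec, THEN spec, THEN mp[OF _ this]]
  obtain e' e where e: "bclass E b \<in> bdry_set E e'" "bclass E a \<in> bdry_set E e"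
    and Fe: "\<forall>\<eta>' \<eta>. \<eta>' \<in> bdry_set E e' \<longrightarrow> \<eta> \<in> bdry_set E e \<longrightarrow> (\<eta>', \<eta>, fst (a 0)) \<in> Pspace E \<longrightarrow>
            F (\<eta>', \<eta>, fst (a 0)) = F (bclass E b, bclass E a, fst (a 0))" by auto
  from bdry_set_agree[OF fa e(2)] obtain n where
    n: "\<forall>c'. fchain E c' \<longrightarrow> (\<forall>i<n. c' i = a i) \<longrightarrow> bclass E c' \<in> bdry_set E e" ..
  from bdry_set_agree[OF fb e(1)] obtain m where
    m: "\<forall>c'. fchain E c' \<longrightarrow> (\<forall>i<m. c' i = b i) \<longrightarrow> bclass E c' \<in> bdry_set E e'" ..
  show "\<exists>n. \<forall>a' b'. cpt a' b' \<longrightarrow> (\<forall>i<n. a' i = a i \<and> b' i = b i) \<longrightarrow> F (point (a', b')) = F (point (a, b))"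
  proof (intro exI[of _ "Suc (n + m)"] allI impI)
    fix a' b' assume h: "cpt a' b'" "\<forall>i<Suc (n + m). a' i = a i \<and> b' i = b i"
    \<comment> \<open>Index 0 is included thanks to \<open>Suc\<close>; it keeps the common origin,
      and with it the third coordinate of the point.\<close>
    have 0: "a' 0 = a 0" using h(2) by simp
    have "bclass E a' \<in> bdry_set E e"
      by (rule n[THEN spec, THEN mp, THEN mp]) (use h in \<open>simp_all add: cpt_def\<close>)
    moreover have "bclass E b' \<in> bdry_set E e'"
      by (rule m[THEN spec, THEN mp, THEN mp]) (use h in \<open>simp_all add: cpt_def\<close>)
    moreover have "(bclass E b', bclass E a', fst (a 0)) \<in> Pspace E"
      using point_Pspace[OF h(1)] 0 by (simp add: point_def)
    ultimately show "F (point (a', b')) = F (point (a, b))" using Fe 0 by (simp add: point_def)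
  qed
qed

text \<open>Test functions on pairs of chains. The level is required uniformly, because after
  integrating over \<open>b\<close> the dependence on \<open>a\<close> must still be bounded;
  \<open>T2_I\<close> derives this from pointwise local constancy.\<close>

definition T2 :: "('v chn \<times> 'v chn \<Rightarrow> complex) set" where
  "T2 = {\<Phi>. (\<forall>a b. \<Phi> (a, b) \<noteq> 0 \<longrightarrow> cpt a b) \<and>
     (\<exists>X. finite X \<and> (\<forall>a b. \<Phi> (a, b) \<noteq> 0 \<longrightarrow> fst (a 0) \<in> X)) \<and>
     (\<exists>n. \<forall>a b a' b'. cpt a b \<longrightarrow> cpt a' b' \<longrightarrow> (\<forall>i<n. a' i = a i \<and> b' i = b i)
        \<longrightarrow> \<Phi> (a', b') = \<Phi> (a, b))}"

lemma T2_cpt: "\<Phi> \<in> T2 \<Longrightarrow> \<Phi> (a, b) \<noteq> 0 \<Longrightarrow> cpt a b"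
  unfolding T2_def by blast

lemma T2_support: "\<Phi> \<in> T2 \<Longrightarrow> \<exists>X. finite X \<and> (\<forall>a b. \<Phi> (a, b) \<noteq> 0 \<longrightarrow> fst (a 0) \<in> X)"
  unfolding T2_def by blast

lemma T2_level: "\<Phi> \<in> T2 \<Longrightarrow> \<exists>n. \<forall>a b a' b'. cpt a b \<longrightarrow> cpt a' b' \<longrightarrow> (\<forall>i<n. a' i = a i \<and> b' i = b i)
        \<longrightarrow> \<Phi> (a', b') = \<Phi> (a, b)"
  unfolding T2_def by simp

lemma T2_I:
  assumes cpt: "\<And>a b. \<Phi> (a, b) \<noteq> 0 \<Longrightarrow> cpt a b"
    and X: "finite X" "\<And>a b. \<Phi> (a, b) \<noteq> 0 \<Longrightarrow> fst (a 0) \<in> X"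
    and lc: "plc \<Phi>"
  shows "\<Phi> \<in> T2"
proof -
  \<comment> \<open>A pair of chains is encoded as one sequence of pairs of edges, so that the
    compactness lemma for sequences applies.\<close>
  define S where "S = {c. cpt (\<lambda>n. fst (c n)) (\<lambda>n. snd (c n)) \<and> fst (fst (c 0)) \<in> X}"
  define f where "f c = \<Phi> (\<lambda>n. fst (c n), \<lambda>n. snd (c n))" for c
  have "\<exists>n. \<forall>c\<in>S. \<forall>c'\<in>S. (\<forall>i<n. c' i = c i) \<longrightarrow> f c' = f c"
  proof (rule finite_branching_uniform)
    fix n
    let ?A = "(\<lambda>c. c n) ` {c. fchain E c \<and> fst (c 0) \<in> X}"
    have "(\<lambda>c. c n) ` S \<subseteq> ?A \<times> ?A"
    proof
      fix p assume "p \<in> (\<lambda>c. c n) ` S"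
      then obtain c where c: "p = c n" "c \<in> S" by blast
      have "fst p \<in> ?A" using c by (intro image_eqI[of _ _ "\<lambda>n. fst (c n)"]) (auto simp: S_def cpt_def)
      moreover have "snd p \<in> ?A" using c by (intro image_eqI[of _ _ "\<lambda>n. snd (c n)"]) (auto simp: S_def cpt_def)
      ultimately show "p \<in> ?A \<times> ?A" by (simp add: mem_Times_iff)
    qed
    then show "finite ((\<lambda>c. c n) ` S)" using chains_from_finite[OF X(1)] finite_subset by blast
  next
    fix c assume h: "\<And>n. \<exists>c'\<in>S. \<forall>i<n. c' i = c i"
    have "fchain E (\<lambda>n. fst (c n))" "fchain E (\<lambda>n. snd (c n))"
    proof -
      show "fchain E (\<lambda>n. fst (c n))"
      proof (rule fchain_closed)
        fix n obtain c' where "c' \<in> S" "\<forall>i<n. c' i = c i" using h by blast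
        then show "\<exists>d. fchain E d \<and> (\<forall>i<n. d i = fst (c i))"
          by (intro exI[of _ "\<lambda>n. fst (c' n)"]) (auto simp: S_def cpt_def)
      qed
      show "fchain E (\<lambda>n. snd (c n))"
      proof (rule fchain_closed)
        fix n obtain c' where "c' \<in> S" "\<forall>i<n. c' i = c i" using h by blast
        then show "\<exists>d. fchain E d \<and> (\<forall>i<n. d i = snd (c i))"
          by (intro exI[of _ "\<lambda>n. snd (c' n)"]) (auto simp: S_def cpt_def)
      qed
    qed
    moreover obtain c' where "c' \<in> S" "\<forall>i<1. c' i = c i" using h by blast
    ultimately show "c \<in> S" by (auto simp: S_def cpt_def)
  next
    fix c assume c: "c \<in> S"
    then have "cpt (\<lambda>n. fst (c n)) (\<lambda>n. snd (c n))" by (simp add: S_def)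
    from plcD[OF lc this] obtain n where
      n: "\<forall>a' b'. cpt a' b' \<longrightarrow> (\<forall>i<n. a' i = fst (c i) \<and> b' i = snd (c i))
         \<longrightarrow> \<Phi> (a', b') = \<Phi> (\<lambda>n. fst (c n), \<lambda>n. snd (c n))" ..
    show "\<exists>n. \<forall>c'\<in>S. (\<forall>i<n. c' i = c i) \<longrightarrow> f c' = f c"
      unfolding f_def
      by (intro exI[of _ n] ballI impI n[THEN spec, THEN spec, THEN mp, THEN mp]) (auto simp: S_def)
  qed
  then obtain n where n: "\<forall>c\<in>S. \<forall>c'\<in>S. (\<forall>i<n. c' i = c i) \<longrightarrow> f c' = f c" ..
  have "\<Phi> (a', b') = \<Phi> (a, b)"
    if h: "cpt a b" "cpt a' b'" "\<forall>i<Suc n. a' i = a i \<and> b' i = b i" for a b a' b'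
  proof (cases "fst (a 0) \<in> X")
    case True
    have "(\<lambda>i. (a i, b i)) \<in> S" "(\<lambda>i. (a' i, b' i)) \<in> S" using h True by (auto simp: S_def)
    from n[THEN bspec[OF _ this(1)], THEN bspec[OF _ this(2)]]
    show ?thesis using h(3) by (simp add: f_def)
  next
    case False
    then have "\<Phi> (a, b) = 0" "\<Phi> (a', b') = 0" using X(2) h(3) by force+
    then show ?thesis by simp
  qed
  then have "\<exists>n. \<forall>a b a' b'. cpt a b \<longrightarrow> cpt a' b' \<longrightarrow> (\<forall>i<n. a' i = a i \<and> b' i = b i)
        \<longrightarrow> \<Phi> (a', b') = \<Phi> (a, b)" by (intro exI[of _ "Suc n"]) blast
  then show ?thesis unfolding T2_def using cpt X by blast
qed

lemma T2_plc: "\<Phi> \<in> T2 \<Longrightarrow> plc \<Phi>"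
  unfolding T2_def plc_def by simp meson

lemma T2_combine:
  assumes \<Phi>: "\<Phi> \<in> T2" and \<Psi>: "\<Psi> \<in> T2" and h: "h 0 0 = 0"
  shows "(\<lambda>p. h (\<Phi> p) (\<Psi> p)) \<in> T2"
proof -
  obtain X where X: "finite X" "\<And>a b. \<Phi> (a, b) \<noteq> 0 \<Longrightarrow> fst (a 0) \<in> X" using T2_support[OF \<Phi>] by metis
  obtain Y where Y: "finite Y" "\<And>a b. \<Psi> (a, b) \<noteq> 0 \<Longrightarrow> fst (a 0) \<in> Y" using T2_support[OF \<Psi>] by metis
  from T2_level[OF \<Phi>] obtain n where
    n: "\<forall>a b a' b'. cpt a b \<longrightarrow> cpt a' b' \<longrightarrow> (\<forall>i<n. a' i = a i \<and> b' i = b i) \<longrightarrow> \<Phi> (a', b') = \<Phi> (a, b)" ..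
  from T2_level[OF \<Psi>] obtain m where
    m: "\<forall>a b a' b'. cpt a b \<longrightarrow> cpt a' b' \<longrightarrow> (\<forall>i<m. a' i = a i \<and> b' i = b i) \<longrightarrow> \<Psi> (a', b') = \<Psi> (a, b)" ..
  have nz: "\<Phi> (a, b) \<noteq> 0 \<or> \<Psi> (a, b) \<noteq> 0" if "h (\<Phi> (a, b)) (\<Psi> (a, b)) \<noteq> 0" for a b
    using that h by auto
  show ?thesis
    unfolding T2_def
  proof (intro CollectI conjI)
    show "\<forall>a b. h (\<Phi> (a, b)) (\<Psi> (a, b)) \<noteq> 0 \<longrightarrow> cpt a b"
      using nz T2_cpt \<Phi> \<Psi> by blast
    show "\<exists>X. finite X \<and> (\<forall>a b. h (\<Phi> (a, b)) (\<Psi> (a, b)) \<noteq> 0 \<longrightarrow> fst (a 0) \<in> X)"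
      by (rule exI[of _ "X \<union> Y"]) (use nz X Y in blast)
    show "\<exists>n. \<forall>a b a' b'. cpt a b \<longrightarrow> cpt a' b' \<longrightarrow> (\<forall>i<n. a' i = a i \<and> b' i = b i)
        \<longrightarrow> h (\<Phi> (a', b')) (\<Psi> (a', b')) = h (\<Phi> (a, b)) (\<Psi> (a, b))"
    proof (intro exI[of _ "max n m"] allI impI)
      fix a b a' b' assume g: "cpt a b" "cpt a' b'" "\<forall>i<max n m. a' i = a i \<and> b' i = b i"
      have "\<Phi> (a', b') = \<Phi> (a, b)"
        by (rule n[THEN spec, THEN spec, THEN spec, THEN spec, THEN mp[OF _ g(1)], THEN mp[OF _ g(2)], THEN mp]) (use g(3) in simp)
      moreover have "\<Psi> (a', b') = \<Psi> (a, b)"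
        by (rule m[THEN spec, THEN spec, THEN spec, THEN spec, THEN mp[OF _ g(1)], THEN mp[OF _ g(2)], THEN mp]) (use g(3) in simp)
      ultimately show "h (\<Phi> (a', b')) (\<Psi> (a', b')) = h (\<Phi> (a, b)) (\<Psi> (a, b))" by simp
    qed
  qed
qed

lemma T2_zero: "(\<lambda>_. 0) \<in> T2"
  unfolding T2_def by auto

lemma T2_add: "\<Phi> \<in> T2 \<Longrightarrow> \<Psi> \<in> T2 \<Longrightarrow> (\<lambda>p. \<Phi> p + \<Psi> p) \<in> T2"
  using T2_combine[of \<Phi> \<Psi> "(+)"] by simp

lemma T2_mult: "\<Phi> \<in> T2 \<Longrightarrow> \<Psi> \<in> T2 \<Longrightarrow> (\<lambda>p. \<Phi> p * \<Psi> p) \<in> T2"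
  using T2_combine[of \<Phi> \<Psi> "(*)"] by simp

lemma T2_scale: "\<Phi> \<in> T2 \<Longrightarrow> (\<lambda>p. k * \<Phi> p) \<in> T2"
  using T2_combine[of \<Phi> \<Phi> "\<lambda>x _. k * x"] by simp

text \<open>For forward chains compatibility is decided by the two first edges. With agreement at
  index 0 the two pairs are both compatible or both incompatible, and in the latter case both values
  are zero.\<close>

lemma T2_agree:
  assumes \<Phi>: "\<Phi> \<in> T2"
  shows "\<exists>n. \<forall>a b a' b'. fchain E a \<longrightarrow> fchain E b \<longrightarrow> fchain E a' \<longrightarrow> fchain E b' \<longrightarrow>
    (\<forall>i<Suc n. a' i = a i \<and> b' i = b i) \<longrightarrow> \<Phi> (a', b') = \<Phi> (a, b)"
proof -
  from T2_level[OF \<Phi>] obtain n where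
    n: "\<forall>a b a' b'. cpt a b \<longrightarrow> cpt a' b' \<longrightarrow> (\<forall>i<n. a' i = a i \<and> b' i = b i) \<longrightarrow> \<Phi> (a', b') = \<Phi> (a, b)" ..
  show ?thesis
  proof (intro exI[of _ n] allI impI)
    fix a b a' b' assume h: "fchain E a" "fchain E b" "fchain E a'" "fchain E b'"
      "\<forall>i<Suc n. a' i = a i \<and> b' i = b i"
    then have iff: "cpt a' b' \<longleftrightarrow> cpt a b" by (simp add: cpt_def)
    show "\<Phi> (a', b') = \<Phi> (a, b)"
    proof (cases "cpt a b")
      case True
      show ?thesis
        by (rule n[THEN spec, THEN spec, THEN spec, THEN spec, THEN mp[OF _ True], THEN mp, THEN mp])
           (use h iff True in simp_all)
    next
      case False
      then show ?thesis using T2_cpt[OF \<Phi>] iff by metis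
    qed
  qed
qed

lemma T2_section:
  assumes \<Phi>: "\<Phi> \<in> T2"
  shows "(\<lambda>b. \<Phi> (a, b)) \<in> Tp"
proof (cases "fchain E a")
  case True
  from T2_agree[OF \<Phi>] obtain n where
    n: "\<forall>a b a' b'. fchain E a \<longrightarrow> fchain E b \<longrightarrow> fchain E a' \<longrightarrow> fchain E b' \<longrightarrow>
    (\<forall>i<Suc n. a' i = a i \<and> b' i = b i) \<longrightarrow> \<Phi> (a', b') = \<Phi> (a, b)" ..
  have "level (Suc n) (\<lambda>b. \<Phi> (a, b))"
    unfolding level_def
    by (intro allI impI n[THEN spec, THEN spec, THEN spec, THEN spec, THEN mp, THEN mp, THEN mp, THEN mp, THEN mp])
       (use True in auto)
  then show ?thesis
    by (rule Tp_I[OF level_lc_shift, of _ _ "{fst (a 0)}"]) (use T2_cpt[OF \<Phi>] in \<open>auto simp: cpt_def\<close>)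
next
  case False
  then have "(\<lambda>b. \<Phi> (a, b)) = (\<lambda>_. 0)" using T2_cpt[OF \<Phi>] by (fastforce simp: cpt_def)
  then show ?thesis using Tp_zero by simp
qed

text \<open>If \<open>a\<close> and \<open>a'\<close> agree up to the uniform level, the integrands
  agree as functions of \<open>b\<close>, so no property of \<open>v\<close> beyond
  \<open>v (\<lambda>_. 0) = 0\<close> enters.\<close>

lemma T2_integral:
  assumes \<Phi>: "\<Phi> \<in> T2" and v: "is_dual Tp v"
  shows "(\<lambda>a. v (\<lambda>b. \<Phi> (a, b))) \<in> Tp"
proof -
  obtain X where X: "finite X" "\<And>a b. \<Phi> (a, b) \<noteq> 0 \<Longrightarrow> fst (a 0) \<in> X" using T2_support[OF \<Phi>] by metis
  from T2_agree[OF \<Phi>] obtain n where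
    n: "\<forall>a b a' b'. fchain E a \<longrightarrow> fchain E b \<longrightarrow> fchain E a' \<longrightarrow> fchain E b' \<longrightarrow>
    (\<forall>i<Suc n. a' i = a i \<and> b' i = b i) \<longrightarrow> \<Phi> (a', b') = \<Phi> (a, b)" ..
  have v0: "v (\<lambda>_. 0) = 0" using dual_scale[OF v Tp_zero, of 0] by simp
  have "level (Suc n) (\<lambda>a. v (\<lambda>b. \<Phi> (a, b)))"
    unfolding level_def
  proof (intro allI impI)
    fix a a' assume h: "fchain E a" "fchain E a'" "\<forall>i<Suc n. a' i = a i"
    have "\<Phi> (a', b) = \<Phi> (a, b)" for b
    proof (cases "fchain E b")
      case True
      show ?thesis
        by (rule n[THEN spec, THEN spec, THEN spec, THEN spec, THEN mp, THEN mp, THEN mp, THEN mp, THEN mp])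
           (use h True in auto)
    next
      case False
      then have "\<Phi> (a', b) = 0" "\<Phi> (a, b) = 0" using T2_cpt[OF \<Phi>] by (auto simp: cpt_def)
      then show ?thesis by simp
    qed
    then show "v (\<lambda>b. \<Phi> (a', b)) = v (\<lambda>b. \<Phi> (a, b))" by simp
  qed
  then show ?thesis
  proof (rule Tp_I[OF level_lc_shift])
    show "finite X" by (rule X(1))
    fix a assume "v (\<lambda>b. \<Phi> (a, b)) \<noteq> 0"
    then have "(\<lambda>b. \<Phi> (a, b)) \<noteq> (\<lambda>_. 0)" using v0 by metis
    then obtain b where "\<Phi> (a, b) \<noteq> 0" by blast
    then show "fchain E a \<and> fst (a 0) \<in> X" using X(2) T2_cpt[OF \<Phi>] by (auto simp: cpt_def)
  qed
qed

definition tens :: "(('v chn \<Rightarrow> complex) \<Rightarrow> complex) \<Rightarrow> (('v chn \<Rightarrow> complex) \<Rightarrow> complex)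
    \<Rightarrow> ('v chn \<times> 'v chn \<Rightarrow> complex) \<Rightarrow> complex" where
  "tens u v \<Phi> = (if \<Phi> \<in> T2 then u (\<lambda>a. v (\<lambda>b. \<Phi> (a, b))) else 0)"

lemma tens_dual:
  assumes u: "is_dual Tp u" and v: "is_dual Tp v"
  shows "is_dual T2 (tens u v)"
  unfolding is_dual_def
proof (intro conjI ballI allI impI)
  fix \<Phi> \<Psi> assume "\<Phi> \<in> T2" "\<Psi> \<in> T2"
  then show "tens u v (\<lambda>p. \<Phi> p + \<Psi> p) = tens u v \<Phi> + tens u v \<Psi>"
    using T2_add dual_add[OF v T2_section T2_section] dual_add[OF u T2_integral[OF _ v] T2_integral[OF _ v]]
    by (simp add: tens_def)
next
  fix k \<Phi> assume "\<Phi> \<in> T2"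
  then show "tens u v (\<lambda>p. k * \<Phi> p) = k * tens u v \<Phi>"
    using T2_scale dual_scale[OF v T2_section] dual_scale[OF u T2_integral[OF _ v]]
    by (simp add: tens_def)
qed (simp add: tens_def)

definition act2 :: "('v \<Rightarrow> 'v) \<Rightarrow> 'v chn \<times> 'v chn \<Rightarrow> 'v chn \<times> 'v chn" where
  "act2 \<gamma> p = (act_chn \<gamma> (fst p), act_chn \<gamma> (snd p))"

lemma cpt_act: "aut \<gamma> \<Longrightarrow> cpt (act_chn \<gamma> a) (act_chn \<gamma> b) \<longleftrightarrow> cpt a b"
  by (simp add: cpt_def fchain_act act_agree) (simp add: act_chn_apply aut_inj)

lemma point_act: "aut \<gamma> \<Longrightarrow> cpt a b \<Longrightarrow> point (act2 \<gamma> (a, b)) = act_P \<gamma> (point (a, b))"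
  by (simp add: point_def act2_def act_P_def act_Omega_bclass cpt_def act_chn_apply)

lemma T2_act:
  assumes \<gamma>: "aut \<gamma>" and \<Phi>: "\<Phi> \<in> T2"
  shows "(\<lambda>p. \<Phi> (act2 \<gamma> p)) \<in> T2"
proof -
  obtain X where X: "finite X" "\<And>a b. \<Phi> (a, b) \<noteq> 0 \<Longrightarrow> fst (a 0) \<in> X" using T2_support[OF \<Phi>] by metis
  show ?thesis
  proof (rule T2_I)
    fix a b assume nz: "\<Phi> (act2 \<gamma> (a, b)) \<noteq> 0"
    then show "cpt a b" using T2_cpt[OF \<Phi>] cpt_act[OF \<gamma>] by (auto simp: act2_def)
    show "fst (a 0) \<in> \<gamma> -` X" using X(2)[of "act_chn \<gamma> a" "act_chn \<gamma> b"] nz by (simp add: act2_def act_chn_apply)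
  next
    show "finite (\<gamma> -` X)" using X(1) \<gamma> by (intro finite_vimageI) (auto simp: aut_def bij_def)
  next
    from T2_level[OF \<Phi>] obtain n where
      n: "\<forall>a b a' b'. cpt a b \<longrightarrow> cpt a' b' \<longrightarrow> (\<forall>i<n. a' i = a i \<and> b' i = b i) \<longrightarrow> \<Phi> (a', b') = \<Phi> (a, b)" ..
    show "plc (\<lambda>p. \<Phi> (act2 \<gamma> p))"
      unfolding plc_def act2_def fst_conv snd_conv
    proof (intro allI impI exI[of _ n])
      fix a b a' b' assume h: "cpt a b" "cpt a' b'" "\<forall>i<n. a' i = a i \<and> b' i = b i"
      show "\<Phi> (act_chn \<gamma> a', act_chn \<gamma> b') = \<Phi> (act_chn \<gamma> a, act_chn \<gamma> b)"
        by (rule n[THEN spec, THEN spec, THEN spec, THEN spec, THEN mp, THEN mp, THEN mp])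
           (use h in \<open>simp_all add: cpt_act[OF \<gamma>] act_agree[OF \<gamma>]\<close>)
    qed
  qed
qed

end

section \<open>Periodization\<close>

text \<open>The sum over the whole group, written over its nonzero terms so that it is a genuine
  finite sum whenever it should converge.\<close>

definition per :: "('g set) \<Rightarrow> ('g \<Rightarrow> 'z \<Rightarrow> 'z) \<Rightarrow> ('z \<Rightarrow> complex) \<Rightarrow> 'z \<Rightarrow> complex" where
  "per G act f x = (\<Sum>\<gamma>\<in>{\<gamma> \<in> G. f (act \<gamma> x) \<noteq> 0}. f (act \<gamma> x))"

text \<open>The unfolding trick: in each term invariance of \<open>v\<close> permits replacing
  \<open>x\<close> by \<open>act (inv \<gamma>) x\<close>, which moves the group element from
  \<open>g\<close> to \<open>h\<close>. Only finitely many elements let the supports meet, so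
  linearity suffices.\<close>

lemma per_adjoint:
  fixes \<Gamma> :: "('v \<Rightarrow> 'v) set" and act :: "('v \<Rightarrow> 'v) \<Rightarrow> 'z \<Rightarrow> 'z"
  assumes dual: "is_dual C v" and zero: "(\<lambda>_. 0) \<in> C"
    and add: "\<And>f g. f \<in> C \<Longrightarrow> g \<in> C \<Longrightarrow> (\<lambda>a. f a + g a) \<in> C"
    and mult: "\<And>f g. f \<in> C \<Longrightarrow> g \<in> C \<Longrightarrow> (\<lambda>a. f a * g a) \<in> C"
    and C_act: "\<And>\<gamma> f. \<gamma> \<in> \<Gamma> \<Longrightarrow> f \<in> C \<Longrightarrow> (\<lambda>x. f (act \<gamma> x)) \<in> C"
    and v_act: "\<And>\<gamma> f. \<gamma> \<in> \<Gamma> \<Longrightarrow> f \<in> C \<Longrightarrow> v (\<lambda>x. f (act \<gamma> x)) = v f"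
    and inv: "\<And>\<gamma>. \<gamma> \<in> \<Gamma> \<Longrightarrow> inv \<gamma> \<in> \<Gamma> \<and> inv (inv \<gamma>) = \<gamma>"
    and act_inv: "\<And>\<gamma> x. \<gamma> \<in> \<Gamma> \<Longrightarrow> act \<gamma> (act (inv \<gamma>) x) = x"
    and fin: "finite {\<gamma> \<in> \<Gamma>. \<exists>x. h x \<noteq> 0 \<and> g (act \<gamma> x) \<noteq> 0}"
    and h: "h \<in> C" and g: "g \<in> C"
  shows "v (\<lambda>x. h x * per \<Gamma> act g x) = v (\<lambda>x. per \<Gamma> act h x * g x)"
proof -
  define G where "G = {\<gamma> \<in> \<Gamma>. \<exists>x. h x \<noteq> 0 \<and> g (act \<gamma> x) \<noteq> 0}"
  have G: "finite G" "G \<subseteq> \<Gamma>" using fin by (auto simp: G_def)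
  have left: "h x * per \<Gamma> act g x = (\<Sum>\<gamma>\<in>G. h x * g (act \<gamma> x))" for x
  proof (cases "h x = 0")
    case False
    have "per \<Gamma> act g x = (\<Sum>\<gamma>\<in>G. g (act \<gamma> x))"
      unfolding per_def by (rule sum.mono_neutral_left) (use G False in \<open>auto simp: G_def\<close>)
    then show ?thesis by (simp add: sum_distrib_left)
  qed simp
  have inj: "inj_on inv G" by (rule inj_on_inverseI[of _ inv]) (use inv G in blast)
  have right: "per \<Gamma> act h x * g x = (\<Sum>\<gamma>\<in>G. h (act (inv \<gamma>) x) * g x)" for x
  proof (cases "g x = 0")
    case False
    have "{\<gamma> \<in> \<Gamma>. h (act \<gamma> x) \<noteq> 0} \<subseteq> inv ` G"
    proof
      fix \<gamma> assume \<gamma>: "\<gamma> \<in> {\<gamma> \<in> \<Gamma>. h (act \<gamma> x) \<noteq> 0}"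
      have "act (inv \<gamma>) (act \<gamma> x) = x" using act_inv[of "inv \<gamma>" x] inv[of \<gamma>] \<gamma> by simp
      then have "inv \<gamma> \<in> G" unfolding G_def using \<gamma> inv False by auto
      then show "\<gamma> \<in> inv ` G" using inv[of \<gamma>] \<gamma> by (metis (no_types, lifting) imageI mem_Collect_eq)
    qed
    then have "per \<Gamma> act h x = (\<Sum>\<gamma>\<in>inv ` G. h (act \<gamma> x))"
      unfolding per_def by (rule sum.mono_neutral_left[rotated]) (use G inv in auto)
    also have "\<dots> = (\<Sum>\<gamma>\<in>G. h (act (inv \<gamma>) x))" by (simp add: sum.reindex[OF inj])
    finally show ?thesis by (simp add: sum_distrib_right)
  qed simp
  have hg: "(\<lambda>x. h x * g (act \<gamma> x)) \<in> C" if "\<gamma> \<in> G" for \<gamma>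
    using mult[OF h C_act[OF _ g]] that G by blast
  have hg': "(\<lambda>x. h (act (inv \<gamma>) x) * g x) \<in> C" if "\<gamma> \<in> G" for \<gamma>
    using mult[OF C_act[OF _ h] g] that G inv by blast
  have "v (\<lambda>x. h x * per \<Gamma> act g x) = (\<Sum>\<gamma>\<in>G. v (\<lambda>x. h x * g (act \<gamma> x)))"
    unfolding left using dual_sum[OF dual zero add, of G "\<lambda>\<gamma> x. h x * g (act \<gamma> x)"] hg by blast
  also have "\<dots> = (\<Sum>\<gamma>\<in>G. v (\<lambda>x. h (act (inv \<gamma>) x) * g x))"
  proof (rule sum.cong)
    fix \<gamma> assume "\<gamma> \<in> G"
    then have \<gamma>: "\<gamma> \<in> \<Gamma>" "inv \<gamma> \<in> \<Gamma>" using G inv by auto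
    show "v (\<lambda>x. h x * g (act \<gamma> x)) = v (\<lambda>x. h (act (inv \<gamma>) x) * g x)"
      using v_act[OF \<gamma>(2) hg[OF \<open>\<gamma> \<in> G\<close>]] by (simp add: act_inv[OF \<gamma>(1)])
  qed simp
  also have "\<dots> = v (\<lambda>x. per \<Gamma> act h x * g x)"
    unfolding right using dual_sum[OF dual zero add, of G "\<lambda>\<gamma> x. h (act (inv \<gamma>) x) * g x"] hg' by metis
  finally show ?thesis .
qed

section \<open>Free group actions and the unfolding of cut-offs\<close>

locale tree_group = reg_tree E q for E :: "('v \<times> 'v) set" and q :: nat +
  fixes \<Gamma> :: "('v \<Rightarrow> 'v) set"
  assumes good: "good_group E \<Gamma>"
begin

lemma \<Gamma>_aut:
  assumes "\<gamma> \<in> \<Gamma>"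
  shows "aut \<gamma>"
proof -
  have "\<forall>\<gamma>\<in>\<Gamma>. bij \<gamma> \<and> inv \<gamma> \<in> \<Gamma>"
    using good unfolding good_group_def by (elim conjE)
  moreover have "\<forall>\<gamma>\<in>\<Gamma>. \<forall>x y. (x, y) \<in> E \<longleftrightarrow> (\<gamma> x, \<gamma> y) \<in> E"
    using good unfolding good_group_def by (elim conjE)
  ultimately show ?thesis unfolding aut_def using assms by blast
qed

lemma \<Gamma>_id: "id \<in> \<Gamma>"
  using good unfolding good_group_def by blast

lemma \<Gamma>_comp: "\<gamma> \<in> \<Gamma> \<Longrightarrow> \<delta> \<in> \<Gamma> \<Longrightarrow> \<gamma> \<circ> \<delta> \<in> \<Gamma>"
  using good unfolding good_group_def by blast

lemma \<Gamma>_inv: "\<gamma> \<in> \<Gamma> \<Longrightarrow> inv \<gamma> \<in> \<Gamma> \<and> inv (inv \<gamma>) = \<gamma>"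
  using good inv_inv_eq[of \<gamma>] unfolding good_group_def by simp

lemma \<Gamma>_free:
  assumes "\<gamma> \<in> \<Gamma>" "\<delta> \<in> \<Gamma>" "\<gamma> x = \<delta> x"
  shows "\<gamma> = \<delta>"
proof -
  have d: "inv \<delta> \<circ> \<delta> = id" "\<delta> \<circ> inv \<delta> = id" using aut_inv \<Gamma>_aut assms by blast+
  have "(inv \<delta> \<circ> \<gamma>) x = x" using fun_cong[OF d(1), of x] assms(3) by simp
  then have "inv \<delta> \<circ> \<gamma> = id" using good \<Gamma>_comp \<Gamma>_inv assms unfolding good_group_def by blast
  then have "\<delta> \<circ> (inv \<delta> \<circ> \<gamma>) = \<delta>" by simp
  then show ?thesis by (simp add: comp_assoc[symmetric] d(2))
qed

lemma \<Gamma>_act_inv: "\<gamma> \<in> \<Gamma> \<Longrightarrow> act_chn \<gamma> (act_chn (inv \<gamma>) c) = c"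
  using aut_inv(2)[OF \<Gamma>_aut] by (simp add: act_chn_comp)

text \<open>By freeness at most one group element takes a given \<open>x\<close> to a given
  \<open>y\<close>. This supplies the finiteness hypothesis of \<open>per_adjoint\<close>.\<close>

lemma finite_moves:
  assumes "finite X" "finite Y"
  shows "finite {\<gamma> \<in> \<Gamma>. \<exists>x\<in>X. \<gamma> x \<in> Y}"
proof -
  have "finite {\<gamma> \<in> \<Gamma>. \<gamma> x = y}" for x y
  proof (cases "\<exists>\<gamma>\<in>\<Gamma>. \<gamma> x = y")
    case True
    then obtain \<delta> where "\<delta> \<in> \<Gamma>" "\<delta> x = y" by blast
    then have "{\<gamma> \<in> \<Gamma>. \<gamma> x = y} \<subseteq> {\<delta>}" using \<Gamma>_free by blast
    then show ?thesis using finite_subset by blast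
  next
    case False
    then have "{\<gamma> \<in> \<Gamma>. \<gamma> x = y} = {}" by blast
    then show ?thesis by (simp only: finite.emptyI)
  qed
  moreover have "{\<gamma> \<in> \<Gamma>. \<exists>x\<in>X. \<gamma> x \<in> Y} = (\<Union>x\<in>X. \<Union>y\<in>Y. {\<gamma> \<in> \<Gamma>. \<gamma> x = y})" by blast
  ultimately show ?thesis using assms by simp
qed

definition inv_dual :: "(('v chn \<Rightarrow> complex) \<Rightarrow> complex) \<Rightarrow> bool" where
  "inv_dual u \<longleftrightarrow> is_dual Tp u \<and> (\<forall>\<gamma>\<in>\<Gamma>. \<forall>f\<in>Tp. u (\<lambda>c. f (act_chn \<gamma> c)) = u f)"

lemma inv_dualD: "inv_dual u \<Longrightarrow> \<gamma> \<in> \<Gamma> \<Longrightarrow> f \<in> Tp \<Longrightarrow> u (\<lambda>c. f (act_chn \<gamma> c)) = u f"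
  unfolding inv_dual_def by blast

lemma per_adjoint_chain:
  assumes u: "inv_dual u" and h: "h \<in> Tp" and g: "g \<in> Tp"
  shows "u (\<lambda>c. h c * per \<Gamma> act_chn g c) = u (\<lambda>c. per \<Gamma> act_chn h c * g c)"
proof (rule per_adjoint[OF _ Tp_zero Tp_add Tp_mult])
  show "is_dual Tp u" using u by (simp add: inv_dual_def)
  show "(\<lambda>x. f (act_chn \<gamma> x)) \<in> Tp" if "\<gamma> \<in> \<Gamma>" "f \<in> Tp" for \<gamma> f
    using Tp_act \<Gamma>_aut that by blast
  show "u (\<lambda>x. f (act_chn \<gamma> x)) = u f" if "\<gamma> \<in> \<Gamma>" "f \<in> Tp" for \<gamma> f
    using u that by (simp add: inv_dual_def)
  obtain X where X: "finite X" "\<And>c. h c \<noteq> 0 \<Longrightarrow> fchain E c \<and> fst (c 0) \<in> X"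
    using Tp_support[OF h] by metis
  obtain Y where Y: "finite Y" "\<And>c. g c \<noteq> 0 \<Longrightarrow> fchain E c \<and> fst (c 0) \<in> Y"
    using Tp_support[OF g] by metis
  have "{\<gamma> \<in> \<Gamma>. \<exists>x. h x \<noteq> 0 \<and> g (act_chn \<gamma> x) \<noteq> 0} \<subseteq> {\<gamma> \<in> \<Gamma>. \<exists>x\<in>X. \<gamma> x \<in> Y}"
    using X(2) Y(2)[of "act_chn _ _"] by (auto simp: act_chn_apply)
  then show "finite {\<gamma> \<in> \<Gamma>. \<exists>x. h x \<noteq> 0 \<and> g (act_chn \<gamma> x) \<noteq> 0}"
    using finite_moves[OF X(1) Y(1)] finite_subset by blast
qed (use \<Gamma>_inv \<Gamma>_act_inv h g in auto)

lemma per_adjoint_pair: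
  assumes u: "inv_dual u" and v: "inv_dual v" and h: "h \<in> T2" and g: "g \<in> T2"
  shows "tens u v (\<lambda>p. h p * per \<Gamma> act2 g p) = tens u v (\<lambda>p. per \<Gamma> act2 h p * g p)"
proof (rule per_adjoint[OF _ T2_zero T2_add T2_mult])
  have ud: "is_dual Tp u" and vd: "is_dual Tp v" using u v by (auto simp: inv_dual_def)
  show "is_dual T2 (tens u v)" by (rule tens_dual[OF ud vd])
  show "(\<lambda>x. f (act2 \<gamma> x)) \<in> T2" if "\<gamma> \<in> \<Gamma>" "f \<in> T2" for \<gamma> f
    using T2_act \<Gamma>_aut that by blast
  show "tens u v (\<lambda>x. f (act2 \<gamma> x)) = tens u v f" if "\<gamma> \<in> \<Gamma>" "f \<in> T2" for \<gamma> f
  proof -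
    have "v (\<lambda>b. f (act_chn \<gamma> a, act_chn \<gamma> b)) = v (\<lambda>b. f (act_chn \<gamma> a, b))" for a
      by (rule inv_dualD[OF v that(1) T2_section[OF that(2)]])
    moreover have "u (\<lambda>a. v (\<lambda>b. f (act_chn \<gamma> a, b))) = u (\<lambda>a. v (\<lambda>b. f (a, b)))"
      by (rule inv_dualD[OF u that(1) T2_integral[OF that(2) vd]])
    ultimately show ?thesis
      using that T2_act[OF \<Gamma>_aut[OF that(1)] that(2)] by (simp add: tens_def act2_def)
  qed
  obtain X where X: "finite X" "\<And>a b. h (a, b) \<noteq> 0 \<Longrightarrow> fst (a 0) \<in> X" using T2_support[OF h] by metis
  obtain Y where Y: "finite Y" "\<And>a b. g (a, b) \<noteq> 0 \<Longrightarrow> fst (a 0) \<in> Y" using T2_support[OF g] by metis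
  have "{\<gamma> \<in> \<Gamma>. \<exists>x. h x \<noteq> 0 \<and> g (act2 \<gamma> x) \<noteq> 0} \<subseteq> {\<gamma> \<in> \<Gamma>. \<exists>x\<in>X. \<gamma> x \<in> Y}"
  proof
    fix \<gamma> assume "\<gamma> \<in> {\<gamma> \<in> \<Gamma>. \<exists>x. h x \<noteq> 0 \<and> g (act2 \<gamma> x) \<noteq> 0}"
    then obtain a b where \<gamma>: "\<gamma> \<in> \<Gamma>" "h (a, b) \<noteq> 0" "g (act_chn \<gamma> a, act_chn \<gamma> b) \<noteq> 0"
      by (auto simp: act2_def)
    have "fst (a 0) \<in> X" "\<gamma> (fst (a 0)) \<in> Y" using X(2)[OF \<gamma>(2)] Y(2)[OF \<gamma>(3)] by (auto simp: act_chn_apply)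
    then show "\<gamma> \<in> {\<gamma> \<in> \<Gamma>. \<exists>x\<in>X. \<gamma> x \<in> Y}" using \<gamma>(1) by blast
  qed
  then show "finite {\<gamma> \<in> \<Gamma>. \<exists>x. h x \<noteq> 0 \<and> g (act2 \<gamma> x) \<noteq> 0}"
    using finite_moves[OF X(1) Y(1)] finite_subset by blast
qed (use \<Gamma>_inv \<Gamma>_act_inv h g in \<open>auto simp: act2_def\<close>)

text \<open>The function \<open>F\<close> transported to pairs of forward chains and extended by
  zero, without saturating under separate translations of the two chains as \<open>ext_zero\<close>
  does.\<close>

definition K :: "('v chn set \<times> 'v chn set \<times> 'v \<Rightarrow> complex) \<Rightarrow> 'v chn \<times> 'v chn \<Rightarrow> complex" where
  "K F p = (if cpt (fst p) (snd p) then F (point p) else 0)"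

lemma plc_K: "lc_P E F \<Longrightarrow> plc (K F)"
  using plc_point[of F] unfolding plc_def by (simp add: K_def)

lemma K_act:
  assumes F: "Clc_PG E \<Gamma> F" and \<gamma>: "\<gamma> \<in> \<Gamma>"
  shows "K F (act2 \<gamma> p) = K F p"
proof (cases "cpt (fst p) (snd p)")
  case True
  have "F (point (act2 \<gamma> p)) = F (point p)"
    using point_act[OF \<Gamma>_aut[OF \<gamma>] True] point_Pspace[OF True] F \<gamma> unfolding Clc_PG_def by simp
  then show ?thesis using True cpt_act[OF \<Gamma>_aut[OF \<gamma>]] by (simp add: K_def act2_def)
next
  case False
  then show ?thesis using cpt_act[OF \<Gamma>_aut[OF \<gamma>]] by (simp add: K_def act2_def)
qed

lemma T2_mult_K:
  assumes f: "f \<in> Tp" and F: "lc_P E F"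
  shows "(\<lambda>p. f (fst p) * K F p) \<in> T2"
proof -
  obtain X where X: "finite X" "\<And>c. f c \<noteq> 0 \<Longrightarrow> fchain E c \<and> fst (c 0) \<in> X"
    using Tp_support[OF f] by metis
  show ?thesis
    by (rule T2_I[OF _ X(1)])
       (use X(2) in \<open>auto simp: K_def intro!: plc_mult plc_fst Tp_lc f plc_K[OF F, unfolded K_def[abs_def]] split: if_splits\<close>)
qed

lemma K_section:
  assumes F: "lc_P E F"
  shows "(\<lambda>b. K F (a, b)) \<in> Tp"
proof -
  \<comment> \<open>The indicator is 1 wherever \<open>K F (a, b)\<close> is nonzero; it provides
    the compactly supported factor needed for \<open>T2_mult_K\<close>.\<close>
  have "(\<lambda>b. K F (a, b)) = (\<lambda>b. fib (fst (a 0)) a * K F (a, b))"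
    by (rule ext) (auto simp: K_def fib_eq cpt_def)
  then show ?thesis using T2_section[OF T2_mult_K[OF fib_Tp[of "fst (a 0)"] F], of a] by simp
qed

text \<open>Compatibility forces the origins to match, so by freeness at most one translate of
  \<open>b\<close> fits \<open>a\<close>. Invariance of \<open>F\<close> makes the value at the pair
  picked by \<open>SOME\<close> equal to that single term.\<close>

lemma ext_zero_per:
  assumes F: "Clc_PG E \<Gamma> F" and a: "fchain E a" and b: "fchain E b"
  shows "ext_zero E \<Gamma> F a (rev_chn b) = per \<Gamma> act_chn (\<lambda>b. K F (a, b)) b"
proof (cases "\<exists>\<gamma>1\<in>\<Gamma>. \<exists>\<gamma>2\<in>\<Gamma>. compat E (act_chn \<gamma>1 a) (act_chn \<gamma>2 (rev_chn b))")
  case True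
  define P where "P g \<longleftrightarrow> fst g \<in> \<Gamma> \<and> snd g \<in> \<Gamma> \<and>
      compat E (act_chn (fst g) a) (act_chn (snd g) (rev_chn b))" for g
  have "\<exists>g. P g" using True unfolding P_def by auto
  then have "P (SOME g. P g)" by (rule someI_ex)
  then obtain \<gamma> \<delta> where g: "(SOME g. P g) = (\<gamma>, \<delta>)" "\<gamma> \<in> \<Gamma>" "\<delta> \<in> \<Gamma>"
    "cpt (act_chn \<gamma> a) (act_chn \<delta> b)"
    unfolding P_def[of "SOME g. P g"] act_rev_chn compat_iff by (cases "SOME g. P g") auto
  \<comment> \<open>Translating the chosen pair by \<open>inv \<gamma>\<close> returns the first
    chain to \<open>a\<close> and leaves one group element acting on \<open>b\<close>.\<close>
  define \<epsilon> where "\<epsilon> = inv \<gamma> \<circ> \<delta>"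
  have \<epsilon>: "\<epsilon> \<in> \<Gamma>" unfolding \<epsilon>_def using \<Gamma>_comp \<Gamma>_inv g by blast
  have \<delta>: "act_chn \<delta> b = act_chn \<gamma> (act_chn \<epsilon> b)"
    unfolding \<epsilon>_def act_chn_comp[of "inv \<gamma>", symmetric] using \<Gamma>_act_inv[OF g(2)] by simp
  have cpt: "cpt a (act_chn \<epsilon> b)" using g(4) cpt_act[OF \<Gamma>_aut[OF g(2)]] unfolding \<delta> by blast
  have "ext_zero E \<Gamma> F a (rev_chn b) = F (triple_of E (act_chn \<gamma> a) (act_chn \<delta> (rev_chn b)))"
    using True g(1) unfolding ext_zero_def P_def by simp
  also have "\<dots> = K F (act2 \<gamma> (a, act_chn \<epsilon> b))"
    using g(4) unfolding act_rev_chn triple_of_eq \<delta> by (simp add: K_def act2_def)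
  also have "\<dots> = K F (a, act_chn \<epsilon> b)" by (rule K_act[OF F g(2)])
  also have "\<dots> = per \<Gamma> act_chn (\<lambda>b. K F (a, b)) b"
  proof -
    have "{\<gamma> \<in> \<Gamma>. K F (a, act_chn \<gamma> b) \<noteq> 0} \<subseteq> {\<epsilon>}"
    proof
      fix \<gamma> assume \<gamma>: "\<gamma> \<in> {\<gamma> \<in> \<Gamma>. K F (a, act_chn \<gamma> b) \<noteq> 0}"
      then have "cpt a (act_chn \<gamma> b)" by (auto simp: K_def split: if_splits)
      then have "\<gamma> (fst (b 0)) = \<epsilon> (fst (b 0))" using cpt by (simp add: cpt_def act_chn_apply)
      then show "\<gamma> \<in> {\<epsilon>}" using \<Gamma>_free \<epsilon> \<gamma> by blast
    qed
    then have "per \<Gamma> act_chn (\<lambda>b. K F (a, b)) b = (\<Sum>\<gamma>\<in>{\<epsilon>}. K F (a, act_chn \<gamma> b))"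
      unfolding per_def by (rule sum.mono_neutral_left[rotated]) (use \<epsilon> in auto)
    then show ?thesis by simp
  qed
  finally show ?thesis .
next
  case False
  have "K F (a, act_chn \<gamma> b) = 0" if "\<gamma> \<in> \<Gamma>" for \<gamma>
  proof -
    have "\<not> compat E (act_chn id a) (act_chn \<gamma> (rev_chn b))" using False \<Gamma>_id that by blast
    then show ?thesis unfolding act_rev_chn compat_iff by (simp add: K_def)
  qed
  then have "per \<Gamma> act_chn (\<lambda>b. K F (a, b)) b = 0" unfolding per_def by (simp cong: conj_cong)
  then show ?thesis using False unfolding ext_zero_def by simp
qed

lemma per_cutoff:
  assumes "cutoff_shift (Pplus E) pi_plus \<Gamma> f" "fchain E c"
  shows "per \<Gamma> act_chn f c = 1"
  using assms unfolding cutoff_shift_def per_def Pplus_def by blast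

lemma cutoff_minus:
  assumes "cutoff_shift (Pminus E) pi_minus \<Gamma> f"
  shows "cutoff_shift (Pplus E) pi_plus \<Gamma> (\<lambda>c. f (rev_chn c))"
  using assms unfolding cutoff_shift_def
  by (simp add: Tm_iff act_rev_chn[symmetric] rev_chn_Pminus[symmetric])

text \<open>For fixed \<open>a\<close> the inner functional sees \<open>Xim\<close> times a
  periodization. Unfolding moves the sum onto \<open>Xim\<close>, whose periodization is 1, and only
  the forward cut-off survives.\<close>

lemma tensor_eq:
  assumes u: "inv_dual u" and v: "inv_dual v" and F: "Clc_PG E \<Gamma> F"
    and Xip: "cutoff_shift (Pplus E) pi_plus \<Gamma> Xip" and Xim: "cutoff_shift (Pplus E) pi_plus \<Gamma> Xim"
  shows "u (\<lambda>a. v (\<lambda>b. ext_zero E \<Gamma> F a (rev_chn b) * Xim b) * Xip a)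
    = tens u v (\<lambda>p. Xip (fst p) * K F p)"
proof -
  have lcF: "lc_P E F" using F by (simp add: Clc_PG_def)
  have Xp: "Xip \<in> Tp" and Xm: "Xim \<in> Tp" using Xip Xim by (auto simp: cutoff_shift_def)
  have off: "f c = 0" if "f \<in> Tp" "\<not> fchain E c" for f c
    using that by (simp add: test_shift_def Pplus_def)
  have vd: "is_dual Tp v" using v by (simp add: inv_dual_def)
  have "v (\<lambda>b. ext_zero E \<Gamma> F a (rev_chn b) * Xim b) * Xip a = v (\<lambda>b. Xip a * K F (a, b))" for a
  proof (cases "fchain E a")
    case True
    have eq: "ext_zero E \<Gamma> F a (rev_chn b) * Xim b = Xim b * per \<Gamma> act_chn (\<lambda>b. K F (a, b)) b" for b
      by (cases "fchain E b") (simp_all add: ext_zero_per[OF F True] off[OF Xm])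
    have eq': "per \<Gamma> act_chn Xim b * K F (a, b) = K F (a, b)" for b
      by (cases "fchain E b") (simp_all add: per_cutoff[OF Xim] K_def cpt_def)
    have "v (\<lambda>b. ext_zero E \<Gamma> F a (rev_chn b) * Xim b) = v (\<lambda>b. K F (a, b))"
      unfolding eq per_adjoint_chain[OF v Xm K_section[OF lcF]] eq' ..
    then show ?thesis using dual_scale[OF vd K_section[OF lcF]] by simp
  next
    case False
    then show ?thesis using off[OF Xp] dual_scale[OF vd Tp_zero, of 0] by simp
  qed
  then show ?thesis using T2_mult_K[OF Xp lcF] by (simp add: tens_def)
qed

lemma T2_cutoff_P:
  assumes "lc_P E Xi" "cpt_P E Xi"
  shows "K Xi \<in> T2"
proof (rule T2_I)
  show "plc (K Xi)" by (rule plc_K[OF assms(1)])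
  show "finite {x. \<exists>\<omega>' \<omega>. (\<omega>', \<omega>, x) \<in> Pspace E \<and> Xi (\<omega>', \<omega>, x) \<noteq> 0}"
    using assms(2) by (simp add: cpt_P_def)
  fix a b assume nz: "K Xi (a, b) \<noteq> 0"
  then show cpt: "cpt a b" by (auto simp: K_def split: if_splits)
  have "point (a, b) \<in> Pspace E" "Xi (point (a, b)) \<noteq> 0" using point_Pspace[OF cpt] nz cpt by (auto simp: K_def)
  then show "fst (a 0) \<in> {x. \<exists>\<omega>' \<omega>. (\<omega>', \<omega>, x) \<in> Pspace E \<and> Xi (\<omega>', \<omega>, x) \<noteq> 0}"
    by (auto simp: point_def)
qed

text \<open>Unfold with \<open>h = K Xi\<close> and \<open>g p = Xip (fst p) * K F p\<close>. Since
  \<open>K F\<close> is invariant, periodizing \<open>g\<close> reproduces \<open>K F\<close>, while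
  periodizing \<open>h\<close> gives 1 on compatible pairs; the two sides of the adjunction are the
  two cut-offs.\<close>

lemma change_cutoff:
  assumes u: "inv_dual u" and v: "inv_dual v" and F: "Clc_PG E \<Gamma> F"
    and Xi: "cutoff_P E \<Gamma> Xi" and Xip: "cutoff_shift (Pplus E) pi_plus \<Gamma> Xip"
  shows "tens u v (\<lambda>p. K Xi p * K F p) = tens u v (\<lambda>p. Xip (fst p) * K F p)"
proof -
  have lcF: "lc_P E F" using F by (simp add: Clc_PG_def)
  have Xp: "Xip \<in> Tp" using Xip by (simp add: cutoff_shift_def)
  define g where "g p = Xip (fst p) * K F p" for p
  have gT: "g \<in> T2" unfolding g_def using T2_mult_K[OF Xp lcF] .
  have hT: "K Xi \<in> T2" using T2_cutoff_P Xi by (simp add: cutoff_P_def)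
  have left: "K Xi p * per \<Gamma> act2 g p = K Xi p * K F p" for p
  proof (cases "K F p = 0")
    case True
    then have "g (act2 \<gamma> p) = 0" if "\<gamma> \<in> \<Gamma>" for \<gamma> using K_act[OF F that] by (simp add: g_def)
    then show ?thesis using True unfolding per_def by (simp cong: conj_cong)
  next
    case False
    then have fc: "fchain E (fst p)" by (auto simp: K_def cpt_def split: if_splits)
    have g: "g (act2 \<gamma> p) = Xip (act_chn \<gamma> (fst p)) * K F p" if "\<gamma> \<in> \<Gamma>" for \<gamma>
      using K_act[OF F that] by (simp add: g_def act2_def)
    have "per \<Gamma> act2 g p = per \<Gamma> act_chn Xip (fst p) * K F p"
      unfolding per_def sum_distrib_right by (rule sum.cong) (use False g in auto)
    then show ?thesis using per_cutoff[OF Xip fc] by simp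
  qed
  have right: "per \<Gamma> act2 (K Xi) p * g p = g p" for p
  proof (cases "cpt (fst p) (snd p)")
    case True
    have h: "K Xi (act2 \<gamma> p) = Xi (act_P \<gamma> (point p))" if "\<gamma> \<in> \<Gamma>" for \<gamma>
      using point_act[OF \<Gamma>_aut[OF that] True] cpt_act[OF \<Gamma>_aut[OF that]] True by (simp add: K_def act2_def)
    have "per \<Gamma> act2 (K Xi) p = (\<Sum>\<gamma>\<in>{\<gamma> \<in> \<Gamma>. Xi (act_P \<gamma> (point p)) \<noteq> 0}. Xi (act_P \<gamma> (point p)))"
      unfolding per_def by (rule sum.cong) (use h in auto)
    also have "\<dots> = 1" using Xi point_Pspace[OF True] by (simp add: cutoff_P_def)
    finally show ?thesis by simp
  next
    case False
    then show ?thesis by (simp add: g_def K_def)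
  qed
  show ?thesis using per_adjoint_pair[OF u v hT gT] unfolding left right by (simp add: g_def)
qed

end

section \<open>Invariance and complex conjugation\<close>

lemma (in eigenfunction) ures_inv_dual:
  assumes "good_group E \<Gamma>" "\<forall>\<gamma>\<in>\<Gamma>. \<forall>x. \<phi> (\<gamma> x) = \<phi> x"
  shows "tree_group.inv_dual E \<Gamma> ures"
proof -
  interpret tree_group E q \<Gamma> by unfold_locales (rule assms(1))
  show ?thesis
    unfolding inv_dual_def using resonant_dual[OF ures_resonant] ures_invariant \<Gamma>_aut assms(2) by blast
qed

lemma (in eigenfunction) eigenfunction_cnj: "eigenfunction E q (- cnj s) (\<lambda>x. cnj (\<phi> x))"
proof
  have pw: "cnj (of_nat q powr w) = of_nat q powr cnj w" for w :: complex
    using cnj_powr[of "of_nat q" w] by simp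
  have chi: "chi q (- cnj s) = cnj (chi q s)"
    unfolding chi_def by (simp add: pw)
  show "chi q (- cnj s) \<notin> {1, -1}"
    unfolding chi using chi_ne by (metis complex_cnj_cnj complex_cnj_minus complex_cnj_one insert_iff singletonD)
  have "lap E q (\<lambda>x. cnj (\<phi> x)) x = cnj (lap E q \<phi> x)" for x by (simp add: lap_def)
  then show "lap E q (\<lambda>x. cnj (\<phi> x)) = (\<lambda>x. chi q (- cnj s) * cnj (\<phi> x))"
    unfolding chi using eigen by (simp add: fun_eq_iff)
qed

text \<open>The bracket is an integer and the base \<open>q\<close> is nonnegative, so conjugating
  the kernel only conjugates the exponent: the conjugate of \<open>1/2 + \<i> * s\<close> is
  \<open>1/2 + \<i> * (- cnj s)\<close>.\<close>

lemma (in eigenfunction) is_bval_conj: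
  assumes "is_bval bo \<mu>"
  shows "eigenfunction.is_bval E q (- cnj s) (\<lambda>x. cnj (\<phi> x)) bo (conj_dist \<mu>)"
proof -
  interpret c: eigenfunction E q "- cnj s" "\<lambda>x. cnj (\<phi> x)" by (rule eigenfunction_cnj)
  have dual: "is_dual (test_Omega E) \<mu>" and pois: "poisson E q bo s \<mu> = \<phi>"
    using assms by (auto simp: is_bval_def)
  have pw: "cnj (of_nat q powr w) = of_nat q powr cnj w" for w :: complex
    using cnj_powr[of "of_nat q" w] by simp
  have test_cnj: "(\<lambda>\<omega>. cnj (f \<omega>)) \<in> test_Omega E \<longleftrightarrow> f \<in> test_Omega E" for f
    unfolding test_Omega_def lc_Omega_def by simp
  have "is_dual (test_Omega E) (conj_dist \<mu>)"
    unfolding is_dual_def conj_dist_def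
    by (auto simp: test_cnj dual_add[OF dual] dual_scale[OF dual] dual_off[OF dual])
  moreover have "poisson E q bo (- cnj s) (conj_dist \<mu>) = (\<lambda>x. cnj (\<phi> x))"
  proof
    fix x
    have "cnj (pker E q bo (- cnj s) x \<omega>) = pker E q bo s x \<omega>" for \<omega>
      unfolding pker_def by (simp add: pw)
    then have "poisson E q bo (- cnj s) (conj_dist \<mu>) x = cnj (poisson E q bo s \<mu> x)"
      unfolding poisson_def integ_Omega_def conj_dist_def by (simp add: if_distrib[of cnj] cong: if_cong)
    then show "poisson E q bo (- cnj s) (conj_dist \<mu>) x = cnj (\<phi> x)" by (simp add: pois)
  qed
  ultimately show ?thesis unfolding c.is_bval_def by blast
qed

context reg_tree
begin

text \<open>Functions in \<open>T2\<close> live on pairs of chains with a common origin \<open>x\<close>, so a single sum over \<open>x\<close>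
  remains.\<close>

lemma tens_boundary:
  assumes \<mu>: "\<And>f. f \<in> Tp \<Longrightarrow> u f = \<mu> (pull bo s f)"
    and \<nu>: "\<And>f. f \<in> Tp \<Longrightarrow> v f = \<nu> (pull bo t f)"
    and \<nu>d: "is_dual (test_Omega E) \<nu>" and vd: "is_dual Tp v"
    and \<Phi>: "\<Phi> \<in> T2" and X: "finite X" "\<forall>a b. \<Phi> (a, b) \<noteq> 0 \<longrightarrow> fst (a 0) \<in> X"
  shows "tens u v \<Phi> = integ_Omega E \<mu> (\<lambda>\<omega>. integ_Omega E \<nu> (\<lambda>\<omega>'.
      \<Sum>x\<in>X. pker E q bo s x \<omega> * (pker E q bo t x \<omega>' * \<Phi> (ray x \<omega>, ray x \<omega>'))))"
proof -
  have inner: "pull bo s (\<lambda>a. v (\<lambda>b. \<Phi> (a, b))) \<omega> = integ_Omega E \<nu> (\<lambda>\<omega>'.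
      \<Sum>x\<in>X. pker E q bo s x \<omega> * (pker E q bo t x \<omega>' * \<Phi> (ray x \<omega>, ray x \<omega>')))" if \<omega>: "\<omega> \<in> Omega E" for \<omega>
  proof -
    have v0: "v (\<lambda>_. 0) = 0" using dual_scale[OF vd Tp_zero, of 0] by simp
    have supp: "\<forall>a. v (\<lambda>b. \<Phi> (a, b)) \<noteq> 0 \<longrightarrow> fst (a 0) \<in> X"
    proof (intro allI impI)
      fix a assume "v (\<lambda>b. \<Phi> (a, b)) \<noteq> 0"
      then have "(\<lambda>b. \<Phi> (a, b)) \<noteq> (\<lambda>_. 0)" using v0 by metis
      then obtain b where "\<Phi> (a, b) \<noteq> 0" by blast
      then show "fst (a 0) \<in> X" using X(2) by blast
    qed
    let ?f = "\<lambda>x \<omega>'. pker E q bo s x \<omega> * pull bo t (\<lambda>b. \<Phi> (ray x \<omega>, b)) \<omega>'"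
    have sec: "(\<lambda>b. \<Phi> (ray x \<omega>, b)) \<in> Tp" for x by (rule T2_section[OF \<Phi>])
    have "pull bo s (\<lambda>a. v (\<lambda>b. \<Phi> (a, b))) \<omega> = (\<Sum>x\<in>X. pker E q bo s x \<omega> * v (\<lambda>b. \<Phi> (ray x \<omega>, b)))"
      by (rule pull_eq[OF X(1) supp \<omega>])
    also have "\<dots> = (\<Sum>x\<in>X. \<nu> (?f x))"
      by (simp add: \<nu>[OF sec] dual_scale[OF \<nu>d pull_test[OF sec]])
    also have "\<dots> = \<nu> (\<lambda>\<omega>'. \<Sum>x\<in>X. ?f x \<omega>')"
    proof -
      have "(\<lambda>_. 0) \<in> test_Omega E"        unfolding test_Omega_iff[of _ bo] by (simp add: olc_const)
      then have "(\<lambda>\<omega>'. \<Sum>x\<in>X. ?f x \<omega>') \<in> test_Omega E \<and> \<nu> (\<lambda>\<omega>'. \<Sum>x\<in>X. ?f x \<omega>') = (\<Sum>x\<in>X. \<nu> (?f x))"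
        by (rule dual_sum[OF \<nu>d _ test_Omega_add _]) (assumption | rule test_Omega_scale[OF pull_test[OF sec]])+
      then show ?thesis by (rule conjunct2[THEN sym])
    qed
    also have "(\<lambda>\<omega>'. \<Sum>x\<in>X. ?f x \<omega>') = (\<lambda>\<omega>'. if \<omega>' \<in> Omega E then
        \<Sum>x\<in>X. pker E q bo s x \<omega> * (pker E q bo t x \<omega>' * \<Phi> (ray x \<omega>, ray x \<omega>')) else 0)"
    proof
      fix \<omega>'
      show "(\<Sum>x\<in>X. ?f x \<omega>') = (if \<omega>' \<in> Omega E then
        \<Sum>x\<in>X. pker E q bo s x \<omega> * (pker E q bo t x \<omega>' * \<Phi> (ray x \<omega>, ray x \<omega>')) else 0)"
      proof (cases "\<omega>' \<in> Omega E")
        case True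
        \<comment> \<open>The second chain must start where the first does, so of the sum over
          origins only the term at \<open>x\<close> remains.\<close>
        have "pull bo t (\<lambda>b. \<Phi> (ray x \<omega>, b)) \<omega>' = pker E q bo t x \<omega>' * \<Phi> (ray x \<omega>, ray x \<omega>')" for x
        proof -
          have "\<forall>b. \<Phi> (ray x \<omega>, b) \<noteq> 0 \<longrightarrow> fst (b 0) \<in> {x}"
          proof (intro allI impI)
            fix b assume "\<Phi> (ray x \<omega>, b) \<noteq> 0"
            then have "cpt (ray x \<omega>) b" by (rule T2_cpt[OF \<Phi>])
            then show "fst (b 0) \<in> {x}" using ray_start[OF \<omega>, of x] by (simp add: cpt_def)
          qed
          from pull_eq[OF _ this True, of bo t] show ?thesis by simp
        qed
        then show ?thesis using True by simp
      next
        case False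
        then show ?thesis by (simp add: pull_off)
      qed
    qed
    finally show ?thesis by (simp add: integ_Omega_def)
  qed
  have "tens u v \<Phi> = \<mu> (pull bo s (\<lambda>a. v (\<lambda>b. \<Phi> (a, b))))"
    using \<Phi> \<mu>[OF T2_integral[OF \<Phi> vd]] by (simp add: tens_def)
  also have "pull bo s (\<lambda>a. v (\<lambda>b. \<Phi> (a, b))) = (\<lambda>\<omega>. if \<omega> \<in> Omega E then integ_Omega E \<nu> (\<lambda>\<omega>'.
      \<Sum>x\<in>X. pker E q bo s x \<omega> * (pker E q bo t x \<omega>' * \<Phi> (ray x \<omega>, ray x \<omega>'))) else 0)"
    by (rule ext) (simp add: inner pull_off)
  finally show ?thesis unfolding integ_Omega_def .
qed

end

theorem theorem3p14:
  fixes E :: "('v \<times> 'v) set" and q :: nat and bo :: 'v and \<Gamma> :: "('v \<Rightarrow> 'v) set"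
    and s s' :: complex and \<phi> \<phi>' :: "'v \<Rightarrow> complex"
    and XiP :: "'v chn set \<times> 'v chn set \<times> 'v \<Rightarrow> complex"
    and XiPlus XiMinus :: "'v chn \<Rightarrow> complex"
    and F :: "'v chn set \<times> 'v chn set \<times> 'v \<Rightarrow> complex"
  assumes "q \<ge> 2" and "regular_tree E q" and "good_group E \<Gamma>"
    and "chi q s \<notin> {1, -1}" and "chi q s' \<notin> {1, -1}"
    and "\<forall>\<gamma>\<in>\<Gamma>. \<forall>x. \<phi> (\<gamma> x) = \<phi> x" and "\<forall>\<gamma>\<in>\<Gamma>. \<forall>x. \<phi>' (\<gamma> x) = \<phi>' x"
    and "lap E q \<phi> = (\<lambda>x. chi q s * \<phi> x)" and "lap E q \<phi>' = (\<lambda>x. chi q s' * \<phi>' x)"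
    and "cutoff_P E \<Gamma> XiP"
    and "cutoff_shift (Pplus E) pi_plus \<Gamma> XiPlus"
    and "cutoff_shift (Pminus E) pi_minus \<Gamma> XiMinus"
    and "Clc_PG E \<Gamma> F"
  shows "PS E q bo XiP s s' \<phi> \<phi>' F =
    tensor_shift (Iop E q (Pplus E) pi_plus XiPlus s \<phi>)
                 (Iop E q (Pminus E) pi_minus XiMinus (- cnj s') (\<lambda>x. cnj (\<phi>' x)))
                 (ext_zero E \<Gamma> F)"
proof -
  interpret tree_group E q \<Gamma> by unfold_locales (use assms in auto)
  interpret p: eigenfunction E q s \<phi> by unfold_locales (use assms in auto)
  interpret m0: eigenfunction E q s' \<phi>' by unfold_locales (use assms in auto)
  interpret m: eigenfunction E q "- cnj s'" "\<lambda>x. cnj (\<phi>' x)" by (rule m0.eigenfunction_cnj)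
  define \<mu> \<nu> where "\<mu> = bval E q bo s \<phi>" and "\<nu> = conj_dist (bval E q bo s' \<phi>')"
  have \<mu>: "p.is_bval bo \<mu>" unfolding \<mu>_def by (rule p.is_bval_bval)
  have \<nu>: "m.is_bval bo \<nu>" unfolding \<nu>_def by (rule m0.is_bval_conj[OF m0.is_bval_bval])
  have u: "inv_dual p.ures" and v: "inv_dual m.ures"
    using p.ures_inv_dual m.ures_inv_dual assms by auto
  have lcF: "lc_P E F" using assms by (simp add: Clc_PG_def)
  define X where "X = {x. \<exists>\<omega>' \<omega>. (\<omega>', \<omega>, x) \<in> Pspace E \<and> XiP (\<omega>', \<omega>, x) \<noteq> 0}"
  have X: "finite X" using assms by (simp add: X_def cutoff_P_def cpt_P_def)
  define \<Phi> where "\<Phi> p = K XiP p * K F p" for p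
  have Xi_T2: "K XiP \<in> T2" using T2_cutoff_P assms by (simp add: cutoff_P_def)
  have \<Phi>X: "\<forall>a b. \<Phi> (a, b) \<noteq> 0 \<longrightarrow> fst (a 0) \<in> X"
  proof (intro allI impI)
    fix a b assume "\<Phi> (a, b) \<noteq> 0"
    then have "cpt a b" "XiP (point (a, b)) \<noteq> 0" by (auto simp: \<Phi>_def K_def split: if_splits)
    then show "fst (a 0) \<in> X" using point_Pspace[of a b] by (auto simp: X_def point_def)
  qed
  have \<Phi>: "\<Phi> \<in> T2"
  proof (rule T2_I[OF _ X])
    show "plc \<Phi>" unfolding \<Phi>_def by (rule plc_mult[OF T2_plc[OF Xi_T2] plc_K[OF lcF]])
  qed (use \<Phi>X in \<open>auto simp: \<Phi>_def K_def split: if_splits\<close>)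
  \<comment> \<open>On rays the compatibility built into \<open>K\<close> is membership in the
    geodesic. It fails on the diagonal, so the case distinction is absorbed, and the sum may run
    over the fixed set \<open>X\<close> instead of a set varying with the boundary points.\<close>
  have integrand: "(if \<omega>' = \<omega> then 0 else (\<Sum>x\<in>{x \<in> geod_verts E \<omega>' \<omega>. XiP (\<omega>', \<omega>, x) \<noteq> 0}.
      XiP (\<omega>', \<omega>, x) * F (\<omega>', \<omega>, x) * pker E q bo s x \<omega> * pker E q bo (- cnj s') x \<omega>'))
    = (\<Sum>x\<in>X. pker E q bo s x \<omega> * (pker E q bo (- cnj s') x \<omega>' * \<Phi> (ray x \<omega>, ray x \<omega>')))"
    if \<omega>: "\<omega> \<in> Omega E" "\<omega>' \<in> Omega E" for \<omega> \<omega>'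
  proof -
    have \<Phi>_ray: "\<Phi> (ray x \<omega>, ray x \<omega>')
        = (if x \<in> geod_verts E \<omega>' \<omega> then XiP (\<omega>', \<omega>, x) * F (\<omega>', \<omega>, x) else 0)" for x
      unfolding \<Phi>_def K_def fst_conv snd_conv cpt_ray[OF \<omega>] geod_verts_iff[OF \<omega>] by simp
    show ?thesis
    proof (cases "\<omega>' = \<omega>")
      case True
      have "\<Phi> (ray x \<omega>, ray x \<omega>') = 0" for x
        using \<Phi>_ray[of x] geod_verts_iff[OF \<omega>, of x] True by simp
      then show ?thesis using True by simp
    next
      case False
      have "{x \<in> geod_verts E \<omega>' \<omega>. XiP (\<omega>', \<omega>, x) \<noteq> 0} \<subseteq> X"
        unfolding X_def Pspace_def using \<omega> False by blast
      then have "(\<Sum>x\<in>{x \<in> geod_verts E \<omega>' \<omega>. XiP (\<omega>', \<omega>, x) \<noteq> 0}.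
          pker E q bo s x \<omega> * (pker E q bo (- cnj s') x \<omega>' * \<Phi> (ray x \<omega>, ray x \<omega>')))
        = (\<Sum>x\<in>X. pker E q bo s x \<omega> * (pker E q bo (- cnj s') x \<omega>' * \<Phi> (ray x \<omega>, ray x \<omega>')))"
        by (intro sum.mono_neutral_left[OF X]) (auto simp: \<Phi>_ray)
      moreover have "(\<Sum>x\<in>{x \<in> geod_verts E \<omega>' \<omega>. XiP (\<omega>', \<omega>, x) \<noteq> 0}.
          XiP (\<omega>', \<omega>, x) * F (\<omega>', \<omega>, x) * pker E q bo s x \<omega> * pker E q bo (- cnj s') x \<omega>')
        = (\<Sum>x\<in>{x \<in> geod_verts E \<omega>' \<omega>. XiP (\<omega>', \<omega>, x) \<noteq> 0}.
          pker E q bo s x \<omega> * (pker E q bo (- cnj s') x \<omega>' * \<Phi> (ray x \<omega>, ray x \<omega>')))"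
        by (rule sum.cong) (auto simp: \<Phi>_ray)
      ultimately show ?thesis using False by simp
    qed
  qed
  have "PS E q bo XiP s s' \<phi> \<phi>' F = integ_Omega E \<mu> (\<lambda>\<omega>. integ_Omega E \<nu> (\<lambda>\<omega>'.
      \<Sum>x\<in>X. pker E q bo s x \<omega> * (pker E q bo (- cnj s') x \<omega>' * \<Phi> (ray x \<omega>, ray x \<omega>'))))"
    unfolding PS_def \<mu>_def[symmetric] \<nu>_def[symmetric] integ_Omega_def
    by (simp add: integrand cong: if_cong)
  also have "\<dots> = tens p.ures m.ures \<Phi>"
  proof (rule tens_boundary[symmetric])
    show "is_dual (test_Omega E) \<nu>" "is_dual Tp m.ures"
      using \<nu> v by (simp_all add: m.is_bval_def inv_dual_def)
  qed (fact p.ures_pull[OF \<mu>] m.ures_pull[OF \<nu>] \<Phi> X \<Phi>X)+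
  also have "\<dots> = tens p.ures m.ures (\<lambda>p. XiPlus (fst p) * K F p)"
    unfolding \<Phi>_def by (rule change_cutoff[OF u v]) (use assms in auto)
  \<comment> \<open>Backward chains are represented by their reversals here, so the backward cut-off
    enters composed with \<open>rev_chn\<close>, as provided by \<open>cutoff_minus\<close>.\<close>
  also have "\<dots> = p.ures (\<lambda>a. m.ures (\<lambda>b. ext_zero E \<Gamma> F a (rev_chn b) * XiMinus (rev_chn b)) * XiPlus a)"
    by (rule tensor_eq[OF u v, symmetric]) (use assms cutoff_minus in auto)
  also have "\<dots> = tensor_shift (Iop E q (Pplus E) pi_plus XiPlus s \<phi>)
                 (Iop E q (Pminus E) pi_minus XiMinus (- cnj s') (\<lambda>x. cnj (\<phi>' x)))
                 (ext_zero E \<Gamma> F)"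
    unfolding tensor_shift_def Iop_def p.resonant_eqI[OF p.ures_resonant] m.resonant_minus ..
  finally show ?thesis .
qed

end
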